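(* Let $D>\mathsf p+1$ and $L>1$. Suppose that the following conditions hold. (1) There exist $\mathcal C$-measurable (real-valued) random variables $U$ and $V$ such that for every $\mathcal T\in\mathfrak T$, $$P_{\mathcal C}\Big[S_T\Big(r,\frac{U}{r^D}\Big)\Big]\Psi_T\le\frac{V}{r^L}\quad\text{a.s.}\qquad(T\in\mathcal T,\ r\in\mathbb N).$$ (2) For every $\epsilon>0$, $c>0$ and $\mathcal T\in\mathfrak T$, $\ \limsup_{T\to\infty,\,T\in\mathcal T}P_{\mathcal C}[W_T(\delta,c,\epsilon)]\Psi_T\to^P 0$ as $\delta\downarrow0$. (3) (i) For any $k\in\mathbb N$, $u_1,\dots,u_k\in\mathbb R^{\mathsf p}$, $f\in C_b(\mathbb R^{k})$ and any bounded $\mathcal G$-measurable random variable $Y$, $$E_{\mathcal C}\big[f\big((\mathbb Z_T(u_i))_{i=1,\dots,k}\big)\Psi_TY\big]\to^P\overline E_{\mathcal C}\big[f\big((\mathbb Z(u_i))_{i=1,\dots,k}\big)Y\big]\quad(T\to\infty);$$ (ii) $\Psi_T\to^P1$ as $T\to\infty$. Then $$E_{\mathcal C}[f(\tilde u_T)Y]\to^P\overline E_{\mathcal C}[f(\tilde u)Y]\quad(T\to\infty)$$ for any $f\in C_b(\mathbb R^{\mathsf p})$ and any bounded $\mathcal G$-measurable random variable $Y$, where $$\tilde u=\frac{\int_{\mathbb R^{\mathsf p}}u\,\mathbb Z(u)\,du}{\int_{\mathbb R^{\mathsf p}}\mathbb Z(u)\,du}.$$ In particular, $\tilde u_T\to^{d_s(\mathcal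 G)}\tilde u$ as $T\to\infty$.
   Context: $(\Omega,\mathcal F,P)$ is a probability space, $\mathbb T\subset[0,\infty)$ with $\sup\mathbb T=\infty$, $\Theta$ is a bounded domain in $\mathbb R^{\mathsf p}$ with closure $\overline\Theta$, and $\theta^*\in\Theta$. For $T\in\mathbb T$, $\mathbb H_T:\Omega\times\overline\Theta\to\mathbb R$ is a jointly measurable random field, continuous in $\theta\in\overline\Theta$ for every $\omega$. The matrices $a_T\in GL(\mathbb R^{\mathsf p})$ satisfy $a_T\to0$ as $T\to\infty$. Put $\theta_T^\dagger(u)=\theta^*+a_Tu$, $\mathbb U_T=\{u\in\mathbb R^{\mathsf p}:\theta_T^\dagger(u)\in\Theta\}$ and $\mathbb Z_T(u)=\exp\big(\mathbb H_T(\theta_T^\dagger(u))-\mathbb H_T(\theta^* )\big)$ for $u\in\mathbb U_T$. The field $\mathbb Z_T$ is extended to $\mathbb R^{\mathsf p}$ as a (measurable, nonnegative) continuous random field with compact support and $\sup_{u\in\mathbb R^{\mathsf p}\setminus\mathbb U_T}\mathbb Z_T(u)\le\max_{u\in\partial\mathbb U_T}\mathbb Z_T(u)$; the extension is also denoted $\mathbb Z_T$. $\hat C=\{f\in C(\mathbb R^{\mathsf p}):\lim_{|u|\to\infty}f(u)=0\}$ with the supremum norm. The quasi Bayesian estimator with respect to a prior density $\varpi$ is $$\tilde\theta_T=\Big[\int_\Theta\exp(\mathbb H_T(\theta))\varpi(\theta)d\theta\Big]^{-1}\int_\Theta\theta\exp(\mathbb H_T(\theta))\varpi(\theta)d\theta,$$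 where $\varpi$ is continuous on $\Theta$ with $0<\inf_\Theta\varpi\le\sup_\Theta\varpi<\infty$; $\tilde u_T=a_T^{-1}(\tilde\theta_T-\theta^* )$. $\mathcal C\subset\mathcal G\subset\mathcal F$ are $\sigma$-fields; $P_{\mathcal C}$, $E_{\mathcal C}$ denote conditional probability and expectation given $\mathcal C$. $\Psi_T$ ($T\in\mathbb T$) are $[0,1]$-valued $\mathcal C$-measurable random variables. $T_0>0$ is fixed, and $\mathfrak T$ is the set of sequences $(T_n)_{n\in\mathbb N}$ in $\mathbb T$ with $T_n\ge T_0$ for all $n$ and $T_n\to\infty$. $\mathbb V_T(r)=\{u\in\mathbb U_T:|u|\ge r\}$ and $S_T(r,\epsilon)=\{\sup_{u\in\mathbb V_T(r)}\mathbb Z_T(u)\ge\epsilon\}$ (the supremum over the empty set being $0$). For $c>0$, $B_{c,T}=\{u\in\mathbb R^{\mathsf p}:|u|<c,\ \theta_T^\dagger(u)\in\Theta\}$, $w_T(\delta,c)=\sup\{|\log\mathbb Z_T(u_2)-\log\mathbb Z_T(u_1)|:u_1,u_2\in B_{c,T},|u_2-u_1|\le\delta\}$, and $W_T(\delta,c,\epsilon)=\{w_T(\delta,c)>\epsilon\}$. $(\overline\Omega,\overline{\mathcal F},\overline P)$ is an extension of $(\Omega,\mathcal F,P)$ (random variables on $\Omega$ are regarded as random variables on $\overline\Omega$, and $\overline P|_{\mathcal F}=P$), with conditional expectation $\overline E_{\mathcal C}$ given $\mathcal C$; $\mathbb Z$ is a $\hat C$-valued random variable on it. $\to^P$ is convergence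 in probability. $\tilde u_T\to^{d_s(\mathcal G)}\tilde u$ ($\mathcal G$-stable convergence) means $E[f(\tilde u_T)Y]\to\overline E[f(\tilde u)Y]$ for all $f\in C_b(\mathbb R^{\mathsf p})$ and all bounded $\mathcal G$-measurable $Y$. *)

theory Defs
  imports "HOL-Probability.Probability"
begin

definition conditional_prob :: "'w measure \<Rightarrow> 'w measure \<Rightarrow> 'w set \<Rightarrow> 'w \<Rightarrow> real" where
  "conditional_prob M C A = real_cond_exp M C (indicator A)"

definition tendsto_in_prob ::
  "'w measure \<Rightarrow> ('i \<Rightarrow> 'w \<Rightarrow> real) \<Rightarrow> ('w \<Rightarrow> real) \<Rightarrow> 'i filter \<Rightarrow> bool" where
  "tendsto_in_prob M X Y F \<longleftrightarrow>
     (\<forall>e>0. ((\<lambda>i. measure M {\<omega> \<in> space M. \<bar>X i \<omega> - Y \<omega>\<bar> > e}) \<longlongrightarrow> 0) F)"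

text \<open>
  An extension of a probability space \<open>M\<close> is a probability space \<open>Mb\<close> with a measure preserving
  map \<open>\<pi>\<close> to \<open>M\<close>. A random variable \<open>X\<close> on \<open>M\<close> is regarded as the random variable
  \<open>\<lambda>\<omega>. X (\<pi> \<omega>)\<close> on \<open>Mb\<close>, and a sub-sigma-field \<open>C\<close> of \<open>M\<close> as the sub-sigma-field of
  \<open>Mb\<close> formed by the preimages under \<open>\<pi>\<close> of the members of \<open>C\<close>.
\<close>

definition is_extension :: "'w measure \<Rightarrow> 'v measure \<Rightarrow> ('v \<Rightarrow> 'w) \<Rightarrow> bool" where
  "is_extension M Mb \<pi> \<longleftrightarrow> prob_space Mb \<and> \<pi> \<in> measurable Mb M \<and> distr Mb M \<pi> = M"

definition ext_cond_exp ::
  "'v measure \<Rightarrow> ('v \<Rightarrow> 'w) \<Rightarrow> 'w measure \<Rightarrow> ('v \<Rightarrow> real) \<Rightarrow> 'v \<Rightarrow> real" where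
  "ext_cond_exp Mb \<pi> C X = real_cond_exp Mb (vimage_algebra (space Mb) \<pi> C) X"

definition stably_converges ::
  "'w measure \<Rightarrow> 'w measure \<Rightarrow> 'v measure \<Rightarrow> ('v \<Rightarrow> 'w) \<Rightarrow>
   ('i \<Rightarrow> 'w \<Rightarrow> 'a::topological_space) \<Rightarrow> ('v \<Rightarrow> 'a) \<Rightarrow> 'i filter \<Rightarrow> bool" where
  "stably_converges M G Mb \<pi> X Xlim F \<longleftrightarrow>
     (\<forall>(f :: 'a \<Rightarrow> real) Y.
        continuous_on UNIV f \<longrightarrow> bounded (range f) \<longrightarrow>
        Y \<in> borel_measurable G \<longrightarrow> bounded (Y ` space G) \<longrightarrow>
        ((\<lambda>i. \<integral>\<omega>. f (X i \<omega>) * Y \<omega> \<partial>M) \<longlongrightarrow> (\<integral>\<omega>. f (Xlim \<omega>) * Y (\<pi> \<omega>) \<partial>Mb)) F)"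

definition at_top_in :: "real set \<Rightarrow> real filter" where
  "at_top_in TT = inf at_top (principal TT)"

definition index_seqs :: "real set \<Rightarrow> real \<Rightarrow> (nat \<Rightarrow> real) set" where
  "index_seqs TT T0 =
     {\<tau>. (\<forall>n. \<tau> n \<in> TT \<and> \<tau> n \<ge> T0) \<and> filterlim \<tau> at_top sequentially}"

text \<open>The scaling matrix \<open>a\<^sub>T\<close> enters as the argument \<open>A\<close>.\<close>

definition local_param :: "real^'p \<Rightarrow> real^'p^'p \<Rightarrow> real^'p \<Rightarrow> real^'p" where
  "local_param \<theta>s A u = \<theta>s + A *v u"

definition local_space :: "(real^'p) set \<Rightarrow> real^'p \<Rightarrow> real^'p^'p \<Rightarrow> (real^'p) set" where
  "local_space \<Theta> \<theta>s A = {u. local_param \<theta>s A u \<in> \<Theta>}"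

text \<open>
  \<open>Z\<close> is a continuous extension, with compact support, of the random field
  \<open>exp (H (\<theta>s + A u) - H \<theta>s)\<close> from the local parameter space to the whole space. The frontier
  of the (bounded, open, nonempty) local parameter space is compact and nonempty, so
  the supremum on the right of the last inequality is a maximum.
\<close>

definition is_extended_field ::
  "'w measure \<Rightarrow> (real^'p) set \<Rightarrow> real^'p \<Rightarrow> real^'p^'p \<Rightarrow>
   ('w \<Rightarrow> real^'p \<Rightarrow> real) \<Rightarrow> ('w \<Rightarrow> real^'p \<Rightarrow> real) \<Rightarrow> bool" where
  "is_extended_field M \<Theta> \<theta>s A H Z \<longleftrightarrow>
     (\<lambda>(\<omega>, u). Z \<omega> u) \<in> borel_measurable (M \<Otimes>\<^sub>M borel) \<and>
     (\<forall>\<omega>\<in>space M.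
        (\<forall>u\<in>local_space \<Theta> \<theta>s A. Z \<omega> u = exp (H \<omega> (local_param \<theta>s A u) - H \<omega> \<theta>s)) \<and>
        (\<forall>u. Z \<omega> u \<ge> 0) \<and>
        continuous_on UNIV (Z \<omega>) \<and>
        compact (closure {u. Z \<omega> u \<noteq> 0}) \<and>
        (SUP u\<in>- local_space \<Theta> \<theta>s A. Z \<omega> u) \<le> (SUP u\<in>frontier (local_space \<Theta> \<theta>s A). Z \<omega> u))"

text \<open>
  The supremum over the empty set is \<open>0\<close> by convention. The threshold \<open>\<epsilon>\<close> may be random.
  The argument \<open>UU\<close> is the local parameter space.
\<close>

definition tail_event ::
  "'w measure \<Rightarrow> (real^'p) set \<Rightarrow> ('w \<Rightarrow> real^'p \<Rightarrow> real) \<Rightarrow> real \<Rightarrow> ('w \<Rightarrow> real) \<Rightarrow> 'w set" where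
  "tail_event M UU Z r \<epsilon> =
     {\<omega> \<in> space M.
        (let V = {u \<in> UU. norm u \<ge> r} in if V = {} then 0 else SUP u\<in>V. Z \<omega> u) \<ge> \<epsilon> \<omega>}"

definition log_modulus :: "(real^'p) set \<Rightarrow> (real^'p \<Rightarrow> real) \<Rightarrow> real \<Rightarrow> real \<Rightarrow> real" where
  "log_modulus UU z \<delta> c =
     Sup {\<bar>ln (z u2) - ln (z u1)\<bar> | u1 u2.
            u1 \<in> UU \<and> norm u1 < c \<and> u2 \<in> UU \<and> norm u2 < c \<and> norm (u2 - u1) \<le> \<delta>}"

definition modulus_event ::
  "'w measure \<Rightarrow> (real^'p) set \<Rightarrow> ('w \<Rightarrow> real^'p \<Rightarrow> real) \<Rightarrow> real \<Rightarrow> real \<Rightarrow> real \<Rightarrow> 'w set" where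
  "modulus_event M UU Z \<delta> c \<epsilon> = {\<omega> \<in> space M. log_modulus UU (Z \<omega>) \<delta> c > \<epsilon>}"

text \<open>
  Continuous functions vanishing at infinity. They are bounded, so they form a subset of the
  type of bounded continuous functions, whose distance is the supremum distance.
\<close>

definition C_hat :: "((real^'p) \<Rightarrow>\<^sub>C real) set" where
  "C_hat = {f. (apply_bcontfun f \<longlongrightarrow> 0) at_infinity}"

definition quasi_bayes ::
  "(real^'p) set \<Rightarrow> (real^'p \<Rightarrow> real) \<Rightarrow> (real^'p \<Rightarrow> real) \<Rightarrow> real^'p" where
  "quasi_bayes \<Theta> prior h =
     inverse (LINT \<theta>:\<Theta>|lborel. exp (h \<theta>) * prior \<theta>) *\<^sub>R
     (LINT \<theta>:\<Theta>|lborel. (exp (h \<theta>) * prior \<theta>) *\<^sub>R \<theta>)"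

definition field_mean :: "(real^'p \<Rightarrow> real) \<Rightarrow> real^'p" where
  "field_mean z = inverse (LINT u|lborel. z u) *\<^sub>R (LINT u|lborel. z u *\<^sub>R u)"

end

theory Submission
  imports Defs
begin

text \<open>
  The substitution \<open>\<theta> = \<theta>* + a\<^sub>T u\<close> turns the normalised estimator into a mean of a random density: it is
  \<^const>\<open>field_mean\<close> of \<open>u \<mapsto> 1\<^bsub>U\<^sub>T\<^esub>(u) Z\<^sub>T(u) q\<^sub>T(u)\<close>, where the weight \<open>q\<^sub>T(u)\<close> is the ratio of the prior
  at \<open>\<theta>* + a\<^sub>T u\<close> and at \<open>\<theta>*\<close> (\<open>quasi_bayes_local\<close>). On a bounded set \<open>q\<^sub>T\<close> tends to one, because
  \<open>a\<^sub>T\<close> tends to zero. The claim is therefore that the mean of this density inherits the conditional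
  convergence of the finite-dimensional laws of \<open>Z\<^sub>T\<close>.

  Conditioning disappears first. Conditional expectation is a contraction in \<open>L\<^sup>1\<close>, so it
  suffices to find, for every tolerance, a bounded continuous function \<open>g\<close> of finitely many values of
  the field such that the test function of the mean differs from \<open>g\<close> by little in \<open>L\<^sup>1\<close>, both for the
  limit and for all late \<open>T\<close> (\<open>conditional_L1_limit\<close>). The assumed convergence then applies to \<open>g\<close>.
  The factors \<open>\<Psi>\<^sub>T\<close> tend to one in \<open>L\<^sup>1\<close>, so they are inserted and removed at a vanishing cost.

  The approximation itself (\<open>mean_approximation\<close>) cuts the field off outside a ball of radius \<open>R\<close> and
  replaces it inside by its values at finitely many points, through a rounding map of small mesh. The
  error is governed by one identity: if \<open>m\<close> is the mean of \<open>z\<close>, then the mean of \<open>y\<close> differs from \<open>m\<close> by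
  \<open>(\<integral> y)\<^sup>-\<^sup>1 \<integral> (y - z)(u - m) du\<close> (\<open>field_mean_close\<close>). Three bounds enter, each off an event of small probability.
  \<^item> The logarithm of \<open>Z\<^sub>T\<close> oscillates little over the mesh, so inside the ball the error is small
    relative to the density, whatever its size.
  \<^item> Since \<open>Z\<^sub>T(0) = 1\<close>, the same modulus near the origin bounds the total mass from below,
    independently of \<open>R\<close>.
  \<^item> Outside the ball \<open>Z\<^sub>T\<close> lies below a multiple of \<open>(1 + |u|)\<^sup>-\<^sup>D\<close>, whose first moment is finite as
    \<open>D\<close> exceeds the dimension by more than one.

  The second hypothesis gives the oscillation bound by a reverse Fatou argument, the first one gives the
  envelope: on the \<open>C\<close>-measurable event where \<open>U\<close> and \<open>V\<close> are at most \<open>K\<close>, the conditional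
  probabilities of the tail events are summable over the radius, as \<open>L > 1\<close>. The envelope, the
  nonnegativity and the value one at the origin pass to the limit field through its finite-dimensional
  laws (\<open>AE_nice_path\<close>), so that the limit has a well-defined mean which is the limit of its own
  truncations and discretisations.

  The mesh on which the oscillation is small may depend on the sequence along which \<open>T\<close> tends to
  infinity. The whole argument is therefore carried out along a fixed sequence, and the passage back
  to the directed limit is made at the end (\<open>tendsto_at_top_in_of_sequences\<close>).
\<close>

section \<open>Affine changes of variables for Lebesgue measure\<close>

lemma nn_integral_lborel_shift:
  fixes h :: "'a::euclidean_space \<Rightarrow> ennreal"
  assumes [measurable]: "h \<in> borel_measurable borel"
  shows "(\<integral>\<^sup>+x. h (c + x) \<partial>lborel) = (\<integral>\<^sup>+x. h x \<partial>lborel)"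
proof -
  have "(\<integral>\<^sup>+x. h x \<partial>lborel) = (\<integral>\<^sup>+x. h x \<partial>(distr lborel borel ((+) c)))"
    by (simp add: lborel_distr_plus)
  also have "\<dots> = (\<integral>\<^sup>+x. h (c + x) \<partial>lborel)"
    by (rule nn_integral_distr) auto
  finally show ?thesis by simp
qed

text \<open>
  The image of Lebesgue measure is translation invariant, hence a multiple of Lebesgue measure. This is shown by the classical two-fold Fubini argument applied to \<open>f(A x) g(y - A x)\<close> with \<open>g\<close> the indicator
  of the unit ball. Only the existence of the constant matters, since it cancels in means.
\<close>
lemma nn_integral_lborel_linear:
  fixes A B :: "'a::euclidean_space \<Rightarrow> 'a"
  assumes "linear A" "linear B" and BA: "\<And>x. B (A x) = x" and AB: "\<And>x. A (B x) = x"
  obtains c :: real where "c > 0"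
    "\<And>f. f \<in> borel_measurable borel \<Longrightarrow>
       (\<integral>\<^sup>+x. f (A x) \<partial>lborel) = ennreal c * (\<integral>\<^sup>+x. f x \<partial>lborel)"
proof -
  have contA: "continuous_on UNIV A" and contB: "continuous_on UNIV B"
    using assms(1,2) by (simp_all add: linear_continuous_on linear_conv_bounded_linear)
  have [measurable]: "A \<in> borel_measurable borel" "B \<in> borel_measurable borel"
    using contA contB by (simp_all add: borel_measurable_continuous_onI)
  obtain K where K: "K > 0" "\<And>x. norm (A x) \<le> norm x * K"
    using bounded_linear.pos_bounded[of A] assms(1) linear_conv_bounded_linear by blast
  define S where "S = {x. norm (A x) < 1}"
  define v where "v = measure lborel (ball (0::'a) 1)"
  have S_sets[measurable]: "S \<in> sets borel" unfolding S_def by measurable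
  have "S \<subseteq> B ` ball 0 1"
  proof
    fix x assume "x \<in> S"
    then have "A x \<in> ball 0 1" by (simp add: S_def)
    then have "B (A x) \<in> B ` ball 0 1" by (rule imageI)
    then show "x \<in> B ` ball 0 1" by (simp add: BA)
  qed
  moreover have "bounded (B ` ball 0 1)"
    using bounded_linear_image[of "ball 0 1" B] assms(2) linear_conv_bounded_linear by auto
  ultimately have "bounded S" using bounded_subset by blast
  then have Sfin: "emeasure lborel S < \<infinity>" by (rule emeasure_bounded_finite)
  have sub: "ball 0 (1/K) \<subseteq> S"
  proof
    fix x :: 'a assume "x \<in> ball 0 (1/K)"
    then have "norm x * K < 1" using K(1) by (simp add: pos_less_divide_eq)
    then show "x \<in> S" unfolding S_def using K(2)[of x] by simp
  qed
  define m where "m = measure lborel S"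
  have mS: "emeasure lborel S = ennreal m"
    unfolding m_def using Sfin by (simp add: emeasure_eq_ennreal_measure less_top)
  have "0 < measure lborel (ball (0::'a) (1/K))" using K(1) content_ball_gt_0_iff by simp
  also have "\<dots> \<le> m" unfolding m_def
    by (rule measure_mono_fmeasurable[OF sub]) (use Sfin in \<open>auto simp: fmeasurable_def\<close>)
  finally have m: "m > 0" .
  have v: "v > 0" unfolding v_def using content_ball_gt_0_iff[of "0::'a" 1] by simp
  have vS: "emeasure lborel (ball (0::'a) 1) = ennreal v"
    unfolding v_def using emeasure_bounded_finite[of "ball (0::'a) 1"]
    by (simp add: emeasure_eq_ennreal_measure less_top)
  define g :: "'a \<Rightarrow> ennreal" where "g = indicator (ball 0 1)"
  have [measurable]: "g \<in> borel_measurable borel" unfolding g_def by (intro borel_measurable_indicator) simp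
  have gA: "g (- A x) = indicator S x" for x
    unfolding g_def S_def by (auto simp: indicator_def)
  have main: "(\<integral>\<^sup>+x. f (A x) \<partial>lborel) = ennreal (m / v) * (\<integral>\<^sup>+x. f x \<partial>lborel)"
    if [measurable]: "f \<in> borel_measurable borel" for f
  proof -

    have "(\<integral>\<^sup>+x. f (A x) \<partial>lborel) * ennreal v = (\<integral>\<^sup>+x. f (A x) * (\<integral>\<^sup>+y. g y \<partial>lborel) \<partial>lborel)"
      by (subst nn_integral_multc) (auto simp: g_def vS)
    also have "\<dots> = (\<integral>\<^sup>+x. f (A x) * (\<integral>\<^sup>+y. g (- A x + y) \<partial>lborel) \<partial>lborel)"
      by (subst nn_integral_lborel_shift) auto
    also have "\<dots> = (\<integral>\<^sup>+x. (\<integral>\<^sup>+y. f (A x) * g (y - A x) \<partial>lborel) \<partial>lborel)"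
      by (subst nn_integral_cmult) auto
    also have "\<dots> = (\<integral>\<^sup>+y. (\<integral>\<^sup>+x. f (A x) * g (y - A x) \<partial>lborel) \<partial>lborel)"
      by (rule lborel_pair.Fubini') measurable
    also have "\<dots> = (\<integral>\<^sup>+y. (\<integral>\<^sup>+x. f (A (B y + x)) * g (y - A (B y + x)) \<partial>lborel) \<partial>lborel)"
      by (intro nn_integral_cong
          nn_integral_lborel_shift[of "\<lambda>x. f (A x) * g (y - A x)" "B y" for y, symmetric]) measurable
    also have "\<dots> = (\<integral>\<^sup>+y. (\<integral>\<^sup>+x. f (A x + y) * g (- A x) \<partial>lborel) \<partial>lborel)"
      by (simp add: linear_add[OF assms(1)] AB add.commute)
    also have "\<dots> = (\<integral>\<^sup>+x. (\<integral>\<^sup>+y. f (A x + y) * g (- A x) \<partial>lborel) \<partial>lborel)"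
      by (rule lborel_pair.Fubini') measurable
    also have "\<dots> = (\<integral>\<^sup>+x. (\<integral>\<^sup>+y. f (A x + y) \<partial>lborel) * g (- A x) \<partial>lborel)"
      by (subst nn_integral_multc) auto
    also have "\<dots> = (\<integral>\<^sup>+x. (\<integral>\<^sup>+y. f y \<partial>lborel) * indicator S x \<partial>lborel)"
      by (subst nn_integral_lborel_shift) (auto simp: gA)
    also have "\<dots> = (\<integral>\<^sup>+y. f y \<partial>lborel) * ennreal m"
      by (subst nn_integral_cmult) (auto simp: mS)
    finally have eq: "(\<integral>\<^sup>+x. f (A x) \<partial>lborel) * ennreal v = (\<integral>\<^sup>+y. f y \<partial>lborel) * ennreal m" .
    have "(\<integral>\<^sup>+x. f (A x) \<partial>lborel) = (\<integral>\<^sup>+x. f (A x) \<partial>lborel) * (ennreal v * ennreal (1/v))"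
      using v by (simp flip: ennreal_mult)
    also have "\<dots> = (\<integral>\<^sup>+y. f y \<partial>lborel) * (ennreal m * ennreal (1/v))"
      using eq by (simp add: mult.assoc[symmetric])
    also have "\<dots> = ennreal (m / v) * (\<integral>\<^sup>+y. f y \<partial>lborel)"
      using m v by (simp add: ennreal_mult[symmetric] mult.commute)
    finally show ?thesis .
  qed
  show thesis by (rule that[of "m / v"]) (use m v main in auto)
qed

lemma lborel_distr_linear:
  fixes A B :: "'a::euclidean_space \<Rightarrow> 'a"
  assumes "linear A" "linear B" and BA: "\<And>x. B (A x) = x" and AB: "\<And>x. A (B x) = x"
  obtains c :: real where "c > 0"
    "distr lborel borel A = density lborel (\<lambda>_. ennreal c)"
proof -
  obtain c :: real where c: "c > 0"
    "\<And>f. f \<in> borel_measurable borel \<Longrightarrow>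
       (\<integral>\<^sup>+x. f (A x) \<partial>lborel) = ennreal c * (\<integral>\<^sup>+x. f x \<partial>lborel)"
    by (rule nn_integral_lborel_linear[OF assms]) blast
  have [measurable]: "A \<in> borel_measurable borel"
    using assms(1) by (intro borel_measurable_continuous_onI)
      (simp add: linear_continuous_on linear_conv_bounded_linear)
  have eq: "distr lborel borel A = density lborel (\<lambda>_. ennreal c)"
  proof (rule measure_eqI)
    fix S :: "'a set" assume "S \<in> sets (distr lborel borel A)"
    then have [measurable]: "S \<in> sets borel" by simp
    have "emeasure (distr lborel borel A) S = (\<integral>\<^sup>+x. indicator S x \<partial>distr lborel borel A)"
      by simp
    also have "\<dots> = (\<integral>\<^sup>+x. indicator S (A x) \<partial>lborel)"
      by (rule nn_integral_distr) auto
    also have "\<dots> = ennreal c * (\<integral>\<^sup>+x. indicator S x \<partial>lborel)"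
      by (rule c(2)) simp
    also have "\<dots> = emeasure (density lborel (\<lambda>_. ennreal c)) S"
      by (simp add: emeasure_density nn_integral_cmult)
    finally show "emeasure (distr lborel borel A) S = emeasure (density lborel (\<lambda>_. ennreal c)) S" .
  qed simp
  show thesis by (rule that[OF c(1) eq])
qed

lemma integral_lborel_affine:
  fixes f :: "'a::euclidean_space \<Rightarrow> 'b::{banach,second_countable_topology}"
  assumes "linear A" and c: "c > 0" "distr lborel borel A = density lborel (\<lambda>_. ennreal c)"
    and [measurable]: "f \<in> borel_measurable borel"
  shows "(\<integral>x. f (a + A x) \<partial>lborel) = c *\<^sub>R (\<integral>x. f x \<partial>lborel)"
proof -
  have [measurable]: "A \<in> borel_measurable borel"
    using assms(1) by (intro borel_measurable_continuous_onI)
      (simp add: linear_continuous_on linear_conv_bounded_linear)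
  have "(\<integral>x. f (a + A x) \<partial>lborel) = (\<integral>x. f (a + x) \<partial>distr lborel borel A)"
    by (rule integral_distr[symmetric]) auto
  also have "\<dots> = (\<integral>x. c *\<^sub>R f (a + x) \<partial>lborel)"
    unfolding c(2) by (rule integral_density) (use c in auto)
  also have "\<dots> = c *\<^sub>R (\<integral>x. f (a + x) \<partial>lborel)" by simp
  also have "(\<integral>x. f (a + x) \<partial>lborel) = (\<integral>x. f x \<partial>distr lborel borel ((+) a))"
    by (rule integral_distr[symmetric]) auto
  finally show ?thesis by (simp add: lborel_distr_plus)
qed

section \<open>Rounding to finitely many points and measurability of continuous fields\<close>

text \<open>
  Coordinates are rounded to a grid of mesh \<open>h / d\<close>, with \<open>d\<close> the dimension. A whole neighbourhood of
  the origin is sent to the origin, so that in a discretised mean the value of the field at zero carries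
  positive weight.
\<close>
lemma finite_range_rounding:
  fixes h :: real
  assumes "h > 0"
  obtains \<rho> :: "'a::euclidean_space \<Rightarrow> 'a"
  where "\<rho> \<in> borel_measurable borel" "countable (range \<rho>)"
    "\<And>u. norm (\<rho> u - u) \<le> h" "\<And>u. norm u < h \<Longrightarrow> \<rho> u = 0" "\<And>R. finite (\<rho> ` ball 0 R)"
proof -
  define m where "m = real DIM('a) / h"
  have m: "m > 0" using assms by (simp add: m_def)
  define F :: "('a \<Rightarrow> int) \<Rightarrow> 'a" where "F = (\<lambda>x. \<Sum>b\<in>Basis. (real_of_int (x b) / m) *\<^sub>R b)"
  define \<sigma> where "\<sigma> = (\<lambda>u::'a. F (\<lambda>b. \<lfloor>m * (u \<bullet> b)\<rfloor>))"
  define \<rho> where "\<rho> = (\<lambda>u. if norm u < h then 0 else \<sigma> u)"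
  have \<sigma>_meas[measurable]: "\<sigma> \<in> borel_measurable borel" unfolding \<sigma>_def F_def by measurable
  have \<rho>_meas: "\<rho> \<in> borel_measurable borel" unfolding \<rho>_def by measurable
  have F_restrict: "F x = F (restrict x Basis)" for x unfolding F_def by (rule sum.cong) auto
  have sub: "range \<sigma> \<subseteq> F ` (PiE Basis (\<lambda>_. UNIV))"
  proof -
    have "\<sigma> u \<in> F ` (PiE Basis (\<lambda>_. UNIV))" for u
      unfolding \<sigma>_def by (subst F_restrict) (intro imageI, auto)
    then show ?thesis by auto
  qed
  have cnt: "countable (range \<sigma>)"
    by (rule countable_subset[OF sub]) (intro countable_image countable_PiE, auto)
  have "range \<rho> \<subseteq> insert 0 (range \<sigma>)" unfolding \<rho>_def by auto
  then have cnt\<rho>: "countable (range \<rho>)" using countable_insert[OF cnt] by (rule countable_subset)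
  have \<sigma>_close: "norm (\<sigma> u - u) \<le> h" for u
  proof -

    have "norm (\<sigma> u - u) \<le> (\<Sum>b\<in>Basis. \<bar>(\<sigma> u - u) \<bullet> b\<bar>)" by (rule norm_le_l1)
    also have "\<dots> \<le> (\<Sum>b\<in>(Basis::'a set). 1 / m)"
    proof (rule sum_mono)
      fix b :: 'a assume b: "b \<in> Basis"
      have "\<sigma> u \<bullet> b = real_of_int \<lfloor>m * (u \<bullet> b)\<rfloor> / m"
        unfolding \<sigma>_def F_def using b by (rule inner_sum_left_Basis)
      then have "(\<sigma> u - u) \<bullet> b = (real_of_int \<lfloor>m * (u \<bullet> b)\<rfloor> - m * (u \<bullet> b)) / m"
        using m by (simp add: inner_diff_left diff_divide_distrib)
      moreover have "\<bar>real_of_int \<lfloor>m * (u \<bullet> b)\<rfloor> - m * (u \<bullet> b)\<bar> \<le> 1" by linarith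
      ultimately show "\<bar>(\<sigma> u - u) \<bullet> b\<bar> \<le> 1 / m"
        using m divide_right_mono[of "\<bar>real_of_int \<lfloor>m * (u \<bullet> b)\<rfloor> - m * (u \<bullet> b)\<bar>" 1 m]
        by (simp only: abs_divide abs_of_pos)
    qed
    also have "\<dots> = h" using assms by (simp add: m_def)
    finally show ?thesis .
  qed
  have close: "norm (\<rho> u - u) \<le> h" for u
    using \<sigma>_close[of u] by (auto simp: \<rho>_def)
  have fin: "finite (\<rho> ` ball 0 R)" for R
  proof -
    define N where "N = \<lceil>m * \<bar>R\<bar>\<rceil> + 1"
    have "\<sigma> ` ball 0 R \<subseteq> F ` (PiE Basis (\<lambda>_. {-N..N}))"
    proof (rule image_subsetI)
      fix u :: 'a assume "u \<in> ball 0 R"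
      then have u: "norm u < R" by simp
      have "\<lfloor>m * (u \<bullet> b)\<rfloor> \<in> {-N..N}" if b: "b \<in> Basis" for b
      proof -
        have "\<bar>u \<bullet> b\<bar> \<le> \<bar>R\<bar>" using Basis_le_norm[OF b, of u] u by linarith
        then have "\<bar>m * (u \<bullet> b)\<bar> \<le> m * \<bar>R\<bar>" using m by (simp add: abs_mult)
        then have "- real_of_int N \<le> m * (u \<bullet> b) \<and> m * (u \<bullet> b) \<le> real_of_int N"
          unfolding N_def by linarith
        then have "-N \<le> \<lfloor>m * (u \<bullet> b)\<rfloor>" "\<lfloor>m * (u \<bullet> b)\<rfloor> \<le> N" by linarith+
        then show ?thesis by simp
      qed
      then show "\<sigma> u \<in> F ` (PiE Basis (\<lambda>_. {-N..N}))"
        unfolding \<sigma>_def by (subst F_restrict) (intro imageI, auto)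
    qed
    then have "finite (\<sigma> ` ball 0 R)"
      by (rule finite_subset) (intro finite_imageI finite_PiE, auto)
    then have "finite (insert 0 (\<sigma> ` ball 0 R))" by simp
    then show ?thesis by (rule rev_finite_subset) (auto simp: \<rho>_def)
  qed
  show thesis by (rule that[of \<rho>, OF \<rho>_meas cnt\<rho> close _ fin]) (auto simp: \<rho>_def)
qed

text \<open>
  A field that is continuous in the second argument is the limit of the fields obtained by rounding that
  argument, which take the argument from a countable set.
\<close>
lemma Caratheodory_measurable:
  fixes F :: "'w \<Rightarrow> 'a::euclidean_space \<Rightarrow> real"
  assumes meas: "\<And>u. (\<lambda>\<omega>. F \<omega> u) \<in> borel_measurable M"
    and cont: "\<And>\<omega>. \<omega> \<in> space M \<Longrightarrow> continuous_on UNIV (F \<omega>)"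
  shows "(\<lambda>(\<omega>, u). F \<omega> u) \<in> borel_measurable (M \<Otimes>\<^sub>M borel)"
proof -
  have "\<exists>\<rho>. \<forall>n. \<rho> n \<in> borel_measurable borel \<and> countable (range (\<rho> n)) \<and>
      (\<forall>u::'a. norm (\<rho> n u - u) \<le> 1 / real (Suc n))"
  proof (rule choice, rule allI)
    fix n show "\<exists>\<rho>. \<rho> \<in> borel_measurable borel \<and> countable (range \<rho>) \<and>
      (\<forall>u::'a. norm (\<rho> u - u) \<le> 1 / real (Suc n))"
      by (rule finite_range_rounding[of "1 / real (Suc n)"]) auto
  qed
  then obtain \<rho> :: "nat \<Rightarrow> 'a \<Rightarrow> 'a" where \<rho>: "\<And>n. \<rho> n \<in> borel_measurable borel"
    "\<And>n. countable (range (\<rho> n))" "\<And>n u. norm (\<rho> n u - u) \<le> 1 / real (Suc n)" by blast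
  note [measurable] = \<rho>(1)
  show ?thesis
  proof (rule borel_measurable_LIMSEQ_real)
    fix n
    have m: "(\<lambda>x. (\<lambda>i x. F (fst x) i) (\<rho> n (snd x)) x) \<in> borel_measurable (M \<Otimes>\<^sub>M (borel :: 'a measure))"
    proof (rule measurable_compose_countable'[where I = "range (\<rho> n)"])
      show "(\<lambda>x. F (fst x) i) \<in> borel_measurable (M \<Otimes>\<^sub>M borel)" for i
        using meas by measurable
      show "(\<lambda>x. \<rho> n (snd x)) \<in> M \<Otimes>\<^sub>M borel \<rightarrow>\<^sub>M count_space (range (\<rho> n))"
      proof (rule measurable_count_space_eq_countable[THEN iffD2, OF \<rho>(2)], intro conjI ballI)
        show "(\<lambda>x. \<rho> n (snd x)) \<in> space (M \<Otimes>\<^sub>M borel) \<rightarrow> range (\<rho> n)" by auto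
        fix v
        have "(\<lambda>x. \<rho> n (snd x)) \<in> borel_measurable (M \<Otimes>\<^sub>M borel)" by measurable
        from measurable_sets[OF this, of "{v}"]
        show "(\<lambda>x. \<rho> n (snd x)) -` {v} \<inter> space (M \<Otimes>\<^sub>M borel) \<in> sets (M \<Otimes>\<^sub>M borel)" by simp
      qed
    qed (rule \<rho>(2))
    then show "(\<lambda>(\<omega>, u). F \<omega> (\<rho> n u)) \<in> borel_measurable (M \<Otimes>\<^sub>M borel)"
      by (simp add: case_prod_unfold)
  next
    fix x assume "x \<in> space (M \<Otimes>\<^sub>M (borel :: 'a measure))"
    then have x: "fst x \<in> space M" by (auto simp: space_pair_measure)
    have "(\<lambda>n. \<rho> n (snd x) - snd x) \<longlonglongrightarrow> 0"
      by (rule Lim_null_comparison[OF _ LIMSEQ_Suc[OF lim_1_over_n]])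
         (intro always_eventually allI, use \<rho>(3) in auto)
    then have "(\<lambda>n. \<rho> n (snd x)) \<longlonglongrightarrow> snd x" by (simp add: LIM_zero_iff)
    then have "(\<lambda>n. F (fst x) (\<rho> n (snd x))) \<longlonglongrightarrow> F (fst x) (snd x)"
      using cont[OF x] by (auto simp: continuous_on_eq_continuous_at intro: isCont_tendsto_compose)
    then show "(\<lambda>n. case x of (\<omega>, u) \<Rightarrow> F \<omega> (\<rho> n u)) \<longlonglongrightarrow> (case x of (\<omega>, u) \<Rightarrow> F \<omega> u)"
      by (simp add: case_prod_unfold)
  qed
qed

text \<open>A supremum of a continuous function over \<open>S\<close> is a supremum over a countable dense subset of \<open>S\<close>.\<close>
lemma continuous_cSUP_measurable:
  fixes F :: "'w \<Rightarrow> 'a::{metric_space,second_countable_topology} \<Rightarrow> real"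
  assumes meas: "\<And>u. u \<in> S \<Longrightarrow> (\<lambda>\<omega>. F \<omega> u) \<in> borel_measurable M"
    and cont: "\<And>\<omega>. \<omega> \<in> space M \<Longrightarrow> continuous_on S (F \<omega>)"
    and bdd: "\<And>\<omega>. \<omega> \<in> space M \<Longrightarrow> bdd_above (F \<omega> ` S)"
  shows "(\<lambda>\<omega>. SUP u\<in>S. F \<omega> u) \<in> borel_measurable M"
proof (cases "S = {}")
  case False
  obtain T where T: "countable T" "T \<subseteq> S" "S \<subseteq> closure T" by (rule separable)
  have "T \<noteq> {}" using False T(3) by auto
  have eq: "(SUP u\<in>S. F \<omega> u) = (SUP u\<in>T. F \<omega> u)" if w: "\<omega> \<in> space M" for \<omega>
  proof (rule antisym)
    have bT: "bdd_above (F \<omega> ` T)" using bdd[OF w] T(2) by (meson bdd_above_mono image_mono)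
    show "(SUP u\<in>S. F \<omega> u) \<le> (SUP u\<in>T. F \<omega> u)"
    proof (rule cSUP_least[OF False])
      fix u assume u: "u \<in> S"
      then have "u \<in> closure T" using T(3) by auto
      then obtain x where x: "\<And>n. x n \<in> T" "x \<longlonglongrightarrow> u" unfolding closure_sequential by auto
      have lim: "(\<lambda>n. F \<omega> (x n)) \<longlonglongrightarrow> F \<omega> u"
        using cont[OF w] x u T(2) unfolding continuous_on_sequentially o_def by blast
      show "F \<omega> u \<le> (SUP u\<in>T. F \<omega> u)"
        by (rule LIMSEQ_le_const2[OF lim]) (use x(1) bT in \<open>auto intro!: cSUP_upper\<close>)
    qed
    show "(SUP u\<in>T. F \<omega> u) \<le> (SUP u\<in>S. F \<omega> u)"
      by (rule cSUP_subset_mono[OF \<open>T \<noteq> {}\<close> bdd[OF w] T(2)]) simp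
  qed
  have "(\<lambda>\<omega>. SUP u\<in>T. F \<omega> u) \<in> borel_measurable M"
  proof (rule borel_measurable_cSUP[OF T(1)])
    fix u assume "u \<in> T" then show "(\<lambda>\<omega>. F \<omega> u) \<in> borel_measurable M" using meas T(2) by auto
  next
    fix \<omega> assume "\<omega> \<in> space M"
    then show "bdd_above ((\<lambda>i. F \<omega> i) ` T)" using bdd T(2) by (meson bdd_above_mono image_mono)
  qed
  then show ?thesis by (subst measurable_cong[OF eq]) auto
qed simp

section \<open>Means of densities\<close>

lemma field_mean_scale:
  assumes "c \<noteq> 0"
  shows "field_mean (\<lambda>u. c * z u) = field_mean z"
proof -
  have "(LINT u|lborel. (c * z u) *\<^sub>R u) = c *\<^sub>R (LINT u|lborel. z u *\<^sub>R u)"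
    by (simp flip: scaleR_scaleR)
  then show ?thesis using assms by (simp add: field_mean_def)
qed

lemma integrable_scaleR_moment:
  fixes y :: "real^'p \<Rightarrow> real"
  assumes "integrable lborel y" "integrable lborel (\<lambda>u. norm u * y u)"
  shows "integrable lborel (\<lambda>u. y u *\<^sub>R u)"
proof (rule Bochner_Integration.integrable_bound[OF assms(2)])
  have [measurable]: "y \<in> borel_measurable borel" using assms(1) by auto
  show "(\<lambda>u. y u *\<^sub>R u) \<in> borel_measurable lborel" by measurable
qed (simp add: abs_mult mult.commute)

text \<open>
  Splitting the first moment at radius \<open>R\<close> bounds the mean by \<open>R\<close> plus the tail, with the mass in the
  denominator. It confines the random means to a fixed compact set, where a continuous test function is
  uniformly continuous.
\<close>
lemma norm_field_mean_le:
  fixes y :: "real^'p \<Rightarrow> real"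
  assumes y: "integrable lborel y" "integrable lborel (\<lambda>u. norm u * y u)" "\<And>u. y u \<ge> 0"
    and R: "R \<ge> 0" and D: "(LINT u|lborel. y u) \<ge> \<kappa>" "\<kappa> > 0"
    and t: "(LINT u|lborel. indicator (- ball 0 R) u * (norm u * y u)) \<le> t"
  shows "norm (field_mean y) \<le> R + t / \<kappa>"
proof -
  let ?D = "LINT u|lborel. y u"
  have D0: "?D > 0" using D by simp
  have [measurable]: "y \<in> borel_measurable borel" using y(1) by auto
  have int1: "integrable lborel (\<lambda>u. indicator (- ball 0 R) u * (norm u * y u))"
    by (rule Bochner_Integration.integrable_bound[OF y(2)]) (auto simp: indicator_def y(3))
  have t0: "t \<ge> 0"
    by (rule order_trans[OF _ t], rule integral_nonneg_AE) (auto simp: y(3))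
  have "norm (LINT u|lborel. y u *\<^sub>R u) \<le> (LINT u|lborel. norm (y u *\<^sub>R u))"
    by (rule integral_norm_bound)
  also have "\<dots> \<le> (LINT u|lborel. R * y u + indicator (- ball 0 R) u * (norm u * y u))"
  proof (rule integral_mono)
    show "integrable lborel (\<lambda>u. norm (y u *\<^sub>R u))"
      using y integrable_scaleR_moment[OF y(1,2)] by (intro integrable_norm)
    show "integrable lborel (\<lambda>u. R * y u + indicator (- ball 0 R) u * (norm u * y u))"
      using y(1) int1 by auto
    show "norm (y u *\<^sub>R u) \<le> R * y u + indicator (- ball 0 R) u * (norm u * y u)" for u
    proof (cases "norm u < R")
      case True
      then have "norm u * y u \<le> R * y u" using y(3) by (intro mult_right_mono) auto
      then show ?thesis using True y(3)[of u] by (simp add: mult.commute)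
    next
      case False then show ?thesis using y(3)[of u] R by (simp add: mult.commute)
    qed
  qed
  also have "\<dots> = R * ?D + (LINT u|lborel. indicator (- ball 0 R) u * (norm u * y u))"
    using y(1) int1 by simp
  also have "\<dots> \<le> R * ?D + t" using t by simp
  finally have "norm (field_mean y) \<le> (R * ?D + t) / ?D"
    unfolding field_mean_def using D0 by (simp add: field_simps)
  also have "\<dots> = R + t / ?D" using D0 by (simp add: field_simps)
  also have "\<dots> \<le> R + t / \<kappa>"
    using D t0 by (simp add: frac_le)
  finally show ?thesis .
qed

lemma norm_field_mean_le_support:
  fixes z :: "real^'p \<Rightarrow> real"
  assumes z: "integrable lborel z" "\<And>u. z u \<ge> 0" "\<And>u. norm u \<ge> R \<Longrightarrow> z u = 0" and R: "R \<ge> 0"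
  shows "norm (field_mean z) \<le> R"
proof (cases "(LINT u|lborel. z u) = 0")
  case True then show ?thesis using R by (simp add: field_mean_def)
next
  case False
  have "(LINT u|lborel. z u) \<ge> 0" by (rule integral_nonneg_AE) (auto simp: z)
  with False have pos: "(LINT u|lborel. z u) > 0" by simp
  have [measurable]: "z \<in> borel_measurable borel" using z(1) by auto
  have *: "norm u * z u \<le> R * z u" for u
    by (cases "norm u \<ge> R") (auto simp: z intro!: mult_right_mono)
  have int: "integrable lborel (\<lambda>u. norm u * z u)"
    by (rule Bochner_Integration.integrable_bound[of _ "\<lambda>u. R * z u"])
       (use z R * in \<open>auto simp: abs_mult\<close>)
  have "(\<lambda>u. indicator (- ball 0 R) u * (norm u * z u)) = (\<lambda>u. 0)"
    by (rule ext) (use z(3) in \<open>auto simp: indicator_def not_less\<close>)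
  then show ?thesis using norm_field_mean_le[OF z(1) int z(2) R order_refl pos, of 0] by simp
qed

text \<open>
  With \<open>m\<close> the mean of \<open>z\<close> one has \<open>\<integral> z(u) (u - m) du = 0\<close>, so that
  \<open>(\<integral> y) (mean y - m) = \<integral> (y(u) - z(u)) (u - m) du\<close>. Inside the ball \<open>|u - m|\<close> is at most \<open>2 R\<close> and the
  difference is small relative to \<open>z\<close>; outside it only the tail of \<open>y\<close> is left and \<open>|u - m| \<le> 2 |u|\<close>.
\<close>
lemma field_mean_close:
  fixes y z :: "real^'p \<Rightarrow> real"
  assumes y: "integrable lborel y" "integrable lborel (\<lambda>u. norm u * y u)" "\<And>u. y u \<ge> 0"
    and z: "integrable lborel z" "\<And>u. z u \<ge> 0" "\<And>u. norm u \<ge> R \<Longrightarrow> z u = 0" and R: "R \<ge> 0"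
    and eps: "0 \<le> \<epsilon>" "\<epsilon> \<le> 1 / 2"
    and close: "\<And>u. norm u < R \<Longrightarrow> \<bar>y u - z u\<bar> \<le> \<epsilon> * z u"
    and D: "(LINT u|lborel. indicator (ball 0 R) u * y u) \<ge> \<kappa>" "\<kappa> > 0"
    and t: "(LINT u|lborel. indicator (- ball 0 R) u * (norm u * y u)) \<le> t"
  shows "norm (field_mean y - field_mean z) \<le> 4 * R * \<epsilon> + 2 * t / \<kappa>"
proof -
  let ?D = "LINT u|lborel. y u" and ?d = "LINT u|lborel. z u"
  let ?m = "field_mean z"
  have [measurable]: "y \<in> borel_measurable borel" "z \<in> borel_measurable borel" using y(1) z(1) by auto
  have intB: "integrable lborel (\<lambda>u. indicator (ball 0 R) u * y u)"
    by (rule Bochner_Integration.integrable_bound[OF y(1)]) (auto simp: indicator_def y(3))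
  have int1: "integrable lborel (\<lambda>u. indicator (- ball 0 R) u * (norm u * y u))"
    by (rule Bochner_Integration.integrable_bound[OF y(2)]) (auto simp: indicator_def y(3))
  have t0: "t \<ge> 0"
    by (rule order_trans[OF _ t], rule integral_nonneg_AE) (auto simp: y(3))
  have "(LINT u|lborel. indicator (ball 0 R) u * y u) \<le> ?D"
    by (rule integral_mono[OF intB y(1)]) (auto simp: indicator_def y(3))
  then have D\<kappa>: "?D \<ge> \<kappa>" and D0: "?D > 0" using D by simp_all
  have zy: "z u \<le> 2 * y u" for u
  proof (cases "norm u < R")
    case True
    have "\<epsilon> * z u \<le> 1 / 2 * z u" using eps z(2) by (intro mult_right_mono)
    then show ?thesis using close[OF True] by linarith
  next
    case False then show ?thesis using z(3) y(3)[of u] by simp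
  qed
  have "?d \<le> (LINT u|lborel. 2 * y u)" by (rule integral_mono) (use z y zy in auto)
  then have d2: "?d \<le> 2 * ?D" by simp
  have "(LINT u|lborel. indicator (ball 0 R) u * y u) \<le> (LINT u|lborel. 2 * z u)"
  proof (rule integral_mono[OF intB])
    fix u show "indicator (ball 0 R) u * y u \<le> 2 * z u"
    proof (cases "norm u < R")
      case True
      have "\<epsilon> * z u \<le> 1 / 2 * z u" using eps z(2) by (intro mult_right_mono)
      then have "y u \<le> 2 * z u" using close[OF True] z(2)[of u] by linarith
      then show ?thesis using True by simp
    next
      case False then show ?thesis using z(2)[of u] by simp
    qed
  qed (use z in auto)
  then have d0: "?d > 0" using D by simp
  have moment_z: "norm u * z u \<le> R * z u" for u
    by (cases "norm u \<ge> R") (auto simp: z intro!: mult_right_mono)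
  have z_mom: "integrable lborel (\<lambda>u. norm u * z u)"
    by (rule Bochner_Integration.integrable_bound[of _ "\<lambda>u. R * z u"])
       (use z R moment_z in \<open>auto simp: abs_mult\<close>)
  note iy = integrable_scaleR_moment[OF y(1,2)] and iz = integrable_scaleR_moment[OF z(1) z_mom]
  have mR: "norm ?m \<le> R" by (rule norm_field_mean_le_support) (use z R in auto)
  have centred: "(LINT u|lborel. z u *\<^sub>R (u - ?m)) = 0"
  proof -
    have "(LINT u|lborel. z u *\<^sub>R (u - ?m)) = (LINT u|lborel. z u *\<^sub>R u) - ?d *\<^sub>R ?m"
      using iz z(1) by (simp add: scaleR_diff_right)
    then show ?thesis using d0 by (simp add: field_mean_def)
  qed
  have "(LINT u|lborel. (y u - z u) *\<^sub>R (u - ?m)) =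
      (LINT u|lborel. y u *\<^sub>R (u - ?m)) - (LINT u|lborel. z u *\<^sub>R (u - ?m))"
    using iy iz y(1) z(1) by (simp add: scaleR_diff_left scaleR_diff_right)
  also have "\<dots> = (LINT u|lborel. y u *\<^sub>R u) - ?D *\<^sub>R ?m"
    using iy y(1) by (simp add: centred) (simp add: scaleR_diff_right)
  also have "\<dots> = ?D *\<^sub>R (field_mean y - ?m)"
    using D0 by (simp add: field_mean_def[of y] scaleR_diff_right)
  finally have eq: "?D *\<^sub>R (field_mean y - ?m) = (LINT u|lborel. (y u - z u) *\<^sub>R (u - ?m))" ..
  have "norm (LINT u|lborel. (y u - z u) *\<^sub>R (u - ?m)) \<le> (LINT u|lborel. norm ((y u - z u) *\<^sub>R (u - ?m)))"
    by (rule integral_norm_bound)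
  also have "\<dots> \<le> (LINT u|lborel. 2 * R * \<epsilon> * z u + 2 * (indicator (- ball 0 R) u * (norm u * y u)))"
  proof (rule integral_mono)
    show "integrable lborel (\<lambda>u. norm ((y u - z u) *\<^sub>R (u - ?m)))"
      using iy iz y(1) z(1) by (intro integrable_norm) (simp add: scaleR_diff_left scaleR_diff_right)
    show "integrable lborel (\<lambda>u. 2 * R * \<epsilon> * z u + 2 * (indicator (- ball 0 R) u * (norm u * y u)))"
      using z(1) int1 by auto
    fix u
    have n: "norm (u - ?m) \<le> norm u + R" using norm_triangle_ineq4[of u ?m] mR by linarith
    show "norm ((y u - z u) *\<^sub>R (u - ?m)) \<le> 2 * R * \<epsilon> * z u + 2 * (indicator (- ball 0 R) u * (norm u * y u))"
    proof (cases "norm u < R")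
      case True
      have "\<bar>y u - z u\<bar> * norm (u - ?m) \<le> (\<epsilon> * z u) * (2 * R)"
        using close[OF True] n True eps z(2)[of u] by (intro mult_mono) auto
      then show ?thesis using True by (simp add: mult_ac)
    next
      case False
      have "y u * norm (u - ?m) \<le> y u * (2 * norm u)"
        using n False y(3)[of u] by (intro mult_left_mono) auto
      then show ?thesis using False z(3)[of u] y(3)[of u] by (simp add: mult_ac)
    qed
  qed
  also have "\<dots> = 2 * R * \<epsilon> * ?d + 2 * (LINT u|lborel. indicator (- ball 0 R) u * (norm u * y u))"
    using z(1) int1 by simp
  also have "\<dots> \<le> 2 * R * \<epsilon> * (2 * ?D) + 2 * t"
    using t d2 R eps by (intro add_mono mult_left_mono) auto
  finally have "?D * norm (field_mean y - ?m) \<le> 4 * R * \<epsilon> * ?D + 2 * t"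
    unfolding eq[symmetric] using D0 by (simp add: mult_ac)
  then have "norm (field_mean y - ?m) \<le> (4 * R * \<epsilon> * ?D + 2 * t) / ?D"
    using D0 by (simp add: pos_le_divide_eq mult.commute)
  also have "\<dots> = 4 * R * \<epsilon> + 2 * t / ?D" using D0 by (simp add: field_simps)
  also have "\<dots> \<le> 4 * R * \<epsilon> + 2 * t / \<kappa>" using D\<kappa> D(2) t0 by (simp add: frac_le)
  finally show ?thesis .
qed

text \<open>
  The rounded field is constant on finitely many cells, so numerator and denominator of its mean are
  linear in the values at the cell representatives. The denominator may vanish at other arguments;
  replacing it by its maximum with the volume of a small ball makes the functional continuous everywhere
  and changes nothing on nonnegative fields with value one at the origin.
\<close>
lemma field_mean_discretized:
  fixes \<rho> :: "real^'p \<Rightarrow> real^'p"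
  assumes R: "R > 0" and h: "h > 0" and [measurable]: "\<rho> \<in> borel_measurable borel"
    and \<rho>0: "\<And>u. norm u < h \<Longrightarrow> \<rho> u = 0" and fin: "finite (\<rho> ` ball 0 R)"
  obtains k :: nat and v :: "nat \<Rightarrow> real^'p" and g :: "(nat \<Rightarrow> real) \<Rightarrow> real^'p"
  where "k \<ge> 1" "continuous_on UNIV g"
    "\<And>z. (\<And>u. z u \<ge> 0) \<Longrightarrow> z 0 = 1 \<Longrightarrow>
       g (\<lambda>i. if i < k then z (v i) else 0) = field_mean (\<lambda>u. indicator (ball 0 R) u * z (\<rho> u))"
proof -
  define B where "B = ball (0::real^'p) R"
  define A where "A = \<rho> ` B"
  define k where "k = card A"
  have finA: "finite A" using fin by (simp add: A_def B_def)
  have "0 \<in> B" using R by (simp add: B_def)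
  then have A0: "0 \<in> A" unfolding A_def using \<rho>0[of 0] h by (metis image_eqI norm_zero)
  obtain v where v: "bij_betw v {..<k} A"
    unfolding k_def using ex_bij_betw_nat_finite[OF finA] by (auto simp: atLeast0LessThan)
  have [measurable]: "B \<in> sets borel" by (simp add: B_def)
  define cell where "cell = (\<lambda>i. {u\<in>B. \<rho> u = v i})"
  have cell_sets[measurable]: "cell i \<in> sets borel" for i unfolding cell_def by measurable
  have cell_fin: "emeasure lborel (cell i) < \<infinity>" for i
    by (rule emeasure_bounded_finite) (auto simp: cell_def B_def intro!: bounded_subset[OF bounded_ball[of 0 R]])
  define w where "w = (\<lambda>i. LINT u|lborel. indicator (cell i) u :: real)"
  define m where "m = (\<lambda>i. LINT u|lborel. (indicator (cell i) u :: real) *\<^sub>R u)"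
  define w0 where "w0 = measure lborel (ball (0::real^'p) (min h R))"
  have w0: "w0 > 0" unfolding w0_def using R h content_ball_gt_0_iff[of "0::real^'p" "min h R"] by simp
  have int_cell: "integrable lborel (indicator (cell i) :: _ \<Rightarrow> real)" for i
    using cell_fin by (intro integrable_real_indicator) auto
  have int_cell_mom: "integrable lborel (\<lambda>u. (indicator (cell i) u :: real) *\<^sub>R u)" for i
  proof (rule Bochner_Integration.integrable_bound[of _ "\<lambda>u. R * indicator (cell i) u"])
    show "AE u in lborel. norm ((indicator (cell i) u :: real) *\<^sub>R u) \<le> norm (R * indicator (cell i) u :: real)"
      using R by (auto simp: indicator_def cell_def B_def)
  qed (use int_cell in auto)
  define g where "g = (\<lambda>x. inverse (max (\<Sum>i<k. w i * x i) w0) *\<^sub>R (\<Sum>i<k. x i *\<^sub>R m i))"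
  have pos: "max s w0 \<noteq> 0" for s using w0 by (metis max.cobounded2 not_le)
  have cont: "continuous_on UNIV g"
    unfolding g_def using pos
    by (intro continuous_intros) (auto intro!: continuous_intros continuous_on_product_coordinates)
  have "g (\<lambda>i. if i < k then z (v i) else 0) = field_mean (\<lambda>u. indicator (ball 0 R) u * z (\<rho> u))"
    if z: "\<And>u. z u \<ge> 0" "z 0 = 1" for z
  proof -
    have split: "indicator (ball 0 R) u * z (\<rho> u) = (\<Sum>i<k. z (v i) * indicator (cell i) u)" for u
    proof (cases "u \<in> B")
      case False
      then have "indicator (cell i) u = (0::real)" for i by (auto simp: cell_def)
      then show ?thesis using False by (simp add: B_def)
    next
      case True
      then have "\<rho> u \<in> A" by (auto simp: A_def)
      then obtain j where j: "j < k" "v j = \<rho> u" using v unfolding bij_betw_def by auto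
      have "indicator (cell i) u = (if i = j then 1 else 0 :: real)" if "i < k" for i
        using True j that v unfolding bij_betw_def inj_on_def by (auto simp: cell_def indicator_def)
      then have "(\<Sum>i<k. z (v i) * indicator (cell i) u) = (\<Sum>i<k. if i = j then z (v i) else 0)"
        by (intro sum.cong) auto
      also have "\<dots> = z (\<rho> u)" using j by simp
      finally show ?thesis using True by (simp add: B_def)
    qed
    have D: "(LINT u|lborel. indicator (ball 0 R) u * z (\<rho> u)) = (\<Sum>i<k. w i * z (v i))"
      unfolding split w_def using int_cell by (subst Bochner_Integration.integral_sum) (auto simp: mult.commute)
    have N: "(LINT u|lborel. (indicator (ball 0 R) u * z (\<rho> u)) *\<^sub>R u) = (\<Sum>i<k. z (v i) *\<^sub>R m i)"
    proof -
      have "(LINT u|lborel. (indicator (ball 0 R) u * z (\<rho> u)) *\<^sub>R u) =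
            (LINT u|lborel. (\<Sum>i<k. z (v i) *\<^sub>R ((indicator (cell i) u :: real) *\<^sub>R u)))"
        unfolding split by (simp only: scaleR_sum_left scaleR_scaleR)
      also have "\<dots> = (\<Sum>i<k. z (v i) *\<^sub>R m i)"
        unfolding m_def using int_cell_mom
        by (subst Bochner_Integration.integral_sum) (simp_all del: scaleR_scaleR)
      finally show ?thesis .
    qed
    obtain j where j: "j < k" "v j = 0" using v A0 unfolding bij_betw_def by (metis (mono_tags) imageE lessThan_iff)
    have "w0 = (LINT u|lborel. indicator (ball (0::real^'p) (min h R)) u)"
      by (simp add: w0_def)
    also have "\<dots> \<le> w j" unfolding w_def
    proof (rule integral_mono)
      show "integrable lborel (indicator (ball (0::real^'p) (min h R)) :: _ \<Rightarrow> real)"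
        using emeasure_lborel_ball_finite by (intro integrable_real_indicator) auto
      show "indicator (ball 0 (min h R)) u \<le> (indicator (cell j) u :: real)" for u
        using \<rho>0[of u] j by (auto simp: indicator_def cell_def B_def)
    qed (rule int_cell)
    also have "w j = w j * z (v j)" using j z by simp
    also have "\<dots> \<le> (\<Sum>i<k. w i * z (v i))"
      by (rule member_le_sum) (use j z in \<open>auto simp: w_def\<close>)
    finally have "max (\<Sum>i<k. w i * z (v i)) w0 = (\<Sum>i<k. w i * z (v i))" by simp
    moreover have "(\<Sum>i<k. w i * (if i < k then z (v i) else 0)) = (\<Sum>i<k. w i * z (v i))"
      "(\<Sum>i<k. (if i < k then z (v i) else 0) *\<^sub>R m i) = (\<Sum>i<k. z (v i) *\<^sub>R m i)"
      by (auto intro: sum.cong)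
    ultimately show ?thesis
      unfolding g_def field_mean_def D N by simp
  qed
  moreover have "k \<ge> 1" unfolding k_def using A0 finA by (simp add: Suc_le_eq card_gt_0_iff) auto
  ultimately show thesis using that cont by blast
qed

lemma field_mean_tendsto:
  fixes zs :: "nat \<Rightarrow> real^'p \<Rightarrow> real"
  assumes [measurable]: "\<And>n. zs n \<in> borel_measurable borel" "z \<in> borel_measurable borel"
    and lim: "\<And>u. (\<lambda>n. zs n u) \<longlonglongrightarrow> z u"
    and dom: "\<And>n u. \<bar>zs n u\<bar> \<le> b u"
    and b: "integrable lborel b" "integrable lborel (\<lambda>u. norm u * b u)"
    and D: "(LINT u|lborel. z u) \<noteq> 0"
  shows "(\<lambda>n. field_mean (zs n)) \<longlonglongrightarrow> field_mean z"
proof -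
  have 1: "(\<lambda>n. LINT u|lborel. zs n u) \<longlonglongrightarrow> (LINT u|lborel. z u)"
    by (rule integral_dominated_convergence[where w = b]) (use lim dom b in auto)
  have 2: "(\<lambda>n. LINT u|lborel. zs n u *\<^sub>R u) \<longlonglongrightarrow> (LINT u|lborel. z u *\<^sub>R u)"
  proof (rule integral_dominated_convergence[where w = "\<lambda>u. norm u * b u"])
    show "AE x in lborel. (\<lambda>i. zs i x *\<^sub>R x) \<longlonglongrightarrow> z x *\<^sub>R x"
      by (rule AE_I2) (intro tendsto_intros lim)
    show "AE x in lborel. norm (zs i x *\<^sub>R x) \<le> norm x * b x" for i
      using dom[of i] by (auto simp: mult.commute intro!: mult_left_mono)
  qed (use b in auto)
  show ?thesis unfolding field_mean_def by (intro tendsto_intros 1 2 D)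
qed

text \<open>Near the origin the integrand stays above half of its value there.\<close>
lemma integral_pos_of_continuous:
  fixes z :: "'a::euclidean_space \<Rightarrow> real"
  assumes cont: "continuous_on UNIV z" and nn: "\<And>u. z u \<ge> 0" and pos: "z 0 > 0" and R: "R > 0"
    and int: "integrable lborel (\<lambda>u. indicator (ball 0 R) u * z u)"
  shows "(LINT u|lborel. indicator (ball 0 R) u * z u) > 0"
proof -
  have "(z \<longlongrightarrow> z 0) (at 0)" using cont by (simp add: continuous_on_eq_continuous_at isCont_def)
  then have "eventually (\<lambda>u. z u > z 0 / 2) (at 0)"
    by (rule order_tendstoD) (use pos in auto)
  then obtain r where r: "r > 0" "\<And>u. u \<noteq> 0 \<Longrightarrow> dist u 0 < r \<Longrightarrow> z u > z 0 / 2"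
    unfolding eventually_at by auto
  let ?r = "min r R"
  have "0 < z 0 / 2 * measure lborel (ball (0::'a) ?r)"
    using pos r(1) R content_ball_gt_0_iff[of "0::'a" ?r] by simp
  also have "\<dots> = (LINT u|lborel. z 0 / 2 * indicator (ball (0::'a) ?r) u)" by simp
  also have "\<dots> \<le> (LINT u|lborel. indicator (ball 0 R) u * z u)"
  proof (rule integral_mono[OF _ int])
    show "integrable lborel (\<lambda>u. z 0 / 2 * indicator (ball (0::'a) ?r) u)"
      using emeasure_lborel_ball_finite by (intro integrable_mult_right integrable_real_indicator) auto
    show "z 0 / 2 * indicator (ball 0 ?r) u \<le> indicator (ball 0 R) u * z u" for u
    proof (cases "u = 0")
      case True then show ?thesis using pos R r by simp
    next
      case False then show ?thesis using r(2)[of u] nn[of u] by (auto simp: indicator_def)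
    qed
  qed
  finally show ?thesis .
qed

lemma indicator_ball_measurable [measurable]:
  "(\<lambda>u. indicator (ball c r) u :: real) \<in> borel_measurable borel"
  by (rule borel_measurable_indicator) simp

lemma field_mean_truncation_tendsto:
  fixes z :: "real^'p \<Rightarrow> real"
  assumes cont: "continuous_on UNIV z" and nn: "\<And>u. z u \<ge> 0" and pos: "z 0 > 0"
    and int: "integrable lborel z" "integrable lborel (\<lambda>u. norm u * z u)"
  shows "(\<lambda>n. field_mean (\<lambda>u. indicator (ball 0 (real n)) u * z u)) \<longlonglongrightarrow> field_mean z"
proof (rule field_mean_tendsto[OF _ _ _ _ int])
  have m[measurable]: "z \<in> borel_measurable borel" using cont by (rule borel_measurable_continuous_onI)
  show "(\<lambda>u. indicator (ball 0 (real n)) u * z u) \<in> borel_measurable borel" for n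
    by (intro borel_measurable_times m indicator_ball_measurable)
  show "(\<lambda>n. indicator (ball 0 (real n)) u * z u) \<longlonglongrightarrow> z u" for u
  proof (rule tendsto_eventually)
    obtain N :: nat where N: "norm u < real N" using reals_Archimedean2 by blast
    show "eventually (\<lambda>n. indicator (ball 0 (real n)) u * z u = z u) sequentially"
      using eventually_ge_at_top[of N] by eventually_elim (use N in auto)
  qed
  show "\<bar>indicator (ball 0 (real n)) u * z u\<bar> \<le> z u" for n u by (auto simp: indicator_def nn)
  have i1: "integrable lborel (\<lambda>u. indicator (ball 0 1) u * z u)"
    by (rule Bochner_Integration.integrable_bound[OF int(1)]) (auto simp: indicator_def nn)
  have "0 < (LINT u|lborel. indicator (ball 0 1) u * z u)"
    by (rule integral_pos_of_continuous[OF cont nn pos _ i1]) simp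
  also have "\<dots> \<le> (LINT u|lborel. z u)"
    by (rule integral_mono[OF i1 int(1)]) (auto simp: indicator_def nn)
  finally show "(LINT u|lborel. z u) \<noteq> 0" by simp
qed (use cont in \<open>rule borel_measurable_continuous_onI\<close>)

lemma field_mean_discretization_tendsto:
  fixes z :: "real^'p \<Rightarrow> real"
  assumes cont: "continuous_on UNIV z" and nn: "\<And>u. z u \<ge> 0" and pos: "z 0 > 0" and R: "R > 0"
    and [measurable]: "\<And>n. \<rho> n \<in> borel_measurable borel"
    and close: "\<And>n u. norm (\<rho> n u - u) \<le> h n" and h: "h \<longlonglongrightarrow> 0" "\<And>n. h n \<le> 1"
  shows "(\<lambda>n. field_mean (\<lambda>u. indicator (ball 0 R) u * z (\<rho> n u)))
           \<longlonglongrightarrow> field_mean (\<lambda>u. indicator (ball 0 R) u * z u)"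
proof -
  have m[measurable]: "z \<in> borel_measurable borel" using cont by (rule borel_measurable_continuous_onI)
  have "compact (z ` cball 0 (R + 1))"
    by (intro compact_continuous_image continuous_on_subset[OF cont]) auto
  then obtain K where K: "\<And>u. u \<in> cball 0 (R + 1) \<Longrightarrow> norm (z u) \<le> K"
    using compact_imp_bounded[of "z ` cball 0 (R + 1)"] unfolding bounded_iff by blast
  have int_ind: "integrable lborel (indicator (ball (0::real^'p) R) :: _ \<Rightarrow> real)"
    using emeasure_lborel_ball_finite by (intro integrable_real_indicator) auto
  have K0: "K \<ge> 0" using K[of 0] R norm_ge_zero[of "z 0"] by (simp del: norm_ge_zero)
  let ?b = "\<lambda>u::real^'p. K * indicator (ball 0 R) u"
  have int_b: "integrable lborel ?b" using int_ind by simp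
  show ?thesis
  proof (rule field_mean_tendsto[of _ _ ?b])
    show "(\<lambda>n. indicator (ball 0 R) u * z (\<rho> n u)) \<longlonglongrightarrow> indicator (ball 0 R) u * z u" for u
    proof -
      have "(\<lambda>n. \<rho> n u - u) \<longlonglongrightarrow> 0" by (rule Lim_null_comparison[OF _ h(1)]) (simp add: close)
      then have "(\<lambda>n. \<rho> n u) \<longlonglongrightarrow> u" by (simp add: LIM_zero_iff)
      then have "(\<lambda>n. z (\<rho> n u)) \<longlonglongrightarrow> z u"
        using cont by (auto simp: continuous_on_eq_continuous_at intro: isCont_tendsto_compose)
      then show ?thesis by (intro tendsto_intros)
    qed
    show "\<bar>indicator (ball 0 R) u * z (\<rho> n u)\<bar> \<le> ?b u" for n u
    proof (cases "norm u < R")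
      case True
      have "norm (\<rho> n u) \<le> R + 1"
        using close[of n u] h(2)[of n] True norm_triangle_ineq2[of "\<rho> n u" u] by linarith
      then show ?thesis using K[of "\<rho> n u"] True by simp
    qed simp
    show "integrable lborel ?b" by (rule int_b)
    show "integrable lborel (\<lambda>u. norm u * ?b u)"
      by (rule Bochner_Integration.integrable_bound[of _ "\<lambda>u. R * ?b u"])
         (use int_b R K0 in \<open>auto simp: indicator_def abs_mult intro!: mult_right_mono\<close>)
    have i1: "integrable lborel (\<lambda>u. indicator (ball 0 R) u * z u)"
    proof (rule Bochner_Integration.integrable_bound[OF int_b])
      show "AE u in lborel. norm (indicator (ball 0 R) u * z u) \<le> norm (?b u)"
        using K K0 by (auto simp: indicator_def)
    qed measurable
    show "(LINT u|lborel. indicator (ball 0 R) u * z u) \<noteq> 0"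
      using integral_pos_of_continuous[OF cont nn pos R i1] by simp
  qed measurable
qed

section \<open>Polynomial envelopes\<close>

text \<open>
  On the dyadic shell \<open>2\<^sup>k \<le> 1 + |u| < 2\<^sup>k\<^sup>+\<^sup>1\<close> the integrand is at most \<open>2\<^sup>-\<^sup>k\<^sup>s\<close>, and the shell lies in a ball of
  volume proportional to \<open>2\<^sup>k\<^sup>d\<close>; the resulting geometric series converges for \<open>s > d\<close>.
\<close>
lemma integrable_moment_envelope:
  assumes s: "s > real DIM('a::euclidean_space)"
  shows "integrable lborel (\<lambda>u::'a. (1 + norm u) powr (- s))"
proof (rule integrableI_nonneg)
  define C where "C = unit_ball_vol (real DIM('a))"
  have C: "C \<ge> 0" unfolding C_def by simp
  define q where "q = 2 powr (real DIM('a) - s)"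
  have q: "0 < q" "q < 1" unfolding q_def using s by (auto simp: powr_less_one)
  have bound: "ennreal ((1 + norm u) powr (- s)) \<le>
     (\<Sum>k. ennreal ((2 ^ k) powr (- s)) * indicator (ball 0 (2 ^ Suc k)) u)" for u :: 'a
  proof -
    obtain k where k: "2 ^ k \<le> 1 + norm u" "1 + norm u < 2 ^ Suc k"
    proof -
      define k where "k = nat \<lfloor>log 2 (1 + norm u)\<rfloor>"
      have l: "log 2 (1 + norm u) \<ge> 0" by (simp add: add_pos_nonneg)
      have "real k \<le> log 2 (1 + norm u)" "log 2 (1 + norm u) < real (Suc k)"
        unfolding k_def using l by linarith+
      then have "2 powr real k \<le> 1 + norm u" "1 + norm u < 2 powr real (Suc k)"
        by (simp_all add: le_log_iff log_less_iff add_pos_nonneg)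
      then show thesis using that[of k] by (simp add: powr_realpow del: power_Suc of_nat_Suc)
    qed
    define t :: "nat \<Rightarrow> ennreal" where
      "t = (\<lambda>k. ennreal ((2 ^ k) powr (- s)) * indicator (ball 0 (2 ^ Suc k)) u)"
    have "(1 + norm u) powr (- s) \<le> (2 ^ k) powr (- s)"
      by (rule powr_mono2') (use k(1) s in auto)
    moreover have "u \<in> ball 0 (2 ^ Suc k)" using k(2) by (simp add: )
    ultimately have "ennreal ((1 + norm u) powr (- s)) \<le>
       ennreal ((2 ^ k) powr (- s)) * indicator (ball 0 (2 ^ Suc k)) u"
      by (simp add: ennreal_leI)
    also have "\<dots> = t k" by (simp only: t_def)
    also have "\<dots> \<le> suminf t" using sum_le_suminf[of t "{k}"] by simp
    finally show ?thesis unfolding t_def .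
  qed
  have term_eq: "(\<integral>\<^sup>+u. ennreal ((2 ^ k) powr (- s)) * indicator (ball (0::'a) (2 ^ Suc k)) u \<partial>lborel)
      = ennreal (C * 2 ^ DIM('a) * q ^ k)" for k :: nat
  proof -
    have "(\<integral>\<^sup>+u. ennreal ((2 ^ k) powr (- s)) * indicator (ball (0::'a) (2 ^ Suc k)) u \<partial>lborel)
      = ennreal ((2 ^ k) powr (- s)) * emeasure lborel (ball (0::'a) (2 ^ Suc k))"
      by (subst nn_integral_cmult) (auto intro!: borel_measurable_indicator)
    also have "\<dots> = ennreal ((2 ^ k) powr (- s) * (C * (2 ^ Suc k) ^ DIM('a)))"
      unfolding C_def by (subst emeasure_ball) (auto simp flip: ennreal_mult)
    also have "(2 ^ k) powr (- s) * (C * (2 ^ Suc k) ^ DIM('a)) = C * 2 ^ DIM('a) * q ^ k"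
    proof -
      have "q ^ k = (2 ^ k) powr (real DIM('a) - s)"
        unfolding q_def by (simp add: powr_realpow[symmetric] powr_powr powr_power mult.commute)
      also have "\<dots> = (2 ^ k) ^ DIM('a) * (2 ^ k) powr (- s)"
        by (simp add: powr_realpow[symmetric] flip: powr_add)
      finally show ?thesis by (simp add: power_mult_distrib)
    qed
    finally show ?thesis .
  qed
  have "(\<integral>\<^sup>+u. ennreal ((1 + norm u) powr (- s)) \<partial>(lborel :: 'a measure)) \<le>
    (\<integral>\<^sup>+u. (\<Sum>k. ennreal ((2 ^ k) powr (- s)) * indicator (ball (0::'a) (2 ^ Suc k)) u) \<partial>lborel)"
    by (intro nn_integral_mono bound)
  also have "\<dots> = (\<Sum>k. ennreal (C * 2 ^ DIM('a) * q ^ k))"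
  proof (subst nn_integral_suminf)
    show "(\<lambda>u. ennreal ((2 ^ k) powr (- s)) * indicator (ball (0::'a) (2 ^ Suc k)) u)
        \<in> borel_measurable lborel" for k :: nat
      by (intro borel_measurable_times_ennreal borel_measurable_indicator) auto
  qed (simp only: term_eq)
  also have "\<dots> < \<infinity>"
  proof (subst suminf_ennreal2)
    show "summable (\<lambda>k. C * 2 ^ DIM('a) * q ^ k)"
      using q by (intro summable_mult summable_geometric) simp
    show "0 \<le> C * 2 ^ DIM('a) * q ^ k" for k using q C by simp
  qed simp
  finally show "(\<integral>\<^sup>+u. ennreal ((1 + norm u) powr (- s)) \<partial>(lborel :: 'a measure)) < \<infinity>" .
qed auto

text \<open>
  The first moment, outside the ball of radius \<open>R\<close>, of the envelope that dominates the fields. The type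
  argument selects the space of integration.
\<close>
definition tail_moment :: "'a::euclidean_space itself \<Rightarrow> real \<Rightarrow> real \<Rightarrow> real" where
  "tail_moment _ s R = (LINT u::'a|lborel. indicator (- ball 0 R) u * (norm u * (1 + norm u) powr (- s)))"

lemma integrable_moment_weight:
  assumes "s > real DIM('a::euclidean_space) + 1"
  shows "integrable lborel (\<lambda>u::'a. norm u * (1 + norm u) powr (- s))"
proof (rule Bochner_Integration.integrable_bound)
  show "integrable lborel (\<lambda>u::'a. (1 + norm u) powr (- (s - 1)))"
    by (rule integrable_moment_envelope) (use assms in simp)
  have "norm u * (1 + norm u) powr (- s) \<le> (1 + norm u) powr (- (s - 1))" for u :: 'a
  proof -
    have "norm u * (1 + norm u) powr (- s) \<le> (1 + norm u) * (1 + norm u) powr (- s)"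
      by (intro mult_right_mono) auto
    also have "\<dots> = (1 + norm u) powr (1 + (- s))"
      by (subst powr_add) (simp add: add_pos_nonneg abs_of_pos)
    finally show ?thesis by simp
  qed
  then show "AE u::'a in lborel. norm (norm u * (1 + norm u) powr (- s)) \<le> norm ((1 + norm u) powr (- (s - 1)))"
    by simp
qed simp

lemma tail_moment_tendsto_0:
  assumes "s > real DIM('a::euclidean_space) + 1"
  shows "(\<lambda>n. tail_moment TYPE('a) s (real n)) \<longlonglongrightarrow> 0"
proof -
  let ?w = "\<lambda>u::'a. norm u * (1 + norm u) powr (- s)"
  have "(\<lambda>n. LINT u::'a|lborel. indicator (- ball 0 (real n)) u * ?w u) \<longlonglongrightarrow> (LINT u::'a|lborel. 0)"
  proof (rule integral_dominated_convergence[where w = ?w])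
    show "integrable lborel ?w" by (rule integrable_moment_weight[OF assms])
    show "AE u::'a in lborel. (\<lambda>n. indicator (- ball 0 (real n)) u * ?w u) \<longlonglongrightarrow> 0"
    proof (rule AE_I2, rule tendsto_eventually)
      fix u :: 'a
      obtain N :: nat where N: "norm u < real N" using reals_Archimedean2 by blast
      show "eventually (\<lambda>n. indicator (- ball 0 (real n)) u * ?w u = 0) sequentially"
        using eventually_ge_at_top[of N] by eventually_elim (use N in auto)
    qed
  qed (auto simp: indicator_def)
  then show ?thesis by (simp add: tail_moment_def)
qed

lemma integrable_bounded_support:
  fixes y :: "'a::euclidean_space \<Rightarrow> real"
  assumes "y \<in> borel_measurable borel" and bd: "\<And>u. \<bar>y u\<bar> \<le> C" and supp: "\<And>u. norm u > R \<Longrightarrow> y u = 0"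
  shows "integrable lborel y" "integrable lborel (\<lambda>u. norm u * y u)"
proof -
  note [measurable] = assms(1)
  have C: "C \<ge> 0" using bd[of 0] by linarith
  have int_ind: "integrable lborel (indicator (cball (0::'a) \<bar>R\<bar>) :: _ \<Rightarrow> real)"
    using emeasure_lborel_cball_finite by (intro integrable_real_indicator) auto
  show "integrable lborel y"
  proof (rule Bochner_Integration.integrable_bound[of _ "\<lambda>u. C * indicator (cball 0 \<bar>R\<bar>) u"])
    have "norm (y u) \<le> norm (C * indicator (cball 0 \<bar>R\<bar>) u)" for u
      using bd[of u] supp[of u] C by (cases "norm u \<le> \<bar>R\<bar>") auto
    then show "AE u in lborel. norm (y u) \<le> norm (C * indicator (cball 0 \<bar>R\<bar>) u)" by simp
  qed (use int_ind in auto)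
  show "integrable lborel (\<lambda>u. norm u * y u)"
  proof (rule Bochner_Integration.integrable_bound[of _ "\<lambda>u. (\<bar>R\<bar> * C) * indicator (cball 0 \<bar>R\<bar>) u"])
    have "norm (norm u * y u) \<le> norm (\<bar>R\<bar> * C * indicator (cball 0 \<bar>R\<bar>) u)" for u
    proof (cases "norm u \<le> \<bar>R\<bar>")
      case True
      then show ?thesis using bd[of u] C by (auto simp: abs_mult intro!: mult_mono)
    next
      case False then show ?thesis using supp[of u] by auto
    qed
    then show "AE u in lborel. norm (norm u * y u) \<le> norm (\<bar>R\<bar> * C * indicator (cball 0 \<bar>R\<bar>) u)" by simp
  qed (use int_ind in auto)
qed

lemma integrable_of_envelope:
  fixes z :: "'a::euclidean_space \<Rightarrow> real"
  assumes cont: "continuous_on UNIV z" and nn: "\<And>u. z u \<ge> 0" and s: "s > real DIM('a) + 1"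
    and env: "\<And>u. norm u > R \<Longrightarrow> z u \<le> K * (1 + norm u) powr (- s)"
  shows "integrable lborel z" "integrable lborel (\<lambda>u. norm u * z u)"
proof -
  have [measurable]: "z \<in> borel_measurable borel" using cont by (rule borel_measurable_continuous_onI)
  have [measurable]: "cball (0::'a) R \<in> sets borel" by simp
  have "compact (z ` cball 0 R)"
    by (intro compact_continuous_image continuous_on_subset[OF cont]) auto
  then obtain C where C: "\<And>u. u \<in> cball 0 R \<Longrightarrow> norm (z u) \<le> C"
    using compact_imp_bounded[of "z ` cball 0 R"] unfolding bounded_iff by blast
  let ?in = "\<lambda>u. indicator (cball 0 R) u * z u"
  have b: "\<bar>?in u\<bar> \<le> max 0 C" for u
    using C[of u] by (cases "u \<in> cball 0 R") auto
  have m_in: "?in \<in> borel_measurable borel" by measurable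
  note int_in = integrable_bounded_support[OF m_in b, of R]
  have int_w: "integrable lborel (\<lambda>u::'a. (1 + norm u) powr (- s))"
    by (rule integrable_moment_envelope) (use s in simp)
  have K: "z u \<le> \<bar>K\<bar> * (1 + norm u) powr (- s)" if "norm u > R" for u
    using env[OF that] by (meson abs_ge_self mult_right_mono order_trans powr_ge_zero)
  show "integrable lborel z"
  proof (rule Bochner_Integration.integrable_bound)
    show "integrable lborel (\<lambda>u. ?in u + \<bar>K\<bar> * (1 + norm u) powr (- s))"
      by (intro Bochner_Integration.integrable_add int_in integrable_mult_right int_w) auto
    have "z u \<le> ?in u + \<bar>K\<bar> * (1 + norm u) powr (- s)" for u
      using K[of u] by (cases "norm u \<le> R") auto
    then show "AE u in lborel. norm (z u) \<le> norm (?in u + \<bar>K\<bar> * (1 + norm u) powr (- s))"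
      using nn by (intro AE_I2) (auto simp: abs_le_iff intro: order_trans)
  qed measurable
  show "integrable lborel (\<lambda>u. norm u * z u)"
  proof (rule Bochner_Integration.integrable_bound)
    show "integrable lborel (\<lambda>u. norm u * ?in u + \<bar>K\<bar> * (norm u * (1 + norm u) powr (- s)))"
      by (intro Bochner_Integration.integrable_add int_in integrable_mult_right integrable_moment_weight[OF s]) auto
    have "norm u * z u \<le> norm u * ?in u + \<bar>K\<bar> * (norm u * (1 + norm u) powr (- s))" for u
    proof (cases "norm u \<le> R")
      case False
      then have "norm u * z u \<le> norm u * (\<bar>K\<bar> * (1 + norm u) powr (- s))"
        using K[of u] by (intro mult_left_mono) auto
      then show ?thesis using False by (simp add: mult_ac)
    qed auto
    then show "AE u in lborel. norm (norm u * z u) \<le> norm (norm u * ?in u + \<bar>K\<bar> * (norm u * (1 + norm u) powr (- s)))"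
      using nn by (intro AE_I2) (auto simp: abs_mult abs_le_iff intro: order_trans)
  qed measurable
qed

section \<open>The mean of a weighted field on a single path\<close>

text \<open>
  One path of the local field together with the weight that the prior puts on the local parameter. The
  quantity studied is the unnormalised posterior density \<open>local_density\<close>.
\<close>
locale weighted_local_field =
  fixes z :: "real^'p \<Rightarrow> real" and UU :: "(real^'p) set" and q :: "real^'p \<Rightarrow> real" and Q :: real
  assumes z_cont: "continuous_on UNIV z" and z_nonneg: "\<And>u. z u \<ge> 0"
    and z_pos: "\<And>u. u \<in> UU \<Longrightarrow> z u > 0" and z_0: "z 0 = 1"
    and UU: "open UU" "bounded UU"
    and q_meas: "(\<lambda>u. indicator UU u * q u) \<in> borel_measurable borel"
    and q_bounds: "\<And>u. u \<in> UU \<Longrightarrow> 0 \<le> q u" "\<And>u. u \<in> UU \<Longrightarrow> q u \<le> Q"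
begin

definition local_density :: "real^'p \<Rightarrow> real" where "local_density u = indicator UU u * z u * q u"

lemma density_nonneg: "local_density u \<ge> 0"
  unfolding local_density_def using z_nonneg[of u] q_bounds(1)[of u] by (simp add: indicator_def)

lemma density_integrable: "integrable lborel local_density" "integrable lborel (\<lambda>u. norm u * local_density u)"
proof -
  have [measurable]: "z \<in> borel_measurable borel" using z_cont by (rule borel_measurable_continuous_onI)
  note q_meas[measurable]
  have "local_density = (\<lambda>u. z u * (indicator UU u * q u))" by (auto simp: local_density_def fun_eq_iff)
  then have meas: "local_density \<in> borel_measurable borel" by simp
  obtain R where R: "\<And>u. u \<in> UU \<Longrightarrow> norm u \<le> R" using UU(2) unfolding bounded_iff by blast
  have "compact (z ` cball 0 R)"
    by (intro compact_continuous_image continuous_on_subset[OF z_cont]) auto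
  then obtain C where C: "\<And>u. u \<in> cball 0 R \<Longrightarrow> norm (z u) \<le> C"
    using compact_imp_bounded[of "z ` cball 0 R"] unfolding bounded_iff by blast
  have bd: "\<bar>local_density u\<bar> \<le> max 0 (C * Q)" for u
  proof (cases "u \<in> UU")
    case True
    then have "z u * q u \<le> C * Q"
      using C[of u] R[of u] q_bounds[of u] z_nonneg[of u] by (intro mult_mono) auto
    then show ?thesis using True density_nonneg[of u] by (simp add: local_density_def)
  qed (simp add: local_density_def)
  have "local_density u = 0" if "norm u > R" for u
    using R[of u] that by (cases "u \<in> UU") (auto simp: local_density_def)
  then show "integrable lborel local_density" "integrable lborel (\<lambda>u. norm u * local_density u)"
    using integrable_bounded_support[OF meas bd] by blast+
qed

text \<open>
  A small increment of \<open>ln z\<close> is a small relative change of \<open>z\<close>, and the weight is close to one. The bound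
  is relative to \<open>z v\<close> and hence uniform in the size of the field. The constant five collects
  \<open>|exp s - 1| \<le> 2 \<epsilon>\<close>, a weight of at most two, and the deviation \<open>\<epsilon>\<close> of the weight itself.
\<close>
lemma density_close:
  assumes ball: "ball 0 (R + 1) \<subseteq> UU" and u: "norm u < R"
    and \<epsilon>: "0 \<le> \<epsilon>" "\<epsilon> \<le> 1"
    and q1: "\<bar>q u - 1\<bar> \<le> \<epsilon>"
    and modulus: "\<And>u1 u2. u1 \<in> UU \<Longrightarrow> u2 \<in> UU \<Longrightarrow> norm u1 < R + 1 \<Longrightarrow> norm u2 < R + 1 \<Longrightarrow>
        norm (u2 - u1) \<le> \<delta> \<Longrightarrow> \<bar>ln (z u2) - ln (z u1)\<bar> \<le> \<epsilon>"
    and v: "norm (v - u) \<le> \<delta>" "norm (v - u) \<le> 1"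
  shows "\<bar>local_density u - z v\<bar> \<le> 5 * \<epsilon> * z v"
proof -
  have vR: "norm v < R + 1" using v(2) u norm_triangle_ineq2[of v u] by linarith
  have uU: "u \<in> UU" and vU: "v \<in> UU" using ball u vR by auto
  define s where "s = ln (z u) - ln (z v)"
  have s: "\<bar>s\<bar> \<le> \<epsilon>" unfolding s_def
    using modulus[OF vU uU vR _] u v(1) by (simp add: norm_minus_commute)
  have zu: "z u = z v * exp s"
    unfolding s_def using z_pos[OF uU] z_pos[OF vU] by (simp add: exp_diff)
  have e1: "\<bar>exp s - 1\<bar> \<le> 2 * \<epsilon>"
  proof (cases "s \<ge> 0")
    case True
    then have "exp s \<le> 1 + s + s\<^sup>2" using s \<epsilon> by (intro exp_bound) auto
    moreover have "s\<^sup>2 \<le> 1 * s" unfolding power2_eq_square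
      using True s \<epsilon> by (intro mult_right_mono) auto
    ultimately show ?thesis using True s exp_ge_add_one_self[of s] by linarith
  next
    case False
    then have "exp s \<le> 1" by simp
    then show ?thesis using s exp_ge_add_one_self[of s] by linarith
  qed
  have "\<bar>exp s * q u - 1\<bar> = \<bar>(exp s - 1) * q u + (q u - 1)\<bar>" by (simp add: algebra_simps)
  also have "\<dots> \<le> \<bar>exp s - 1\<bar> * \<bar>q u\<bar> + \<bar>q u - 1\<bar>"
    using abs_triangle_ineq[of "(exp s - 1) * q u" "q u - 1"] by (simp add: abs_mult)
  also have "\<dots> \<le> (2 * \<epsilon>) * 2 + \<epsilon>"
    using e1 q1 \<epsilon> by (intro add_mono mult_mono) auto
  finally have "\<bar>exp s * q u - 1\<bar> \<le> 5 * \<epsilon>" by simp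
  moreover have "local_density u - z v = z v * (exp s * q u - 1)"
    using uU by (simp add: local_density_def zu algebra_simps)
  ultimately show ?thesis
    using mult_left_mono[of "\<bar>exp s * q u - 1\<bar>" "5 * \<epsilon>" "z v"] z_nonneg[of v]
    by (simp add: abs_mult mult_ac)
qed

text \<open>
  Since \<open>z 0 = 1\<close>, the modulus of \<open>ln z\<close> keeps \<open>z\<close> above \<open>exp (-1)\<close> on a small ball. The bound is the same
  for all \<open>R \<ge> 1\<close>, which allows the truncation radius to be chosen after it.
\<close>
lemma density_mass_lower_bound:
  assumes ball: "ball 0 1 \<subseteq> UU" and \<delta>: "0 < \<delta>" "\<delta> < 1" and R: "R \<ge> 1"
    and q1: "\<And>u. norm u < 1 \<Longrightarrow> \<bar>q u - 1\<bar> \<le> 1 / 2"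
    and modulus: "\<And>u1 u2. u1 \<in> UU \<Longrightarrow> u2 \<in> UU \<Longrightarrow> norm u1 < 1 \<Longrightarrow> norm u2 < 1 \<Longrightarrow>
        norm (u2 - u1) \<le> \<delta> \<Longrightarrow> \<bar>ln (z u2) - ln (z u1)\<bar> \<le> 1"
  shows "exp (-1) / 2 * measure lborel (ball (0::real^'p) \<delta>) \<le> (LINT u|lborel. indicator (ball 0 R) u * local_density u)"
proof -
  have "exp (-1) / 2 * measure lborel (ball (0::real^'p) \<delta>) = (LINT u|lborel. exp (-1) / 2 * indicator (ball (0::real^'p) \<delta>) u)"
    by simp
  also have "\<dots> \<le> (LINT u|lborel. indicator (ball 0 R) u * local_density u)"
  proof (rule integral_mono)
    show "integrable lborel (\<lambda>u. exp (-1) / 2 * indicator (ball (0::real^'p) \<delta>) u :: real)"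
      using emeasure_lborel_ball_finite by (intro integrable_mult_right integrable_real_indicator) auto
    have [measurable]: "local_density \<in> borel_measurable borel" using density_integrable by auto
    show "integrable lborel (\<lambda>u. indicator (ball 0 R) u * local_density u)"
      by (rule Bochner_Integration.integrable_bound[OF density_integrable(1)]) (auto simp: indicator_def density_nonneg)
    show "exp (-1) / 2 * indicator (ball 0 \<delta>) u \<le> indicator (ball 0 R) u * local_density u" for u :: "real^'p"
    proof (cases "norm u < \<delta>")
      case True
      then have u1: "norm u < 1" using \<delta> by simp
      have uU: "u \<in> UU" "0 \<in> UU" using ball u1 by auto
      have "\<bar>ln (z u) - ln (z 0)\<bar> \<le> 1" using modulus[of 0 u] uU u1 True by simp
      then have "ln (z u) \<ge> -1" by (simp add: z_0)
      then have "z u \<ge> exp (-1)" using z_pos[OF uU(1)] by (simp add: ln_ge_iff)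
      moreover have "q u \<ge> 1 / 2" using q1[OF u1] by linarith
      ultimately have "exp (-1) * (1 / 2) \<le> z u * q u" using z_nonneg by (intro mult_mono) auto
      then show ?thesis using True u1 R uU by (simp add: local_density_def)
    qed (use density_nonneg[of u] in auto)
  qed
  finally show ?thesis .
qed

lemma density_tail_bound:
  assumes s: "s > real CARD('p) + 1" and K: "K \<ge> 0"
    and env: "\<And>u. u \<in> UU \<Longrightarrow> norm u \<ge> R \<Longrightarrow> z u \<le> K * (1 + norm u) powr (- s)"
  shows "(LINT u|lborel. indicator (- ball 0 R) u * (norm u * local_density u)) \<le> \<bar>Q\<bar> * K * tail_moment TYPE(real^'p) s R"
proof -
  have [measurable]: "local_density \<in> borel_measurable borel" using density_integrable by auto
  have w: "integrable lborel (\<lambda>u::real^'p. norm u * (1 + norm u) powr (- s))"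
    by (rule integrable_moment_weight) (use s in simp)
  have "(LINT u|lborel. indicator (- ball 0 R) u * (norm u * local_density u))
     \<le> (LINT u::real^'p|lborel. \<bar>Q\<bar> * K * (indicator (- ball 0 R) u * (norm u * (1 + norm u) powr (- s))))"
  proof (rule integral_mono)
    show "integrable lborel (\<lambda>u. indicator (- ball 0 R) u * (norm u * local_density u))"
      by (rule Bochner_Integration.integrable_bound[OF density_integrable(2)])
         (auto simp: indicator_def density_nonneg)
    show "integrable lborel (\<lambda>u::real^'p. \<bar>Q\<bar> * K * (indicator (- ball 0 R) u * (norm u * (1 + norm u) powr (- s))))"
      by (rule integrable_mult_right, rule Bochner_Integration.integrable_bound[OF w])
         (auto simp: indicator_def)
    show "indicator (- ball 0 R) u * (norm u * local_density u)
      \<le> \<bar>Q\<bar> * K * (indicator (- ball 0 R) u * (norm u * (1 + norm u) powr (- s)))" for u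
    proof (cases "u \<in> UU \<and> norm u \<ge> R")
      case True
      then have "z u * q u \<le> (K * (1 + norm u) powr (- s)) * \<bar>Q\<bar>"
        using env[of u] q_bounds[of u] z_nonneg[of u] K by (intro mult_mono) auto
      then have "norm u * (z u * q u) \<le> norm u * ((K * (1 + norm u) powr (- s)) * \<bar>Q\<bar>)"
        by (rule mult_left_mono) simp
      then show ?thesis using True by (simp add: local_density_def mult_ac)
    next
      case False
      then show ?thesis using K by (auto simp: local_density_def indicator_def)
    qed
  qed
  also have "\<dots> = \<bar>Q\<bar> * K * tail_moment TYPE(real^'p) s R"
    by (simp add: tail_moment_def)
  finally show ?thesis .
qed

lemma field_mean_local_density_close:
  assumes ball: "ball 0 (R + 1) \<subseteq> UU" and R: "R \<ge> 1"
    and \<rho>[measurable]: "\<rho> \<in> borel_measurable borel" and close: "\<And>u. norm (\<rho> u - u) \<le> \<delta>" "\<delta> \<le> 1"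
    and \<epsilon>: "0 \<le> \<epsilon>" "\<epsilon> \<le> 1 / 10"
    and q1: "\<And>u. norm u < R \<Longrightarrow> \<bar>q u - 1\<bar> \<le> \<epsilon>"
    and modulus: "\<And>u1 u2. u1 \<in> UU \<Longrightarrow> u2 \<in> UU \<Longrightarrow> norm u1 < R + 1 \<Longrightarrow> norm u2 < R + 1 \<Longrightarrow>
        norm (u2 - u1) \<le> \<delta> \<Longrightarrow> \<bar>ln (z u2) - ln (z u1)\<bar> \<le> \<epsilon>"
    and mass: "\<kappa> > 0" "(LINT u|lborel. indicator (ball 0 R) u * local_density u) \<ge> \<kappa>"
    and tail: "(LINT u|lborel. indicator (- ball 0 R) u * (norm u * local_density u)) \<le> t"
  shows "norm (field_mean local_density - field_mean (\<lambda>u. indicator (ball 0 R) u * z (\<rho> u))) \<le> 20 * R * \<epsilon> + 2 * t / \<kappa>"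
proof -
  let ?z = "\<lambda>u. indicator (ball 0 R) u * z (\<rho> u)"
  have [measurable]: "z \<in> borel_measurable borel" using z_cont by (rule borel_measurable_continuous_onI)
  have "compact (z ` cball 0 (R + 1))"
    by (intro compact_continuous_image continuous_on_subset[OF z_cont]) auto
  then obtain C where C: "\<And>u. u \<in> cball 0 (R + 1) \<Longrightarrow> norm (z u) \<le> C"
    using compact_imp_bounded[of "z ` cball 0 (R + 1)"] unfolding bounded_iff by blast
  have bd: "\<bar>?z u\<bar> \<le> max 0 C" for u
  proof (cases "norm u < R")
    case True
    have "norm (\<rho> u) \<le> R + 1"
      using close(1)[of u] close(2) True norm_triangle_ineq2[of "\<rho> u" u] by linarith
    then show ?thesis using C[of "\<rho> u"] True by simp
  qed simp
  have m: "?z \<in> borel_measurable borel" by measurable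
  have int_z: "integrable lborel ?z"
    by (rule integrable_bounded_support(1)[OF m bd, of R]) auto
  have "norm (field_mean local_density - field_mean ?z) \<le> 4 * R * (5 * \<epsilon>) + 2 * t / \<kappa>"
  proof (rule field_mean_close[OF density_integrable density_nonneg int_z])
    show "\<bar>local_density u - ?z u\<bar> \<le> 5 * \<epsilon> * ?z u" if "norm u < R" for u
    proof -
      have "\<bar>local_density u - z (\<rho> u)\<bar> \<le> 5 * \<epsilon> * z (\<rho> u)"
        by (rule density_close[OF ball that _ _ q1[OF that] modulus close(1)])
           (use \<epsilon> close in \<open>auto intro: order_trans\<close>)
      then show ?thesis using that by simp
    qed
  qed (use z_nonneg R \<epsilon> mass tail in auto)
  then show ?thesis by simp
qed

end

section \<open>Approximation by finite-dimensional functionals\<close>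

text \<open>
  The vector of values of a field at \<open>k\<close> points, padded with zeros: this is how \<^const>\<open>Euclidean_space\<close>
  represents vectors of length \<open>k\<close>.
\<close>
definition eval_at :: "nat \<Rightarrow> (nat \<Rightarrow> 'a) \<Rightarrow> ('a \<Rightarrow> real) \<Rightarrow> nat \<Rightarrow> real" where
  "eval_at k v z = (\<lambda>i. if i < k then z (v i) else 0)"

lemma eval_at_measurable:
  fixes g :: "(nat \<Rightarrow> real) \<Rightarrow> 'b::topological_space"
  assumes "\<And>i. i < k \<Longrightarrow> (\<lambda>\<omega>. F \<omega> (v i)) \<in> borel_measurable N" "continuous_on UNIV g"
  shows "(\<lambda>\<omega>. g (eval_at k v (F \<omega>))) \<in> borel_measurable N"
proof (rule measurable_compose[OF _ borel_measurable_continuous_onI[OF assms(2)]])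
  show "(\<lambda>\<omega>. eval_at k v (F \<omega>)) \<in> borel_measurable N"
  proof (rule measurable_coordinatewise_then_product)
    fix i show "(\<lambda>\<omega>. eval_at k v (F \<omega>) i) \<in> borel_measurable N"
      using assms(1)[of i] by (cases "i < k") (simp_all add: eval_at_def)
  qed
qed

lemma field_mean_measurable:
  fixes F :: "'w \<Rightarrow> real^'p \<Rightarrow> real"
  assumes [measurable]: "(\<lambda>(\<omega>, u). F \<omega> u) \<in> borel_measurable (N \<Otimes>\<^sub>M borel)"
  shows "(\<lambda>\<omega>. field_mean (F \<omega>)) \<in> borel_measurable N"
  unfolding field_mean_def by measurable

lemma (in prob_space) expectation_le_off_event:
  assumes X: "integrable M X" and E: "E \<in> events" and c: "c \<ge> 0" "C \<ge> 0"
    and off: "\<And>\<omega>. \<omega> \<in> space M - E \<Longrightarrow> X \<omega> \<le> c" and bd: "\<And>\<omega>. \<omega> \<in> space M \<Longrightarrow> X \<omega> \<le> C"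
  shows "expectation X \<le> c + C * prob E"
proof -
  have "expectation X \<le> expectation (\<lambda>\<omega>. c + C * indicator E \<omega>)"
  proof (rule integral_mono[OF X])
    show "integrable M (\<lambda>\<omega>. c + C * indicator E \<omega>)" using E by (auto simp: emeasure_eq_measure)
    show "X \<omega> \<le> c + C * indicator E \<omega>" if "\<omega> \<in> space M" for \<omega>
      using off[of \<omega>] bd[of \<omega>] c that by (cases "\<omega> \<in> E") auto
  qed
  also have "\<dots> = c + C * prob E" using E by (simp add: emeasure_eq_measure prob_space)
  finally show ?thesis .
qed

text \<open>
  The unconditional situation to which the theorem is reduced along a sequence: tightness at infinity,
  equicontinuity in probability of the logarithms, and convergence of the finite-dimensional laws. The
  exceptional events are only required to exist, so that no measurability of suprema enters here.
\<close>
locale converging_fields = M: prob_space M + Mb: prob_space Mb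
  for M :: "'w measure" and Mb :: "'v measure" +
  fixes Zn :: "nat \<Rightarrow> 'w \<Rightarrow> real^'p \<Rightarrow> real" and UU :: "nat \<Rightarrow> (real^'p) set"
    and q :: "nat \<Rightarrow> real^'p \<Rightarrow> real" and Q s :: real and Zlim :: "'v \<Rightarrow> real^'p \<Rightarrow> real"
  assumes Zn_meas: "\<And>n. (\<lambda>(\<omega>, u). Zn n \<omega> u) \<in> borel_measurable (M \<Otimes>\<^sub>M borel)"
    and Zn_field: "\<And>n \<omega>. \<omega> \<in> space M \<Longrightarrow> weighted_local_field (Zn n \<omega>) (UU n) (q n) Q"
    and UU_exhaust: "\<And>R. eventually (\<lambda>n. ball 0 R \<subseteq> UU n) sequentially"
    and q_meas: "\<And>n. (\<lambda>u. indicator (UU n) u * q n u) \<in> borel_measurable borel"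
    and q_tendsto: "\<And>R e. e > 0 \<Longrightarrow> eventually (\<lambda>n. \<forall>u. norm u < R \<longrightarrow> \<bar>q n u - 1\<bar> \<le> e) sequentially"
    and s: "s > real CARD('p) + 1"
    and tight: "\<And>e. e > 0 \<Longrightarrow> \<exists>K R. K > 0 \<and> eventually (\<lambda>n. \<exists>E\<in>sets M. measure M E \<le> e \<and>
        (\<forall>\<omega>\<in>space M - E. \<forall>u\<in>UU n. norm u \<ge> R \<longrightarrow> Zn n \<omega> u \<le> K * (1 + norm u) powr (- s))) sequentially"
    and equicontinuous: "\<And>\<epsilon> c e. \<epsilon> > 0 \<Longrightarrow> c > 0 \<Longrightarrow> e > 0 \<Longrightarrow> \<exists>\<delta>. 0 < \<delta> \<and> \<delta> < 1 \<and>
        eventually (\<lambda>n. \<exists>E\<in>sets M. measure M E \<le> e \<and>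
        (\<forall>\<omega>\<in>space M - E. \<forall>u1\<in>UU n. \<forall>u2\<in>UU n. norm u1 < c \<longrightarrow> norm u2 < c \<longrightarrow> norm (u2 - u1) \<le> \<delta> \<longrightarrow>
           \<bar>ln (Zn n \<omega> u2) - ln (Zn n \<omega> u1)\<bar> \<le> \<epsilon>)) sequentially"
    and fdd: "\<And>k v (f :: (nat \<Rightarrow> real) \<Rightarrow> real). k \<ge> 1 \<Longrightarrow> continuous_on UNIV f \<Longrightarrow> bounded (range f) \<Longrightarrow>
        (\<lambda>n. LINT \<omega>|M. f (eval_at k v (Zn n \<omega>))) \<longlonglongrightarrow> (LINT \<omega>|Mb. f (eval_at k v (Zlim \<omega>)))"
    and Zlim_meas: "\<And>u. (\<lambda>\<omega>. Zlim \<omega> u) \<in> borel_measurable Mb"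
    and Zlim_cont: "\<And>\<omega>. \<omega> \<in> space Mb \<Longrightarrow> continuous_on UNIV (Zlim \<omega>)"
begin

lemma Zn_meas1: "(\<lambda>\<omega>. Zn n \<omega> u) \<in> borel_measurable M"
  using measurable_compose[OF measurable_Pair[OF measurable_ident_sets[OF refl] measurable_const] Zn_meas[of n], of u]
  by simp

lemma Zlim_meas2: "(\<lambda>(\<omega>, u). Zlim \<omega> u) \<in> borel_measurable (Mb \<Otimes>\<^sub>M borel)"
  by (rule Caratheodory_measurable[OF Zlim_meas Zlim_cont])

lemma Zn_nonneg: "\<omega> \<in> space M \<Longrightarrow> Zn n \<omega> u \<ge> 0" and Zn_0: "\<omega> \<in> space M \<Longrightarrow> Zn n \<omega> 0 = 1"
  using Zn_field[of \<omega> n] by (auto simp: weighted_local_field_def)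

lemma fdd_upper_bound:
  fixes f :: "(nat \<Rightarrow> real) \<Rightarrow> real"
  assumes "k \<ge> 1" "continuous_on UNIV f" "bounded (range f)"
    and ev: "eventually (\<lambda>n. (LINT \<omega>|M. f (eval_at k v (Zn n \<omega>))) \<le> e) sequentially"
  shows "(LINT \<omega>|Mb. f (eval_at k v (Zlim \<omega>))) \<le> e"
  by (rule tendsto_upperbound[OF fdd[OF assms(1-3)] ev]) simp

lemma Mb_integrable_eval:
  assumes "continuous_on UNIV f" and bd: "\<And>x. \<bar>f x\<bar> \<le> (C::real)"
  shows "integrable Mb (\<lambda>\<omega>. f (eval_at k v (Zlim \<omega>)))"
  by (rule Mb.integrable_const_bound[of _ C]) (use assms Zlim_meas in \<open>auto intro: eval_at_measurable\<close>)

lemma M_integrable_eval: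
  assumes "continuous_on UNIV f" and bd: "\<And>x. \<bar>f x\<bar> \<le> (C::real)"
  shows "integrable M (\<lambda>\<omega>. f (eval_at k v (Zn n \<omega>)))"
  by (rule M.integrable_const_bound[of _ C]) (use assms Zn_meas1 in \<open>auto intro: eval_at_measurable\<close>)

text \<open>
  Nonnegativity and the value one at the origin pass to the limit field in this way: the violation, cut
  off at one, is a bounded continuous function of a single value, with vanishing expectation.
\<close>
lemma fdd_null:
  assumes k: "k \<ge> 1" and f: "continuous_on UNIV f" "\<And>x. 0 \<le> f x" "\<And>x. f x \<le> (1::real)"
    and 0: "\<And>n \<omega>. \<omega> \<in> space M \<Longrightarrow> f (eval_at k v (Zn n \<omega>)) = 0"
  shows "AE \<omega> in Mb. f (eval_at k v (Zlim \<omega>)) = 0"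
proof -
  have bdd: "bounded (range f)"
    by (rule boundedI[of _ 1]) (use f in auto)
  have "(LINT \<omega>|M. f (eval_at k v (Zn n \<omega>))) = (LINT \<omega>|M. 0)" for n
    by (rule Bochner_Integration.integral_cong) (use 0 in auto)
  then have "(LINT \<omega>|Mb. f (eval_at k v (Zlim \<omega>))) \<le> 0"
    by (intro fdd_upper_bound[OF k f(1) bdd]) simp
  moreover have "integrable Mb (\<lambda>\<omega>. f (eval_at k v (Zlim \<omega>)))"
    by (rule Mb_integrable_eval[OF f(1), of 1]) (use f in auto)
  moreover have "0 \<le> (LINT \<omega>|Mb. f (eval_at k v (Zlim \<omega>)))"
    by (rule Bochner_Integration.integral_nonneg) (rule f(2))
  ultimately show ?thesis
    using integral_nonneg_eq_0_iff_AE[of Mb "\<lambda>\<omega>. f (eval_at k v (Zlim \<omega>))"] f(2) by auto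
qed

lemma AE_Zlim_nonneg: "AE \<omega> in Mb. \<forall>u. Zlim \<omega> u \<ge> 0"
proof -
  obtain T :: "(real^'p) set" where T: "countable T" "UNIV \<subseteq> closure T" by (rule separable)
  have "AE \<omega> in Mb. Zlim \<omega> u \<ge> 0" for u
  proof -
    have "AE \<omega> in Mb. (\<lambda>x::nat \<Rightarrow> real. min 1 (max 0 (- x 0))) (eval_at 1 (\<lambda>_. u) (Zlim \<omega>)) = 0"
      by (rule fdd_null)
         (auto simp: eval_at_def Zn_nonneg intro!: continuous_intros continuous_on_product_coordinates)
    then show ?thesis by eventually_elim (auto simp: eval_at_def min_def max_def split: if_splits)
  qed
  then have "AE \<omega> in Mb. \<forall>u\<in>T. Zlim \<omega> u \<ge> 0"
    using T(1) by (simp add: AE_ball_countable)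
  moreover have "AE \<omega> in Mb. \<omega> \<in> space Mb" by simp
  ultimately show ?thesis
  proof eventually_elim
    case (elim \<omega>)
    have "closed {u. Zlim \<omega> u \<ge> 0}"
      using Zlim_cont[OF elim(2)] by (intro closed_Collect_le continuous_intros)
    then have "closure T \<subseteq> {u. Zlim \<omega> u \<ge> 0}" using elim(1) by (intro closure_minimal) auto
    then show ?case using T(2) by blast
  qed
qed

lemma AE_Zlim_0: "AE \<omega> in Mb. Zlim \<omega> 0 = 1"
proof -
  have "AE \<omega> in Mb. (\<lambda>x::nat \<Rightarrow> real. min 1 \<bar>x 0 - 1\<bar>) (eval_at 1 (\<lambda>_. 0) (Zlim \<omega>)) = 0"
    by (rule fdd_null)
       (auto simp: eval_at_def Zn_0 intro!: continuous_intros continuous_on_product_coordinates)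
  then show ?thesis by eventually_elim (auto simp: eval_at_def min_def split: if_splits)
qed

text \<open>
  The envelope is a statement about uncountably many points, while only finite-dimensional laws
  converge. For finitely many points the function \<open>min 1 (\<Sum> max 0 (x\<^sub>i / b\<^sub>i - 1))\<close> vanishes below the
  envelope \<open>b\<close> and equals one as soon as some coordinate reaches \<open>2 b\<^sub>i\<close>, so the limit field violates
  the doubled envelope at these points with probability at most \<open>e\<close>. Exhausting a countable dense set
  and using continuity of the paths gives the claim.
\<close>
lemma Zlim_envelope:
  assumes e: "e > 0"
  obtains K R A where "A \<in> sets Mb" "measure Mb A \<le> e"
    "\<And>\<omega> u. \<omega> \<in> space Mb - A \<Longrightarrow> norm u > R \<Longrightarrow> Zlim \<omega> u \<le> K * (1 + norm u) powr (- s)"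
proof -
  obtain K R where K: "K > 0" and ev: "eventually (\<lambda>n. \<exists>E\<in>sets M. measure M E \<le> e \<and>
        (\<forall>\<omega>\<in>space M - E. \<forall>u\<in>UU n. norm u \<ge> R \<longrightarrow> Zn n \<omega> u \<le> K * (1 + norm u) powr (- s))) sequentially"
    using tight[OF e] by blast
  define b where "b = (\<lambda>u::real^'p. K * (1 + norm u) powr (- s))"
  have b_pos: "b u > 0" for u unfolding b_def using K by (auto simp: add_pos_nonneg intro!: mult_pos_pos)
      (metis add_pos_nonneg norm_ge_zero not_less_iff_gr_or_eq zero_less_one)
  have b_cont: "continuous_on UNIV b" unfolding b_def
    by (intro continuous_intros) (metis add_pos_nonneg norm_ge_zero less_irrefl zero_less_one)
  define S where "S = {u::real^'p. norm u > R}"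
  obtain T where T: "countable T" "T \<subseteq> S" "S \<subseteq> closure T" by (rule separable)
  define x0 :: "real^'p" where "x0 = (\<bar>R\<bar> + 1) *\<^sub>R axis undefined 1"
  have "x0 \<in> S" unfolding x0_def S_def by simp
  then have Tne: "T \<noteq> {}" using T(3) by auto
  define v where "v = from_nat_into T"
  have v: "v i \<in> T" for i unfolding v_def using Tne by (rule from_nat_into)
  have range_v: "range v = T" unfolding v_def using Tne T(1) by (rule range_from_nat_into)
  have vR: "norm (v i) > R" for i using v[of i] T(2) by (auto simp: S_def)
  define A where "A = (\<lambda>k. {\<omega>\<in>space Mb. \<exists>i<k. Zlim \<omega> (v i) \<ge> 2 * b (v i)})"
  have A_sets: "A k \<in> sets Mb" for k
    unfolding A_def using Zlim_meas by measurable
  have A_le: "measure Mb (A k) \<le> e" for k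
  proof (cases "k \<ge> 1")
    case False
    then have "A k = {}" by (auto simp: A_def)
    then show ?thesis using e by simp
  next
    case True
    \<comment> \<open>A continuous function between the indicators of exceeding \<open>2 b\<close> and of exceeding \<open>b\<close> at one of the points.\<close>
    define f where "f = (\<lambda>x::nat \<Rightarrow> real. min 1 (\<Sum>i<k. max 0 (x i / b (v i) - 1)))"
    have f_cont: "continuous_on UNIV f" unfolding f_def
      using b_pos by (auto intro!: continuous_intros continuous_on_product_coordinates simp: less_le)
    have f01: "0 \<le> f x" "f x \<le> 1" for x unfolding f_def by (auto intro!: sum_nonneg)
    have f_bdd: "bounded (range f)" by (rule boundedI[of _ 1]) (use f01 in auto)
    have ev2: "eventually (\<lambda>n. \<forall>i\<in>{..<k}. v i \<in> UU n) sequentially"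
    proof (rule eventually_ball_finite, simp, intro ballI)
      fix i
      show "eventually (\<lambda>n. v i \<in> UU n) sequentially"
        using UU_exhaust[of "norm (v i) + 1"] by eventually_elim auto
    qed
    have "eventually (\<lambda>n. (LINT \<omega>|M. f (eval_at k v (Zn n \<omega>))) \<le> e) sequentially"
      using ev ev2
    proof eventually_elim
      case (elim n)
      then obtain E where E: "E \<in> sets M" "measure M E \<le> e"
        "\<And>\<omega> u. \<omega> \<in> space M - E \<Longrightarrow> u \<in> UU n \<Longrightarrow> norm u \<ge> R \<Longrightarrow> Zn n \<omega> u \<le> b u"
        unfolding b_def by blast
      have "(LINT \<omega>|M. f (eval_at k v (Zn n \<omega>))) \<le> 0 + 1 * measure M E"
      proof (rule M.expectation_le_off_event[OF _ E(1)])
        show "integrable M (\<lambda>\<omega>. f (eval_at k v (Zn n \<omega>)))"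
          by (rule M_integrable_eval[OF f_cont, of 1]) (use f01 in auto)
        fix \<omega> assume w: "\<omega> \<in> space M - E"
        have "max 0 (eval_at k v (Zn n \<omega>) i / b (v i) - 1) = 0" if "i < k" for i
        proof -
          have "Zn n \<omega> (v i) \<le> b (v i)" using E(3)[OF w, of "v i"] elim(2) that vR[of i] by auto
          then have "Zn n \<omega> (v i) / b (v i) \<le> 1" using b_pos[of "v i"] by simp
          then show ?thesis using that by (simp add: eval_at_def)
        qed
        then have "(\<Sum>i<k. max 0 (eval_at k v (Zn n \<omega>) i / b (v i) - 1)) = 0"
          by (intro sum.neutral) auto
        then show "f (eval_at k v (Zn n \<omega>)) \<le> 0" unfolding f_def by simp
      qed (use f01 in auto)
      then show ?case using E(2) by simp
    qed
    then have le: "(LINT \<omega>|Mb. f (eval_at k v (Zlim \<omega>))) \<le> e"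
      by (rule fdd_upper_bound[OF True f_cont f_bdd])
    have "measure Mb (A k) = (LINT \<omega>|Mb. indicator (A k) \<omega>)"
      using A_sets[of k] sets.sets_into_space by simp
    also have "\<dots> \<le> (LINT \<omega>|Mb. f (eval_at k v (Zlim \<omega>)))"
    proof (rule integral_mono)
      show "integrable Mb (indicator (A k) :: _ \<Rightarrow> real)"
        using A_sets by (intro integrable_real_indicator) (auto simp: Mb.emeasure_eq_measure)
      show "integrable Mb (\<lambda>\<omega>. f (eval_at k v (Zlim \<omega>)))"
        by (rule Mb_integrable_eval[OF f_cont, of 1]) (use f01 in auto)
      fix \<omega>
      show "indicator (A k) \<omega> \<le> f (eval_at k v (Zlim \<omega>))"
      proof (cases "\<omega> \<in> A k")
        case True
        then obtain i where i: "i < k" "Zlim \<omega> (v i) \<ge> 2 * b (v i)" by (auto simp: A_def)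
        then have "1 \<le> max 0 (eval_at k v (Zlim \<omega>) i / b (v i) - 1)"
          using b_pos[of "v i"] by (simp add: eval_at_def pos_le_divide_eq)
        also have "\<dots> \<le> (\<Sum>i<k. max 0 (eval_at k v (Zlim \<omega>) i / b (v i) - 1))"
          by (rule member_le_sum) (use i in auto)
        finally show ?thesis unfolding f_def using True by simp
      qed (use f01 in auto)
    qed
    finally show ?thesis using le by simp
  qed
  have inc: "incseq A" unfolding A_def incseq_def by (auto intro: less_le_trans)
  have "(\<lambda>k. measure Mb (A k)) \<longlonglongrightarrow> measure Mb (\<Union>k. A k)"
    using A_sets inc by (intro Mb.finite_Lim_measure_incseq) auto
  then have lim: "measure Mb (\<Union>k. A k) \<le> e"
    by (rule LIMSEQ_le_const2) (use A_le in auto)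
  show thesis
  proof (rule that[of "\<Union>k. A k" R "2 * K"])
    show "(\<Union>k. A k) \<in> sets Mb" using A_sets by auto
    show "measure Mb (\<Union>k. A k) \<le> e" by (rule lim)
    fix \<omega> and u :: "real^'p" assume w: "\<omega> \<in> space Mb - (\<Union>k. A k)" and u: "norm u > R"
    have vi: "Zlim \<omega> (v i) \<le> 2 * b (v i)" for i
    proof (rule ccontr)
      assume "\<not> Zlim \<omega> (v i) \<le> 2 * b (v i)"
      then have "\<omega> \<in> A (Suc i)" using w by (auto simp: A_def intro!: exI[of _ i])
      then show False using w by blast
    qed
    have T_sub: "T \<subseteq> {u. Zlim \<omega> u \<le> 2 * b u}" using vi range_v by auto
    have "closed {u. Zlim \<omega> u \<le> 2 * b u}"
      using Zlim_cont[of \<omega>] w b_cont by (intro closed_Collect_le continuous_intros) auto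
    then have "closure T \<subseteq> {u. Zlim \<omega> u \<le> 2 * b u}" by (rule closure_minimal[OF T_sub])
    moreover have "u \<in> closure T" using T(3) u by (auto simp: S_def)
    ultimately show "Zlim \<omega> u \<le> 2 * K * (1 + norm u) powr (- s)" by (auto simp: b_def)
  qed
qed

text \<open>The properties of a path under which its mean is the limit of its truncations and discretisations.\<close>
definition nice_path :: "(real^'p \<Rightarrow> real) \<Rightarrow> bool" where
  "nice_path z \<longleftrightarrow> continuous_on UNIV z \<and> (\<forall>u. z u \<ge> 0) \<and> z 0 = 1 \<and>
     integrable lborel z \<and> integrable lborel (\<lambda>u. norm u * z u)"

lemma AE_nice_path: "AE \<omega> in Mb. nice_path (Zlim \<omega>)"
proof -
  have "\<exists>A K R. A \<in> sets Mb \<and> measure Mb A \<le> 1 / real (Suc m) \<and>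
    (\<forall>\<omega>\<in>space Mb - A. \<forall>u. norm u > R \<longrightarrow> Zlim \<omega> u \<le> K * (1 + norm u) powr (- s))" for m :: nat
    by (rule Zlim_envelope[of "1 / real (Suc m)"]) (simp, blast)
  then obtain A K R where A: "\<And>m::nat. A m \<in> sets Mb" "\<And>m. measure Mb (A m) \<le> 1 / real (Suc m)"
    "\<And>m \<omega> u. \<omega> \<in> space Mb - A m \<Longrightarrow> norm u > R m \<Longrightarrow> Zlim \<omega> u \<le> K m * (1 + norm u) powr (- s)"
    by metis
  have null: "(\<Inter>m. A m) \<in> null_sets Mb"
  proof (rule null_setsI)
    show "(\<Inter>m. A m) \<in> sets Mb" using A(1) by auto
    have "measure Mb (\<Inter>m. A m) \<le> 1 / real (Suc m)" for m
      by (rule order_trans[OF Mb.finite_measure_mono A(2)[of m]]) (use A(1) in auto)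
    then have "measure Mb (\<Inter>m. A m) \<le> 0"
      by (intro LIMSEQ_le_const[OF LIMSEQ_Suc[OF lim_1_over_n]]) auto
    then show "emeasure Mb (\<Inter>m. A m) = 0"
      by (simp add: Mb.emeasure_eq_measure measure_le_0_iff)
  qed
  have "AE \<omega> in Mb. \<omega> \<notin> (\<Inter>m. A m)" using null by (rule AE_not_in)
  moreover have "AE \<omega> in Mb. \<omega> \<in> space Mb" by simp
  ultimately show ?thesis using AE_Zlim_nonneg AE_Zlim_0
  proof eventually_elim
    case (elim \<omega>)
    then obtain m where m: "\<omega> \<in> space Mb - A m" by blast
    have "s > real DIM(real^'p) + 1" using s by simp
    from integrable_of_envelope[OF Zlim_cont[OF elim(2)] _ this A(3)[OF m]] elim
    show ?case unfolding nice_path_def using Zlim_cont[OF elim(2)] by auto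
  qed
qed

end

context converging_fields
begin

lemma s_DIM: "s > real DIM(real^'p) + 1"
  using s by simp

definition quasi_mean :: "nat \<Rightarrow> 'w \<Rightarrow> real^'p" where
  "quasi_mean n \<omega> = field_mean (\<lambda>u. indicator (UU n) u * Zn n \<omega> u * q n u)"

lemma quasi_mean_measurable: "quasi_mean n \<in> borel_measurable M"
proof -
  note Zn_meas[measurable] q_meas[measurable]
  have "(\<lambda>(\<omega>, u). Zn n \<omega> u * (indicator (UU n) u * q n u)) \<in> borel_measurable (M \<Otimes>\<^sub>M borel)"
    by measurable
  then have "(\<lambda>\<omega>. field_mean (\<lambda>u. Zn n \<omega> u * (indicator (UU n) u * q n u))) \<in> borel_measurable M"
    by (rule field_mean_measurable)
  then show ?thesis unfolding quasi_mean_def[abs_def] by (simp add: mult_ac)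
qed

lemma Zlim_mean_measurable: "(\<lambda>\<omega>. field_mean (Zlim \<omega>)) \<in> borel_measurable Mb"
  by (rule field_mean_measurable[OF Zlim_meas2])

lemma expected_path_limit:
  fixes f :: "real^'p \<Rightarrow> real"
  assumes f: "continuous_on UNIV f" "\<And>x. \<bar>f x\<bar> \<le> F"
    and meas: "(\<lambda>\<omega>. X \<omega>) \<in> borel_measurable Mb" "\<And>n. (\<lambda>\<omega>. Xs n \<omega>) \<in> borel_measurable Mb"
    and lim: "AE \<omega> in Mb. (\<lambda>n::nat. Xs n \<omega>) \<longlonglongrightarrow> X \<omega>"
  shows "(\<lambda>n. LINT \<omega>|Mb. \<bar>f (X \<omega>) - f (Xs n \<omega>)\<bar>) \<longlonglongrightarrow> 0"
proof -
  have [measurable]: "f \<in> borel_measurable borel" using f(1) by (rule borel_measurable_continuous_onI)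
  note meas[measurable]
  have "(\<lambda>n. LINT \<omega>|Mb. \<bar>f (X \<omega>) - f (Xs n \<omega>)\<bar>) \<longlonglongrightarrow> (LINT \<omega>|Mb. 0)"
  proof (rule integral_dominated_convergence[where w = "\<lambda>_. 2 * F"])
    show "AE \<omega> in Mb. (\<lambda>n. \<bar>f (X \<omega>) - f (Xs n \<omega>)\<bar>) \<longlonglongrightarrow> 0"
      using lim
    proof eventually_elim
      case (elim \<omega>)
      then have "(\<lambda>n. f (Xs n \<omega>)) \<longlonglongrightarrow> f (X \<omega>)"
        using f(1) by (auto simp: continuous_on_eq_continuous_at intro: isCont_tendsto_compose)
      then have "(\<lambda>n. \<bar>f (X \<omega>) - f (Xs n \<omega>)\<bar>) \<longlonglongrightarrow> \<bar>f (X \<omega>) - f (X \<omega>)\<bar>"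
        by (intro tendsto_intros)
      then show ?case by simp
    qed
    have "norm \<bar>f (X \<omega>) - f (Xs n \<omega>)\<bar> \<le> 2 * F" for n \<omega>
      using f(2)[of "X \<omega>"] f(2)[of "Xs n \<omega>"] by (simp add: abs_le_iff)
    then show "AE \<omega> in Mb. norm \<bar>f (X \<omega>) - f (Xs n \<omega>)\<bar> \<le> 2 * F" for n by simp
  qed auto
  then show ?thesis by simp
qed

lemma truncated_limit_mean:
  fixes f :: "real^'p \<Rightarrow> real"
  assumes f: "continuous_on UNIV f" "\<And>x. \<bar>f x\<bar> \<le> F"
  shows "(\<lambda>n. LINT \<omega>|Mb. \<bar>f (field_mean (Zlim \<omega>)) -
           f (field_mean (\<lambda>u. indicator (ball 0 (real n)) u * Zlim \<omega> u))\<bar>) \<longlonglongrightarrow> 0"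
proof (rule expected_path_limit[OF f Zlim_mean_measurable])
  note Zlim_meas2[measurable]
  have [measurable]: "ball (0::real^'p) (real n) \<in> sets borel" for n by simp
  show "(\<lambda>\<omega>. field_mean (\<lambda>u. indicator (ball 0 (real n)) u * Zlim \<omega> u)) \<in> borel_measurable Mb" for n
    by (rule field_mean_measurable) measurable
  show "AE \<omega> in Mb. (\<lambda>n. field_mean (\<lambda>u. indicator (ball 0 (real n)) u * Zlim \<omega> u)) \<longlonglongrightarrow> field_mean (Zlim \<omega>)"
    using AE_nice_path
    by eventually_elim (auto simp: nice_path_def intro!: field_mean_truncation_tendsto)
qed

lemma discretized_limit_mean:
  fixes f :: "real^'p \<Rightarrow> real"
  assumes f: "continuous_on UNIV f" "\<And>x. \<bar>f x\<bar> \<le> F" and R: "R > 0"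
    and \<rho>: "\<And>n. \<rho> n \<in> borel_measurable borel" "\<And>n u. norm (\<rho> n u - u) \<le> 1 / real (Suc n)"
  shows "(\<lambda>n. LINT \<omega>|Mb. \<bar>f (field_mean (\<lambda>u. indicator (ball 0 R) u * Zlim \<omega> u)) -
           f (field_mean (\<lambda>u. indicator (ball 0 R) u * Zlim \<omega> (\<rho> n u)))\<bar>) \<longlonglongrightarrow> 0"
proof (rule expected_path_limit[OF f])
  note Zlim_meas2[measurable] \<rho>(1)[measurable]
  have [measurable]: "ball (0::real^'p) R \<in> sets borel" by simp
  show "(\<lambda>\<omega>. field_mean (\<lambda>u. indicator (ball 0 R) u * Zlim \<omega> u)) \<in> borel_measurable Mb"
    by (rule field_mean_measurable) measurable
  show "(\<lambda>\<omega>. field_mean (\<lambda>u. indicator (ball 0 R) u * Zlim \<omega> (\<rho> n u))) \<in> borel_measurable Mb" for n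
  proof (rule field_mean_measurable)
    have "(\<lambda>x. (fst x, \<rho> n (snd x))) \<in> Mb \<Otimes>\<^sub>M borel \<rightarrow>\<^sub>M Mb \<Otimes>\<^sub>M borel" by measurable
    from measurable_compose[OF this Zlim_meas2]
    have [measurable]: "(\<lambda>(\<omega>, u). Zlim \<omega> (\<rho> n u)) \<in> borel_measurable (Mb \<Otimes>\<^sub>M borel)"
      by (simp add: case_prod_unfold)
    show "(\<lambda>(\<omega>, u). indicator (ball 0 R) u * Zlim \<omega> (\<rho> n u)) \<in> borel_measurable (Mb \<Otimes>\<^sub>M borel)"
      by measurable
  qed
  show "AE \<omega> in Mb. (\<lambda>n. field_mean (\<lambda>u. indicator (ball 0 R) u * Zlim \<omega> (\<rho> n u)))
      \<longlonglongrightarrow> field_mean (\<lambda>u. indicator (ball 0 R) u * Zlim \<omega> u)"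
    using AE_nice_path
  proof eventually_elim
    case (elim \<omega>)
    show ?case
      by (rule field_mean_discretization_tendsto[OF _ _ _ R \<rho> LIMSEQ_Suc[OF lim_1_over_n]])
         (use elim in \<open>auto simp: nice_path_def\<close>)
  qed
qed

text \<open>
  The order of the choices is what makes the argument work: the lower bound \<open>\<kappa>\<close> of the mass and the
  envelope come first, then a radius \<open>R1\<close> that confines the means to a compact set and with it the modulus
  of continuity of \<open>f\<close>, then the truncation radius \<open>R\<close>, then the oscillation \<open>\<epsilon>\<close> allowed on that ball, and
  the mesh last. Each of the three exceptional events has probability at most \<open>e / (12 F)\<close> and contributes at
  most \<open>2 F\<close> times that.
\<close>
theorem mean_approximation:
  fixes f :: "real^'p \<Rightarrow> real"
  assumes f: "continuous_on UNIV f" "\<And>x. \<bar>f x\<bar> \<le> F" and F: "F > 0" and e: "e > 0"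
  obtains k v g where "k \<ge> 1" "continuous_on UNIV g" "\<And>x. \<bar>g x\<bar> \<le> F"
    "eventually (\<lambda>n. (LINT \<omega>|M. \<bar>f (quasi_mean n \<omega>) - g (eval_at k v (Zn n \<omega>))\<bar>) \<le> e) sequentially"
    "(LINT \<omega>|Mb. \<bar>f (field_mean (Zlim \<omega>)) - g (eval_at k v (Zlim \<omega>))\<bar>) \<le> e"
proof -
  define \<eta> where "\<eta> = e / (12 * F)"
  have \<eta>: "\<eta> > 0" using F e by (simp add: \<eta>_def)
  \<comment> \<open>The lower bound \<open>\<kappa>\<close> of the total mass uses tolerance one on the unit ball only.\<close>
  obtain \<delta>1 where \<delta>1: "0 < \<delta>1" "\<delta>1 < 1" and ev1: "eventually (\<lambda>n. \<exists>E\<in>sets M. measure M E \<le> \<eta> \<and>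
        (\<forall>\<omega>\<in>space M - E. \<forall>u1\<in>UU n. \<forall>u2\<in>UU n. norm u1 < 1 \<longrightarrow> norm u2 < 1 \<longrightarrow> norm (u2 - u1) \<le> \<delta>1 \<longrightarrow>
           \<bar>ln (Zn n \<omega> u2) - ln (Zn n \<omega> u1)\<bar> \<le> 1)) sequentially"
    using equicontinuous[of 1 1 \<eta>] \<eta> by auto
  define \<kappa> where "\<kappa> = exp (-1) / 2 * measure lborel (ball (0::real^'p) \<delta>1)"
  have \<kappa>: "\<kappa> > 0" unfolding \<kappa>_def using \<delta>1(1) content_ball_gt_0_iff[of "0::real^'p" \<delta>1] by simp
  obtain K R0 where K: "K > 0" and ev2: "eventually (\<lambda>n. \<exists>E\<in>sets M. measure M E \<le> \<eta> \<and>
        (\<forall>\<omega>\<in>space M - E. \<forall>u\<in>UU n. norm u \<ge> R0 \<longrightarrow> Zn n \<omega> u \<le> K * (1 + norm u) powr (- s))) sequentially"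
    using tight[OF \<eta>] by blast
  define tl where "tl = (\<lambda>n::nat. \<bar>Q\<bar> * K * tail_moment TYPE(real^'p) s (real n))"
  have tl: "tl \<longlonglongrightarrow> 0"
    unfolding tl_def by (rule tendsto_mult_right_zero[OF tail_moment_tendsto_0[OF s_DIM]])
  have "eventually (\<lambda>n. tl n < \<kappa> \<and> real n > max R0 1) sequentially"
    using order_tendstoD(2)[OF tl \<kappa>] filterlim_real_sequentially[THEN filterlim_at_top_dense[THEN iffD1], rule_format, of "max R0 1"]
    by eventually_elim auto
  then obtain R1 where R1: "tl R1 < \<kappa>" "real R1 > max R0 1"
    unfolding eventually_sequentially by blast
  \<comment> \<open>The means of the fields lie in the ball of radius \<open>R1 + 1\<close>, those of the discretised fields one further out.\<close>
  have "uniformly_continuous_on (cball 0 (real R1 + 2)) f"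
    by (intro compact_uniformly_continuous continuous_on_subset[OF f(1)]) auto
  then obtain r0 where r0: "r0 > 0"
    "\<And>x x'. x \<in> cball 0 (real R1 + 2) \<Longrightarrow> x' \<in> cball 0 (real R1 + 2) \<Longrightarrow> dist x' x < r0 \<Longrightarrow> dist (f x') (f x) < e / 2"
    unfolding uniformly_continuous_on_def using e by (metis half_gt_zero)
  define r where "r = min r0 1"
  have r: "r > 0" using r0(1) by (simp add: r_def)
  \<comment> \<open>The tail may contribute \<open>2 tl / \<kappa> < r / 4\<close> to the distance of the means, the oscillation another \<open>r / 4\<close>.\<close>
  have "eventually (\<lambda>n. tl n < \<kappa> * r / 8 \<and> real n > real R1 \<and>
      (LINT \<omega>|Mb. \<bar>f (field_mean (Zlim \<omega>)) -
           f (field_mean (\<lambda>u. indicator (ball 0 (real n)) u * Zlim \<omega> u))\<bar>) < e / 2) sequentially"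
    using order_tendstoD(2)[OF tl, of "\<kappa> * r / 8"] order_tendstoD(2)[OF truncated_limit_mean[OF f], of "e / 2"]
      filterlim_real_sequentially[THEN filterlim_at_top_dense[THEN iffD1], rule_format, of "real R1"] \<kappa> r e
    by (auto intro: eventually_elim2 simp: eventually_conj_iff)
  then obtain Rn where Rn: "tl Rn < \<kappa> * r / 8" "real Rn > real R1"
    "(LINT \<omega>|Mb. \<bar>f (field_mean (Zlim \<omega>)) -
           f (field_mean (\<lambda>u. indicator (ball 0 (real Rn)) u * Zlim \<omega> u))\<bar>) < e / 2"
    unfolding eventually_sequentially by blast
  define R where "R = real Rn"
  have R: "R > 1" "R > R0" "R > real R1" using R1 Rn by (auto simp: R_def)
  \<comment> \<open>The oscillation enters the distance of the means with the factor \<open>20 R\<close>.\<close>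
  define \<epsilon> where "\<epsilon> = min (1 / 10) (r / (80 * R))"
  have \<epsilon>: "\<epsilon> > 0" "\<epsilon> \<le> 1 / 10" "20 * R * \<epsilon> \<le> r / 4"
  proof -
    show "\<epsilon> > 0" "\<epsilon> \<le> 1 / 10" using r R by (auto simp: \<epsilon>_def)
    have "20 * R * \<epsilon> \<le> 20 * R * (r / (80 * R))" using R by (intro mult_left_mono) (auto simp: \<epsilon>_def)
    also have "\<dots> = r / 4" using R by simp
    finally show "20 * R * \<epsilon> \<le> r / 4" .
  qed
  obtain \<delta> where \<delta>: "0 < \<delta>" "\<delta> < 1" and ev3: "eventually (\<lambda>n. \<exists>E\<in>sets M. measure M E \<le> \<eta> \<and>
        (\<forall>\<omega>\<in>space M - E. \<forall>u1\<in>UU n. \<forall>u2\<in>UU n. norm u1 < R + 1 \<longrightarrow> norm u2 < R + 1 \<longrightarrow> norm (u2 - u1) \<le> \<delta> \<longrightarrow>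
           \<bar>ln (Zn n \<omega> u2) - ln (Zn n \<omega> u1)\<bar> \<le> \<epsilon>)) sequentially"
    using equicontinuous[of \<epsilon> "R + 1" \<eta>] \<eta> \<epsilon>(1) R by auto
  have "\<exists>\<rho>. \<forall>m. \<rho> m \<in> borel_measurable borel \<and>
      (\<forall>u::real^'p. norm (\<rho> m u - u) \<le> 1 / real (Suc m)) \<and> (\<forall>u. norm u < 1 / real (Suc m) \<longrightarrow> \<rho> m u = 0) \<and>
      (\<forall>R. finite (\<rho> m ` ball 0 R))"
  proof (rule choice, rule allI)
    fix m show "\<exists>\<rho>. \<rho> \<in> borel_measurable borel \<and>
      (\<forall>u::real^'p. norm (\<rho> u - u) \<le> 1 / real (Suc m)) \<and> (\<forall>u. norm u < 1 / real (Suc m) \<longrightarrow> \<rho> u = 0) \<and>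
      (\<forall>R. finite (\<rho> ` ball 0 R))"
      by (rule finite_range_rounding[of "1 / real (Suc m)"]) auto
  qed
  then obtain \<rho>s :: "nat \<Rightarrow> real^'p \<Rightarrow> real^'p" where \<rho>s: "\<And>m. \<rho>s m \<in> borel_measurable borel"
    "\<And>m u. norm (\<rho>s m u - u) \<le> 1 / real (Suc m)" "\<And>m u. norm u < 1 / real (Suc m) \<Longrightarrow> \<rho>s m u = 0"
    "\<And>m R. finite (\<rho>s m ` ball 0 R)" by blast
  have R_pos: "R > 0" using R by simp
  have "eventually (\<lambda>m. 1 / real (Suc m) < \<delta> \<and>
      (LINT \<omega>|Mb. \<bar>f (field_mean (\<lambda>u. indicator (ball 0 R) u * Zlim \<omega> u)) -
           f (field_mean (\<lambda>u. indicator (ball 0 R) u * Zlim \<omega> (\<rho>s m u)))\<bar>) < e / 2) sequentially"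
    using order_tendstoD(2)[OF LIMSEQ_Suc[OF lim_1_over_n] \<delta>(1)]
      order_tendstoD(2)[OF discretized_limit_mean[OF f R_pos \<rho>s(1,2)], of "e / 2"] e
    by (auto simp: eventually_conj_iff)
  then obtain m where m: "1 / real (Suc m) < \<delta>"
      "(LINT \<omega>|Mb. \<bar>f (field_mean (\<lambda>u. indicator (ball 0 R) u * Zlim \<omega> u)) -
           f (field_mean (\<lambda>u. indicator (ball 0 R) u * Zlim \<omega> (\<rho>s m u)))\<bar>) < e / 2"
    unfolding eventually_sequentially by blast
  define \<rho> where "\<rho> = \<rho>s m"
  have \<rho>_meas: "\<rho> \<in> borel_measurable borel" and \<rho>_close: "\<And>u. norm (\<rho> u - u) \<le> \<delta>"
    unfolding \<rho>_def using \<rho>s(1,2)[of m] m(1) by (auto intro: order_trans less_imp_le)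
  have \<rho>_0: "\<rho> u = 0" if "norm u < 1 / real (Suc m)" for u
    unfolding \<rho>_def using \<rho>s(3) that by blast
  have \<rho>_fin: "finite (\<rho> ` ball 0 R)" unfolding \<rho>_def by (rule \<rho>s(4))
  have h_pos: "1 / real (Suc m) > 0" by simp
  obtain k :: nat and v :: "nat \<Rightarrow> real^'p" and g0 :: "(nat \<Rightarrow> real) \<Rightarrow> real^'p" where g0: "k \<ge> 1" "continuous_on UNIV g0"
    "\<And>z. (\<And>u. z u \<ge> 0) \<Longrightarrow> z 0 = 1 \<Longrightarrow>
       g0 (\<lambda>i. if i < k then z (v i) else 0) = field_mean (\<lambda>u. indicator (ball 0 R) u * z (\<rho> u))"
  proof (rule field_mean_discretized[OF R_pos h_pos \<rho>_meas \<rho>_0 \<rho>_fin])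
    fix k :: nat and v :: "nat \<Rightarrow> real^'p" and g :: "(nat \<Rightarrow> real) \<Rightarrow> real^'p"
    assume "k \<ge> 1" "continuous_on UNIV g"
      "\<And>z. (\<And>u. z u \<ge> 0) \<Longrightarrow> z 0 = 1 \<Longrightarrow>
       g (\<lambda>i. if i < k then z (v i) else 0) = field_mean (\<lambda>u. indicator (ball 0 R) u * z (\<rho> u))"
    then show thesis by (rule that)
  qed
  define g where "g = (\<lambda>x. f (g0 x))"
  have g_cont: "continuous_on UNIV g"
    unfolding g_def by (rule continuous_on_compose2[OF f(1) g0(2)]) auto
  have g_F: "\<bar>g x\<bar> \<le> F" for x unfolding g_def by (rule f(2))
  have g_eval: "g (eval_at k v z) = f (field_mean (\<lambda>u. indicator (ball 0 R) u * z (\<rho> u)))"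
    if "\<And>u. z u \<ge> 0" "z 0 = 1" for z
    unfolding g_def eval_at_def by (simp only: g0(3)[of z] that)
  have f_meas[measurable]: "f \<in> borel_measurable borel" using f(1) by (rule borel_measurable_continuous_onI)
  have diff_bound: "\<bar>f x - f x'\<bar> \<le> 2 * F" for x x'
    using f(2)[of x] f(2)[of x'] by (simp add: abs_le_iff)
  have diff_bound_g: "\<bar>f x - g x'\<bar> \<le> 2 * F" for x x'
    unfolding g_def by (rule diff_bound)
  have "eventually (\<lambda>n. (LINT \<omega>|M. \<bar>f (quasi_mean n \<omega>) - g (eval_at k v (Zn n \<omega>))\<bar>) \<le> e) sequentially"
    using ev1 ev2 ev3 UU_exhaust[of "R + 1"] q_tendsto[OF \<epsilon>(1), of R]
  proof eventually_elim
    case (elim n)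
    obtain E1 where E1: "E1 \<in> sets M" "measure M E1 \<le> \<eta>"
      "\<And>\<omega> u1 u2. \<omega> \<in> space M - E1 \<Longrightarrow> u1 \<in> UU n \<Longrightarrow> u2 \<in> UU n \<Longrightarrow> norm u1 < 1 \<Longrightarrow> norm u2 < 1 \<Longrightarrow>
         norm (u2 - u1) \<le> \<delta>1 \<Longrightarrow> \<bar>ln (Zn n \<omega> u2) - ln (Zn n \<omega> u1)\<bar> \<le> 1"
      using elim(1) by blast
    obtain E2 where E2: "E2 \<in> sets M" "measure M E2 \<le> \<eta>"
      "\<And>\<omega> u. \<omega> \<in> space M - E2 \<Longrightarrow> u \<in> UU n \<Longrightarrow> norm u \<ge> R0 \<Longrightarrow> Zn n \<omega> u \<le> K * (1 + norm u) powr (- s)"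
      using elim(2) by blast
    obtain E3 where E3: "E3 \<in> sets M" "measure M E3 \<le> \<eta>"
      "\<And>\<omega> u1 u2. \<omega> \<in> space M - E3 \<Longrightarrow> u1 \<in> UU n \<Longrightarrow> u2 \<in> UU n \<Longrightarrow> norm u1 < R + 1 \<Longrightarrow> norm u2 < R + 1 \<Longrightarrow>
         norm (u2 - u1) \<le> \<delta> \<Longrightarrow> \<bar>ln (Zn n \<omega> u2) - ln (Zn n \<omega> u1)\<bar> \<le> \<epsilon>"
      using elim(3) by blast
    define E where "E = E1 \<union> E2 \<union> E3"
    have E: "E \<in> sets M" using E1 E2 E3 by (simp add: E_def)
    have "measure M E \<le> measure M E1 + measure M E2 + measure M E3"
      unfolding E_def using measure_Un_le[of "E1 \<union> E2" M E3] measure_Un_le[of E1 M E2] E1(1) E2(1) E3(1)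
      by auto
    then have E_le: "measure M E \<le> 3 * \<eta>" using E1 E2 E3 by linarith
    have good: "\<bar>f (quasi_mean n \<omega>) - g (eval_at k v (Zn n \<omega>))\<bar> \<le> e / 2" if w: "\<omega> \<in> space M - E" for \<omega>
    proof -
      have wM: "\<omega> \<in> space M" and w1: "\<omega> \<in> space M - E1" and w2: "\<omega> \<in> space M - E2" and w3: "\<omega> \<in> space M - E3"
        using w by (auto simp: E_def)
      interpret W: weighted_local_field "Zn n \<omega>" "UU n" "q n" Q by (rule Zn_field[OF wM])
      have Wy: "quasi_mean n \<omega> = field_mean W.local_density"
        unfolding quasi_mean_def W.local_density_def[abs_def] ..
      have ball1: "ball 0 1 \<subseteq> UU n" using subset_trans[OF subset_ball elim(4), of 1] R by simp
      have q1: "\<bar>q n u - 1\<bar> \<le> \<epsilon>" if "norm u < R" for u using elim(5) that by blast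
      have mass: "\<kappa> \<le> (LINT u|lborel. indicator (ball 0 R') u * W.local_density u)" if "R' \<ge> 1" for R'
        unfolding \<kappa>_def
      proof (rule W.density_mass_lower_bound[OF ball1 \<delta>1 that _ E1(3)[OF w1]])
        show "\<bar>q n u - 1\<bar> \<le> 1 / 2" if "norm u < 1" for u
          using q1[of u] that R \<epsilon>(2) by linarith
      qed
      have tail: "(LINT u|lborel. indicator (- ball 0 (real N)) u * (norm u * W.local_density u)) \<le> tl N" if "real N \<ge> R0" for N
        unfolding tl_def
        by (rule W.density_tail_bound[OF s]) (use K E2(3)[OF w2] that in \<open>auto intro: order_trans\<close>)
      let ?z = "\<lambda>u. indicator (ball 0 R) u * Zn n \<omega> (\<rho> u)"
      have "norm (field_mean W.local_density - field_mean ?z) \<le> 20 * R * \<epsilon> + 2 * tl Rn / \<kappa>"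
      proof (rule W.field_mean_local_density_close[OF elim(4) _ \<rho>_meas \<rho>_close _ _ \<epsilon>(2) q1 E3(3)[OF w3] \<kappa>])
        show "(LINT u|lborel. indicator (- ball 0 R) u * (norm u * W.local_density u)) \<le> tl Rn"
          unfolding R_def by (rule tail) (use R R_def in simp)
      qed (use R \<epsilon> \<delta> mass in auto)
      also have "2 * tl Rn / \<kappa> \<le> r / 4"
        using Rn(1) \<kappa> by (simp add: divide_le_eq mult.commute)
      finally have close: "norm (field_mean W.local_density - field_mean ?z) < r"
        using \<epsilon>(3) r by linarith
      have mass': "\<kappa> \<le> (LINT u|lborel. W.local_density u)"
      proof -
        have [measurable]: "W.local_density \<in> borel_measurable borel" using W.density_integrable by auto
        have "(LINT u|lborel. indicator (ball 0 R) u * W.local_density u) \<le> (LINT u|lborel. W.local_density u)"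
        proof (rule integral_mono[OF _ W.density_integrable(1)])
          show "integrable lborel (\<lambda>u. indicator (ball 0 R) u * W.local_density u)"
            by (rule Bochner_Integration.integrable_bound[OF W.density_integrable(1)]) (auto simp: indicator_def W.density_nonneg)
        qed (auto simp: indicator_def W.density_nonneg)
        then show ?thesis using mass[of R] R by linarith
      qed
      have "norm (field_mean W.local_density) \<le> real R1 + tl R1 / \<kappa>"
        by (rule norm_field_mean_le[OF W.density_integrable W.density_nonneg _ mass' \<kappa> tail]) (use R1 in auto)
      also have "tl R1 / \<kappa> \<le> 1" using R1(1) \<kappa> by simp
      finally have bd: "norm (field_mean W.local_density) \<le> real R1 + 1" by simp
      have "norm (field_mean ?z) \<le> real R1 + 2"
        using bd close norm_triangle_ineq3[of "field_mean W.local_density" "field_mean ?z"] by (simp add: r_def abs_le_iff)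
      then have "dist (f (field_mean W.local_density)) (f (field_mean ?z)) < e / 2"
        using r0(2)[of "field_mean ?z" "field_mean W.local_density"] bd close by (simp add: dist_norm r_def)
      moreover have "g (eval_at k v (Zn n \<omega>)) = f (field_mean ?z)"
        by (rule g_eval) (use Zn_nonneg Zn_0 wM in auto)
      ultimately show ?thesis by (simp add: Wy dist_real_def)
    qed
    have "(LINT \<omega>|M. \<bar>f (quasi_mean n \<omega>) - g (eval_at k v (Zn n \<omega>))\<bar>) \<le> e / 2 + 2 * F * measure M E"
    proof (rule M.expectation_le_off_event[OF _ E])
      have [measurable]: "(\<lambda>\<omega>. g (eval_at k v (Zn n \<omega>))) \<in> borel_measurable M"
        using Zn_meas1 g_cont by (intro eval_at_measurable)
      note quasi_mean_measurable[measurable]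
      show "integrable M (\<lambda>\<omega>. \<bar>f (quasi_mean n \<omega>) - g (eval_at k v (Zn n \<omega>))\<bar>)"
        by (rule M.integrable_const_bound[of _ "2 * F"]) (auto simp: diff_bound_g)
    qed (use good e F diff_bound_g in auto)
    also have "\<dots> \<le> e / 2 + 2 * F * (3 * \<eta>)" using E_le F by simp
    also have "\<dots> = e" using F by (simp add: \<eta>_def)
    finally show ?case .
  qed
  moreover have "(LINT \<omega>|Mb. \<bar>f (field_mean (Zlim \<omega>)) - g (eval_at k v (Zlim \<omega>))\<bar>) \<le> e"
  proof -
    note Zlim_meas2[measurable] Zlim_mean_measurable[measurable]
    have [measurable]: "ball (0::real^'p) R \<in> sets borel" by simp
    define t where "t = (\<lambda>\<omega>. field_mean (\<lambda>u. indicator (ball 0 R) u * Zlim \<omega> u))"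
    have t_meas[measurable]: "t \<in> borel_measurable Mb"
      unfolding t_def by (rule field_mean_measurable) measurable
    have [measurable]: "(\<lambda>\<omega>. g (eval_at k v (Zlim \<omega>))) \<in> borel_measurable Mb"
      using Zlim_meas g_cont by (intro eval_at_measurable)
    have int1: "integrable Mb (\<lambda>\<omega>. \<bar>f (field_mean (Zlim \<omega>)) - f (t \<omega>)\<bar>)"
      by (rule Mb.integrable_const_bound[of _ "2 * F"]) (auto simp: diff_bound)
    have int2: "integrable Mb (\<lambda>\<omega>. \<bar>f (t \<omega>) - g (eval_at k v (Zlim \<omega>))\<bar>)"
      by (rule Mb.integrable_const_bound[of _ "2 * F"]) (auto simp: diff_bound_g)
    have "(LINT \<omega>|Mb. \<bar>f (field_mean (Zlim \<omega>)) - g (eval_at k v (Zlim \<omega>))\<bar>) \<le>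
       (LINT \<omega>|Mb. \<bar>f (field_mean (Zlim \<omega>)) - f (t \<omega>)\<bar> + \<bar>f (t \<omega>) - g (eval_at k v (Zlim \<omega>))\<bar>)"
    proof (rule integral_mono)
      show "integrable Mb (\<lambda>\<omega>. \<bar>f (field_mean (Zlim \<omega>)) - g (eval_at k v (Zlim \<omega>))\<bar>)"
        by (rule Mb.integrable_const_bound[of _ "2 * F"]) (auto simp: diff_bound_g)
    qed (use int1 int2 in auto)
    also have "\<dots> = (LINT \<omega>|Mb. \<bar>f (field_mean (Zlim \<omega>)) - f (t \<omega>)\<bar>) +
        (LINT \<omega>|Mb. \<bar>f (t \<omega>) - g (eval_at k v (Zlim \<omega>))\<bar>)"
      using int1 int2 by simp
    also have "(LINT \<omega>|Mb. \<bar>f (t \<omega>) - g (eval_at k v (Zlim \<omega>))\<bar>) =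
        (LINT \<omega>|Mb. \<bar>f (field_mean (\<lambda>u. indicator (ball 0 R) u * Zlim \<omega> u)) -
           f (field_mean (\<lambda>u. indicator (ball 0 R) u * Zlim \<omega> (\<rho>s m u)))\<bar>)"
    proof (rule integral_cong_AE)
      show "AE \<omega> in Mb. \<bar>f (t \<omega>) - g (eval_at k v (Zlim \<omega>))\<bar> =
         \<bar>f (field_mean (\<lambda>u. indicator (ball 0 R) u * Zlim \<omega> u)) -
           f (field_mean (\<lambda>u. indicator (ball 0 R) u * Zlim \<omega> (\<rho>s m u)))\<bar>"
        using AE_nice_path by eventually_elim (simp add: t_def g_eval nice_path_def \<rho>_def)
      have "(\<lambda>x. (fst x, \<rho> (snd x))) \<in> Mb \<Otimes>\<^sub>M borel \<rightarrow>\<^sub>M Mb \<Otimes>\<^sub>M borel" using \<rho>_meas by measurable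
      from measurable_compose[OF this Zlim_meas2]
      have [measurable]: "(\<lambda>(\<omega>, u). Zlim \<omega> (\<rho> u)) \<in> borel_measurable (Mb \<Otimes>\<^sub>M borel)"
        by (simp add: case_prod_unfold)
      have [measurable]: "(\<lambda>\<omega>. field_mean (\<lambda>u. indicator (ball 0 R) u * Zlim \<omega> (\<rho>s m u))) \<in> borel_measurable Mb"
        unfolding \<rho>_def[symmetric] by (rule field_mean_measurable) measurable
      show "(\<lambda>\<omega>. \<bar>f (field_mean (\<lambda>u. indicator (ball 0 R) u * Zlim \<omega> u)) -
           f (field_mean (\<lambda>u. indicator (ball 0 R) u * Zlim \<omega> (\<rho>s m u)))\<bar>) \<in> borel_measurable Mb"
        unfolding t_def[symmetric] using t_meas unfolding t_def by measurable
    qed measurable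
    finally show ?thesis using Rn(3) m(2) unfolding t_def R_def by linarith
  qed
  ultimately show thesis using that[OF g0(1) g_cont g_F] by blast
qed

end

section \<open>Conditional expectations and extensions\<close>

lemma tendsto_in_prob_imp_L1:
  fixes X :: "'i \<Rightarrow> 'w \<Rightarrow> real"
  assumes "prob_space N" and conv: "tendsto_in_prob N X Y F"
    and meas: "\<And>i. X i \<in> borel_measurable N" "Y \<in> borel_measurable N"
    and bd: "\<And>i. AE \<omega> in N. \<bar>X i \<omega>\<bar> \<le> B" "AE \<omega> in N. \<bar>Y \<omega>\<bar> \<le> B"
  shows "((\<lambda>i. LINT \<omega>|N. \<bar>X i \<omega> - Y \<omega>\<bar>) \<longlongrightarrow> 0) F"
proof (rule order_tendstoI)
  interpret prob_space N by fact
  note meas[measurable]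
  fix e :: real
  { assume "e < 0"
    moreover have "0 \<le> (LINT \<omega>|N. \<bar>X i \<omega> - Y \<omega>\<bar>)" for i by (rule integral_nonneg_AE) simp
    ultimately show "eventually (\<lambda>i. e < (LINT \<omega>|N. \<bar>X i \<omega> - Y \<omega>\<bar>)) F"
      by (intro always_eventually allI) (rule less_le_trans) }
  assume e: "0 < e"
  define B' where "B' = \<bar>B\<bar> + 1"
  have B': "B' > 0" by (simp add: B'_def)
  have "((\<lambda>i. measure N {\<omega> \<in> space N. \<bar>X i \<omega> - Y \<omega>\<bar> > e / 2}) \<longlongrightarrow> 0) F"
    using conv half_gt_zero[OF e] unfolding tendsto_in_prob_def by blast
  then have "eventually (\<lambda>i. measure N {\<omega> \<in> space N. \<bar>X i \<omega> - Y \<omega>\<bar> > e / 2} < e / (4 * B')) F"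
    by (rule order_tendstoD) (use e B' in simp)
  then show "eventually (\<lambda>i. (LINT \<omega>|N. \<bar>X i \<omega> - Y \<omega>\<bar>) < e) F"
  proof eventually_elim
    case (elim i)
    define A where "A = {\<omega> \<in> space N. \<bar>X i \<omega> - Y \<omega>\<bar> > e / 2}"
    have [measurable]: "A \<in> sets N" unfolding A_def by measurable
    have "(LINT \<omega>|N. \<bar>X i \<omega> - Y \<omega>\<bar>) \<le> (LINT \<omega>|N. e / 2 + 2 * B' * indicator A \<omega>)"
    proof (rule integral_mono_AE)
      have "AE \<omega> in N. norm \<bar>X i \<omega> - Y \<omega>\<bar> \<le> 2 * B'"
        using bd(1)[of i] bd(2) by eventually_elim (auto simp: B'_def)
      then show "integrable N (\<lambda>\<omega>. \<bar>X i \<omega> - Y \<omega>\<bar>)" by (rule integrable_const_bound) simp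
      show "integrable N (\<lambda>\<omega>. e / 2 + 2 * B' * indicator A \<omega>)" by (simp add: emeasure_eq_measure)
      have "AE \<omega> in N. \<omega> \<in> space N" by simp
      then show "AE \<omega> in N. \<bar>X i \<omega> - Y \<omega>\<bar> \<le> e / 2 + 2 * B' * indicator A \<omega>"
        using bd(1)[of i] bd(2) by eventually_elim (use e in \<open>auto simp: B'_def A_def indicator_def\<close>)
    qed
    also have "\<dots> = e / 2 + 2 * B' * measure N A" by (simp add: emeasure_eq_measure prob_space)
    also have "\<dots> < e / 2 + 2 * B' * (e / (4 * B'))"
      using elim B' unfolding A_def by (intro add_strict_left_mono mult_strict_left_mono) auto
    also have "\<dots> = e" using B' by simp
    finally show ?case .
  qed
qed

lemma L1_imp_tendsto_in_prob:
  fixes X :: "'i \<Rightarrow> 'w \<Rightarrow> real"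
  assumes "prob_space N" and int: "eventually (\<lambda>i. integrable N (X i)) F" "integrable N Y"
    and conv: "((\<lambda>i. LINT \<omega>|N. \<bar>X i \<omega> - Y \<omega>\<bar>) \<longlongrightarrow> 0) F"
  shows "tendsto_in_prob N X Y F"
  unfolding tendsto_in_prob_def
proof (intro allI impI)
  interpret prob_space N by fact
  fix e :: real assume e: "e > 0"
  have lim: "((\<lambda>i. (1 / e) * (LINT \<omega>|N. \<bar>X i \<omega> - Y \<omega>\<bar>)) \<longlongrightarrow> 0) F"
    by (rule tendsto_mult_right_zero[OF conv])
  show "((\<lambda>i. measure N {\<omega> \<in> space N. \<bar>X i \<omega> - Y \<omega>\<bar> > e}) \<longlongrightarrow> 0) F"
  proof (rule tendsto_sandwich[OF _ _ tendsto_const lim])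
    have "measure N {\<omega> \<in> space N. \<bar>X i \<omega> - Y \<omega>\<bar> > e} \<le> (1 / e) * (LINT \<omega>|N. \<bar>X i \<omega> - Y \<omega>\<bar>)"
      if i: "integrable N (X i)" for i
    proof -
      have m: "X i \<in> borel_measurable N" "Y \<in> borel_measurable N" using i int(2) by auto
      have "measure N {\<omega> \<in> space N. \<bar>X i \<omega> - Y \<omega>\<bar> > e} \<le> measure N {\<omega> \<in> space N. \<bar>X i \<omega> - Y \<omega>\<bar> \<ge> e}"
        by (rule finite_measure_mono) (use m in auto)
      also have "\<dots> \<le> (LINT \<omega>|N. \<bar>X i \<omega> - Y \<omega>\<bar>) / e"
        by (rule integral_Markov_inequality_measure[where A = "{}"]) (use i int(2) e in auto)
      finally show ?thesis by simp
    qed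
    with int(1) show "eventually (\<lambda>i. measure N {\<omega> \<in> space N. \<bar>X i \<omega> - Y \<omega>\<bar> > e}
        \<le> (1 / e) * (LINT \<omega>|N. \<bar>X i \<omega> - Y \<omega>\<bar>)) F" by (rule eventually_mono)
  qed simp
qed

context sigma_finite_subalgebra
begin

text \<open>This is what allows approximation under the conditional expectation without any conditional estimate.\<close>
lemma real_cond_exp_L1_contraction:
  assumes "integrable M X" "integrable M X'"
  shows "(LINT \<omega>|M. \<bar>real_cond_exp M F X \<omega> - real_cond_exp M F X' \<omega>\<bar>) \<le> (LINT \<omega>|M. \<bar>X \<omega> - X' \<omega>\<bar>)"
proof -
  let ?D = "\<lambda>\<omega>. X \<omega> - X' \<omega>"
  have D: "integrable M ?D" "integrable M (\<lambda>\<omega>. \<bar>?D \<omega>\<bar>)" "integrable M (\<lambda>\<omega>. - \<bar>?D \<omega>\<bar>)" using assms by auto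
  have 1: "AE \<omega> in M. real_cond_exp M F ?D \<omega> = real_cond_exp M F X \<omega> - real_cond_exp M F X' \<omega>"
    by (rule real_cond_exp_diff[OF assms])
  have 2: "AE \<omega> in M. real_cond_exp M F ?D \<omega> \<le> real_cond_exp M F (\<lambda>\<omega>. \<bar>?D \<omega>\<bar>) \<omega>"
    by (rule real_cond_exp_mono[OF _ D(1,2)]) simp
  have 3: "AE \<omega> in M. real_cond_exp M F (\<lambda>\<omega>. - \<bar>?D \<omega>\<bar>) \<omega> \<le> real_cond_exp M F ?D \<omega>"
    by (rule real_cond_exp_mono[OF _ D(3,1)]) (simp add: abs_if)
  have 4: "AE \<omega> in M. real_cond_exp M F (\<lambda>\<omega>. - 1 * \<bar>?D \<omega>\<bar>) \<omega> = - 1 * real_cond_exp M F (\<lambda>\<omega>. \<bar>?D \<omega>\<bar>) \<omega>"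
    by (rule real_cond_exp_cmult[OF D(2)])
  have "(LINT \<omega>|M. \<bar>real_cond_exp M F X \<omega> - real_cond_exp M F X' \<omega>\<bar>) \<le> (LINT \<omega>|M. real_cond_exp M F (\<lambda>\<omega>. \<bar>?D \<omega>\<bar>) \<omega>)"
  proof (rule integral_mono_AE)
    show "integrable M (\<lambda>\<omega>. \<bar>real_cond_exp M F X \<omega> - real_cond_exp M F X' \<omega>\<bar>)"
      using real_cond_exp_int(1)[OF assms(1)] real_cond_exp_int(1)[OF assms(2)] by auto
    show "integrable M (real_cond_exp M F (\<lambda>\<omega>. \<bar>?D \<omega>\<bar>))" by (rule real_cond_exp_int(1)[OF D(2)])
    show "AE \<omega> in M. \<bar>real_cond_exp M F X \<omega> - real_cond_exp M F X' \<omega>\<bar> \<le> real_cond_exp M F (\<lambda>\<omega>. \<bar>?D \<omega>\<bar>) \<omega>"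
      using 1 2 3 4 by eventually_elim auto
  qed
  also have "\<dots> = (LINT \<omega>|M. \<bar>?D \<omega>\<bar>)" by (rule real_cond_exp_int(2)[OF D(2)])
  finally show ?thesis .
qed

lemma real_cond_exp_AE_bound:
  assumes "finite_measure M" "X \<in> borel_measurable M" "\<And>\<omega>. \<omega> \<in> space M \<Longrightarrow> \<bar>X \<omega>\<bar> \<le> (B::real)"
  shows "AE \<omega> in M. \<bar>real_cond_exp M F X \<omega>\<bar> \<le> B"
proof -
  interpret finite_measure M by fact
  have X: "integrable M X"
    by (rule integrable_const_bound[of _ B]) (use assms in auto)
  have c: "AE \<omega> in M. real_cond_exp M F (\<lambda>_. c) \<omega> = c" for c :: real
    by (rule real_cond_exp_F_meas) auto
  have "AE \<omega> in M. real_cond_exp M F X \<omega> \<le> real_cond_exp M F (\<lambda>_. B) \<omega>"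
    by (rule real_cond_exp_mono) (use assms X in \<open>auto simp: abs_le_iff\<close>)
  moreover have "AE \<omega> in M. real_cond_exp M F (\<lambda>_. - B) \<omega> \<le> real_cond_exp M F X \<omega>"
  proof (rule real_cond_exp_mono)
    show "AE \<omega> in M. - B \<le> X \<omega>" by (rule AE_I2) (use assms(3) in \<open>force simp: abs_le_iff\<close>)
  qed (use X in auto)
  ultimately show ?thesis using c[of B] c[of "- B"] by eventually_elim (auto simp: abs_le_iff)
qed

end

locale extended_prob_space = prob_space M for M :: "'w measure" +
  fixes C G :: "'w measure" and Mb :: "'v measure" and \<pi> :: "'v \<Rightarrow> 'w"
  assumes MG: "subalgebra M G" and GC: "subalgebra G C" and ext: "is_extension M Mb \<pi>"
begin

lemma MC: "subalgebra M C"
  using MG GC unfolding subalgebra_def by auto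

sublocale C: finite_measure_subalgebra M C
  by unfold_locales (rule MC)

sublocale Mb: prob_space Mb
  using ext unfolding is_extension_def by simp

lemma \<pi>_meas[measurable]: "\<pi> \<in> measurable Mb M" and \<pi>_distr: "distr Mb M \<pi> = M"
  using ext unfolding is_extension_def by simp_all

text \<open>The sigma-field \<open>C\<close> carried to the extension, on which conditional expectations of the limit are taken.\<close>
definition Cb :: "'v measure" where "Cb = vimage_algebra (space Mb) \<pi> C"

lemma Mb_Cb: "subalgebra Mb Cb"
  unfolding subalgebra_def
proof
  show "space Cb = space Mb" by (simp add: Cb_def)
  have "\<pi> \<in> space Mb \<rightarrow> space C"
    using measurable_space[OF \<pi>_meas] MC by (auto simp: subalgebra_def)
  then have "sets Cb = {\<pi> -` A \<inter> space Mb | A. A \<in> sets C}"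
    unfolding Cb_def by (rule sets_vimage_algebra2)
  then show "sets Cb \<subseteq> sets Mb"
    using MC by (auto simp: subalgebra_def intro!: measurable_sets[OF \<pi>_meas])
qed

sublocale Cb: finite_measure_subalgebra Mb Cb
  by unfold_locales (rule Mb_Cb)

lemma integral_pullback:
  fixes X :: "'w \<Rightarrow> real"
  assumes "X \<in> borel_measurable M"
  shows "(LINT \<omega>|Mb. X (\<pi> \<omega>)) = (LINT \<omega>|M. X \<omega>)"
  using integral_distr[OF \<pi>_meas assms] by (simp add: \<pi>_distr)

lemma AE_pullback:
  assumes "AE \<omega> in M. P \<omega>" shows "AE \<omega> in Mb. P (\<pi> \<omega>)"
proof -
  have "AE \<omega> in distr Mb M \<pi>. P \<omega>" unfolding \<pi>_distr by (rule assms)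
  then show ?thesis by (rule AE_distrD[OF \<pi>_meas])
qed

lemma integrable_pullback:
  fixes X :: "'w \<Rightarrow> real"
  assumes "integrable M X" shows "integrable Mb (\<lambda>\<omega>. X (\<pi> \<omega>))"
  using integrable_distr_eq[OF \<pi>_meas, of X] assms by (simp add: \<pi>_distr borel_measurable_integrable)

lemma G_measurable: "Y \<in> borel_measurable G \<Longrightarrow> Y \<in> borel_measurable M"
  using MG by (rule measurable_from_subalg)

lemma G_bounded:
  assumes "bounded (Y ` space G)"
  obtains B :: real where "B > 0" "\<And>\<omega>. \<omega> \<in> space M \<Longrightarrow> \<bar>Y \<omega>\<bar> \<le> B"
proof -
  obtain B where B: "B > 0" "\<forall>y\<in>Y ` space G. norm y \<le> B" using assms by (auto simp: bounded_pos)
  show thesis by (rule that[OF B(1)]) (use B(2) MG in \<open>auto simp: subalgebra_def\<close>)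
qed

text \<open>
  The distance between the two conditional expectations is split at the conditional expectations of the
  approximations: the outer terms are at most the \<open>L\<^sup>1\<close> errors times the bound of \<open>Y\<close>, and the middle term
  tends to zero because convergence in probability of bounded variables is convergence in \<open>L\<^sup>1\<close>.
\<close>
lemma conditional_L1_limit:
  fixes Xs :: "nat \<Rightarrow> 'w \<Rightarrow> real" and X :: "'v \<Rightarrow> real"
  assumes X: "\<And>n. Xs n \<in> borel_measurable M" "X \<in> borel_measurable Mb"
    and F: "\<And>n \<omega>. \<bar>Xs n \<omega>\<bar> \<le> F" "\<And>\<omega>. \<bar>X \<omega>\<bar> \<le> F"
    and Y: "Y \<in> borel_measurable G" "bounded (Y ` space G)"
    and approx: "\<And>e. e > 0 \<Longrightarrow> \<exists>Xs' X'. (\<forall>n. Xs' n \<in> borel_measurable M) \<and> X' \<in> borel_measurable Mb \<and>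
      (\<forall>n. \<forall>\<omega>\<in>space M. \<bar>Xs' n \<omega>\<bar> \<le> F) \<and> (\<forall>\<omega>. \<bar>X' \<omega>\<bar> \<le> F) \<and>
      eventually (\<lambda>n. (LINT \<omega>|M. \<bar>Xs n \<omega> - Xs' n \<omega>\<bar>) \<le> e) sequentially \<and> (LINT \<omega>|Mb. \<bar>X \<omega> - X' \<omega>\<bar>) \<le> e \<and>
      tendsto_in_prob Mb (\<lambda>n \<omega>. real_cond_exp M C (\<lambda>\<omega>'. Xs' n \<omega>' * Y \<omega>') (\<pi> \<omega>))
        (ext_cond_exp Mb \<pi> C (\<lambda>\<omega>. X' \<omega> * Y (\<pi> \<omega>))) sequentially"
  shows "(\<lambda>n. LINT \<omega>|Mb. \<bar>real_cond_exp M C (\<lambda>\<omega>'. Xs n \<omega>' * Y \<omega>') (\<pi> \<omega>)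
            - ext_cond_exp Mb \<pi> C (\<lambda>\<omega>. X \<omega> * Y (\<pi> \<omega>)) \<omega>\<bar>) \<longlonglongrightarrow> 0"
proof (rule order_tendstoI)
  fix e :: real
  let ?d = "\<lambda>n. LINT \<omega>|Mb. \<bar>real_cond_exp M C (\<lambda>\<omega>'. Xs n \<omega>' * Y \<omega>') (\<pi> \<omega>)
            - ext_cond_exp Mb \<pi> C (\<lambda>\<omega>. X \<omega> * Y (\<pi> \<omega>)) \<omega>\<bar>"
  { assume "e < 0"
    moreover have "0 \<le> ?d n" for n by (rule integral_nonneg_AE) simp
    ultimately show "eventually (\<lambda>n. e < ?d n) sequentially"
      by (intro always_eventually allI) (rule less_le_trans) }
  assume e: "0 < e"
  obtain B where B: "B > 0" "\<And>\<omega>. \<omega> \<in> space M \<Longrightarrow> \<bar>Y \<omega>\<bar> \<le> B" by (rule G_bounded[OF Y(2)]) blast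
  have Y_meas[measurable]: "Y \<in> borel_measurable M" by (rule G_measurable[OF Y(1)])
  have Yb: "\<bar>Y (\<pi> \<omega>)\<bar> \<le> B" if "\<omega> \<in> space Mb" for \<omega>
    using B(2) measurable_space[OF \<pi>_meas that] by simp
  define e' where "e' = e / (4 * B)"
  have e': "e' > 0" using e B by (simp add: e'_def)
  obtain Xs' X' where X': "\<And>n. Xs' n \<in> borel_measurable M" "X' \<in> borel_measurable Mb"
    "\<And>n \<omega>. \<omega> \<in> space M \<Longrightarrow> \<bar>Xs' n \<omega>\<bar> \<le> F" "\<And>\<omega>. \<bar>X' \<omega>\<bar> \<le> F"
    "eventually (\<lambda>n. (LINT \<omega>|M. \<bar>Xs n \<omega> - Xs' n \<omega>\<bar>) \<le> e') sequentially" "(LINT \<omega>|Mb. \<bar>X \<omega> - X' \<omega>\<bar>) \<le> e'"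
    "tendsto_in_prob Mb (\<lambda>n \<omega>. real_cond_exp M C (\<lambda>\<omega>'. Xs' n \<omega>' * Y \<omega>') (\<pi> \<omega>))
        (ext_cond_exp Mb \<pi> C (\<lambda>\<omega>. X' \<omega> * Y (\<pi> \<omega>))) sequentially"
    using approx[OF e'] by blast
  note [measurable] = X X'(1,2)
  have F0: "F \<ge> 0" using F(2) abs_ge_zero order_trans by blast
  have b1: "\<bar>Xs n \<omega> * Y \<omega>\<bar> \<le> F * B" "\<bar>Xs' n \<omega> * Y \<omega>\<bar> \<le> F * B" if "\<omega> \<in> space M" for n \<omega>
    unfolding abs_mult using F(1)[of n \<omega>] X'(3)[OF that, of n] B(2)[OF that] F0 by (auto intro!: mult_mono)
  have b2: "\<bar>X \<omega> * Y (\<pi> \<omega>)\<bar> \<le> F * B" "\<bar>X' \<omega> * Y (\<pi> \<omega>)\<bar> \<le> F * B" if "\<omega> \<in> space Mb" for \<omega>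
    unfolding abs_mult using F(2)[of \<omega>] X'(4)[of \<omega>] Yb[OF that] F0 by (auto intro!: mult_mono)
  have i1: "integrable M (\<lambda>\<omega>. Xs n \<omega> * Y \<omega>)" "integrable M (\<lambda>\<omega>. Xs' n \<omega> * Y \<omega>)" for n
    by (rule integrable_const_bound[of _ "F * B"], use b1 in \<open>auto\<close>)+
  have i2: "integrable Mb (\<lambda>\<omega>. X \<omega> * Y (\<pi> \<omega>))" "integrable Mb (\<lambda>\<omega>. X' \<omega> * Y (\<pi> \<omega>))"
    by (rule Mb.integrable_const_bound[of _ "F * B"], use b2 in \<open>auto\<close>)+
  let ?E = "\<lambda>n. real_cond_exp M C (\<lambda>\<omega>'. Xs n \<omega>' * Y \<omega>')" and ?E' = "\<lambda>n. real_cond_exp M C (\<lambda>\<omega>'. Xs' n \<omega>' * Y \<omega>')"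
  let ?L = "ext_cond_exp Mb \<pi> C (\<lambda>\<omega>. X \<omega> * Y (\<pi> \<omega>))" and ?L' = "ext_cond_exp Mb \<pi> C (\<lambda>\<omega>. X' \<omega> * Y (\<pi> \<omega>))"
  have L: "?L = real_cond_exp Mb Cb (\<lambda>\<omega>. X \<omega> * Y (\<pi> \<omega>))" "?L' = real_cond_exp Mb Cb (\<lambda>\<omega>. X' \<omega> * Y (\<pi> \<omega>))"
    by (simp_all add: ext_cond_exp_def Cb_def)
  have iE: "integrable M (?E n)" "integrable M (?E' n)" for n using i1 by (auto intro: C.real_cond_exp_int(1))
  have iL: "integrable Mb ?L" "integrable Mb ?L'" unfolding L using i2 by (auto intro: Cb.real_cond_exp_int(1))
  have iEp: "integrable Mb (\<lambda>\<omega>. ?E n (\<pi> \<omega>))" "integrable Mb (\<lambda>\<omega>. ?E' n (\<pi> \<omega>))" for n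
    using iE by (auto intro: integrable_pullback)
  have "(\<lambda>n. LINT \<omega>|Mb. \<bar>?E' n (\<pi> \<omega>) - ?L' \<omega>\<bar>) \<longlonglongrightarrow> 0"
  proof (rule tendsto_in_prob_imp_L1[OF Mb.prob_space_axioms X'(7)])
    show "(\<lambda>\<omega>. ?E' n (\<pi> \<omega>)) \<in> borel_measurable Mb" for n using iEp by auto
    show "?L' \<in> borel_measurable Mb" using iL by auto
    show "AE \<omega> in Mb. \<bar>?E' n (\<pi> \<omega>)\<bar> \<le> F * B" for n
      by (rule AE_pullback, rule C.real_cond_exp_AE_bound[OF finite_measure_axioms]) (use b1 in auto)
    show "AE \<omega> in Mb. \<bar>?L' \<omega>\<bar> \<le> F * B"
      unfolding L by (rule Cb.real_cond_exp_AE_bound[OF Mb.finite_measure_axioms]) (use b2 in auto)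
  qed
  then have "eventually (\<lambda>n. (LINT \<omega>|Mb. \<bar>?E' n (\<pi> \<omega>) - ?L' \<omega>\<bar>) < e / 4) sequentially"
    by (rule order_tendstoD) (use e in simp)
  then show "eventually (\<lambda>n. ?d n < e) sequentially" using X'(5)
  proof eventually_elim
    case (elim n)
    have "(LINT \<omega>|Mb. \<bar>?E n (\<pi> \<omega>) - ?E' n (\<pi> \<omega>)\<bar>) = (LINT \<omega>|M. \<bar>?E n \<omega> - ?E' n \<omega>\<bar>)"
      by (rule integral_pullback) measurable
    also have "\<dots> \<le> (LINT \<omega>|M. \<bar>Xs n \<omega> * Y \<omega> - Xs' n \<omega> * Y \<omega>\<bar>)"
      by (rule C.real_cond_exp_L1_contraction[OF i1])
    also have "\<dots> \<le> (LINT \<omega>|M. B * \<bar>Xs n \<omega> - Xs' n \<omega>\<bar>)"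
    proof (rule integral_mono)
      have "integrable M (\<lambda>\<omega>. Xs n \<omega>)" "integrable M (\<lambda>\<omega>. Xs' n \<omega>)"
        by (rule integrable_const_bound[of _ "F"], use F X'(3) in \<open>auto\<close>)+
      then show "integrable M (\<lambda>\<omega>. B * \<bar>Xs n \<omega> - Xs' n \<omega>\<bar>)" by auto
      show "\<bar>Xs n \<omega> * Y \<omega> - Xs' n \<omega> * Y \<omega>\<bar> \<le> B * \<bar>Xs n \<omega> - Xs' n \<omega>\<bar>" if "\<omega> \<in> space M" for \<omega>
        using mult_right_mono[OF B(2)[OF that], of "\<bar>Xs n \<omega> - Xs' n \<omega>\<bar>"]
        by (simp add: abs_mult[symmetric] algebra_simps)
    qed (use i1 in auto)
    also have "\<dots> \<le> B * e'" using elim(2) B by simp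
    finally have t1: "(LINT \<omega>|Mb. \<bar>?E n (\<pi> \<omega>) - ?E' n (\<pi> \<omega>)\<bar>) \<le> e / 4" using B by (simp add: e'_def)
    have "(LINT \<omega>|Mb. \<bar>?L' \<omega> - ?L \<omega>\<bar>) \<le> (LINT \<omega>|Mb. \<bar>X' \<omega> * Y (\<pi> \<omega>) - X \<omega> * Y (\<pi> \<omega>)\<bar>)"
      unfolding L by (rule Cb.real_cond_exp_L1_contraction[OF i2(2,1)])
    also have "\<dots> \<le> (LINT \<omega>|Mb. B * \<bar>X \<omega> - X' \<omega>\<bar>)"
    proof (rule integral_mono)
      have "integrable Mb X" "integrable Mb X'"
        by (rule Mb.integrable_const_bound[of _ "F"], use F X'(4) in \<open>auto\<close>)+
      then show "integrable Mb (\<lambda>\<omega>. B * \<bar>X \<omega> - X' \<omega>\<bar>)" by auto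
      show "\<bar>X' \<omega> * Y (\<pi> \<omega>) - X \<omega> * Y (\<pi> \<omega>)\<bar> \<le> B * \<bar>X \<omega> - X' \<omega>\<bar>" if "\<omega> \<in> space Mb" for \<omega>
        using mult_right_mono[OF Yb[OF that], of "\<bar>X' \<omega> - X \<omega>\<bar>"]
        by (simp add: abs_mult[symmetric] algebra_simps abs_minus_commute)
    qed (use i2 in auto)
    also have "\<dots> \<le> B * e'" using X'(6) B by simp
    finally have t2: "(LINT \<omega>|Mb. \<bar>?L' \<omega> - ?L \<omega>\<bar>) \<le> e / 4" using B by (simp add: e'_def)
    have "?d n \<le> (LINT \<omega>|Mb. \<bar>?E n (\<pi> \<omega>) - ?E' n (\<pi> \<omega>)\<bar> + \<bar>?E' n (\<pi> \<omega>) - ?L' \<omega>\<bar> + \<bar>?L' \<omega> - ?L \<omega>\<bar>)"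
      by (rule integral_mono) (use iEp iL in auto)
    also have "\<dots> = (LINT \<omega>|Mb. \<bar>?E n (\<pi> \<omega>) - ?E' n (\<pi> \<omega>)\<bar>) + (LINT \<omega>|Mb. \<bar>?E' n (\<pi> \<omega>) - ?L' \<omega>\<bar>) +
        (LINT \<omega>|Mb. \<bar>?L' \<omega> - ?L \<omega>\<bar>)"
      using iEp iL by simp
    finally show ?case using t1 t2 elim(1) e by linarith
  qed
qed

lemma expectation_difference_le:
  assumes X: "integrable M X" "integrable Mb Z"
  shows "\<bar>(LINT \<omega>|M. X \<omega>) - (LINT \<omega>|Mb. Z \<omega>)\<bar> \<le>
    (LINT \<omega>|Mb. \<bar>real_cond_exp M C X (\<pi> \<omega>) - ext_cond_exp Mb \<pi> C Z \<omega>\<bar>)"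
proof -
  have L: "ext_cond_exp Mb \<pi> C Z = real_cond_exp Mb Cb Z" by (simp add: ext_cond_exp_def Cb_def)
  have i1: "integrable Mb (\<lambda>\<omega>. real_cond_exp M C X (\<pi> \<omega>))"
    by (rule integrable_pullback) (rule C.real_cond_exp_int(1)[OF X(1)])
  have i2: "integrable Mb (real_cond_exp Mb Cb Z)" by (rule Cb.real_cond_exp_int(1)[OF X(2)])
  have "(LINT \<omega>|M. X \<omega>) - (LINT \<omega>|Mb. Z \<omega>) = (LINT \<omega>|Mb. real_cond_exp M C X (\<pi> \<omega>) - real_cond_exp Mb Cb Z \<omega>)"
    using i1 i2 C.real_cond_exp_int(2)[OF X(1)] Cb.real_cond_exp_int(2)[OF X(2)]
      integral_pullback[of "real_cond_exp M C X"] by simp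
  also have "\<bar>\<dots>\<bar> \<le> (LINT \<omega>|Mb. \<bar>real_cond_exp M C X (\<pi> \<omega>) - real_cond_exp Mb Cb Z \<omega>\<bar>)"
    by (rule integral_abs_bound)
  finally show ?thesis by (simp add: L)
qed

lemma conditional_prob_AE_bounds:
  assumes "A \<in> sets M"
  shows "AE \<omega> in M. 0 \<le> conditional_prob M C A \<omega> \<and> conditional_prob M C A \<omega> \<le> 1"
proof -
  have i: "integrable M (indicator A :: _ \<Rightarrow> real)" using assms by (auto simp: emeasure_eq_measure)
  have "AE \<omega> in M. 0 \<le> real_cond_exp M C (indicator A) \<omega>"
    by (rule C.real_cond_exp_pos) (use assms in auto)
  moreover have "AE \<omega> in M. \<bar>real_cond_exp M C (indicator A) \<omega>\<bar> \<le> 1"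
    by (rule C.real_cond_exp_AE_bound[OF finite_measure_axioms]) (use assms in auto)
  ultimately show ?thesis unfolding conditional_prob_def by eventually_elim auto
qed

lemma conditional_prob_integral:
  assumes A: "A \<in> sets M" and \<psi>: "\<psi> \<in> borel_measurable C" "\<And>\<omega>. \<omega> \<in> space M \<Longrightarrow> 0 \<le> \<psi> \<omega> \<and> \<psi> \<omega> \<le> (1::real)"
  shows "(LINT \<omega>|M. conditional_prob M C A \<omega> * \<psi> \<omega>) = (LINT \<omega>|M. indicator A \<omega> * \<psi> \<omega>)"
    "integrable M (\<lambda>\<omega>. conditional_prob M C A \<omega> * \<psi> \<omega>)" "integrable M (\<lambda>\<omega>. indicator A \<omega> * \<psi> \<omega>)"
proof -
  have \<psi>M: "\<psi> \<in> borel_measurable M" using MC \<psi>(1) by (rule measurable_from_subalg)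
  note [measurable] = A \<psi>M
  have int: "integrable M (\<lambda>\<omega>. \<psi> \<omega> * indicator A \<omega>)"
    by (rule integrable_const_bound[of _ 1]) (use \<psi>(2) in \<open>auto simp: indicator_def\<close>)
  then show "integrable M (\<lambda>\<omega>. indicator A \<omega> * \<psi> \<omega>)" by (simp add: mult.commute)
  have Am: "(indicator A :: _ \<Rightarrow> real) \<in> borel_measurable M" by simp
  show "(LINT \<omega>|M. conditional_prob M C A \<omega> * \<psi> \<omega>) = (LINT \<omega>|M. indicator A \<omega> * \<psi> \<omega>)"
    using C.real_cond_exp_intg(2)[OF int \<psi>(1) Am] by (simp add: conditional_prob_def mult.commute)
  show "integrable M (\<lambda>\<omega>. conditional_prob M C A \<omega> * \<psi> \<omega>)"
    using C.real_cond_exp_intg(1)[OF int \<psi>(1) Am] by (simp add: conditional_prob_def mult.commute)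
qed

end

section \<open>From the conditional hypotheses to tightness and equicontinuity\<close>

lemma bounded_continuous_image_of_bounded:
  fixes f :: "'a::euclidean_space \<Rightarrow> 'b::real_normed_vector"
  assumes "continuous_on (closure S) f" "bounded S"
  shows "bounded (f ` S)"
proof -
  have "compact (f ` closure S)" using assms by (intro compact_continuous_image) auto
  then show ?thesis by (rule bounded_subset[OF compact_imp_bounded image_mono[OF closure_subset]])
qed

lemma tail_event_measurable:
  fixes Z :: "'w \<Rightarrow> real^'p \<Rightarrow> real"
  assumes meas: "\<And>u. (\<lambda>\<omega>. Z \<omega> u) \<in> borel_measurable M" and cont: "\<And>\<omega>. \<omega> \<in> space M \<Longrightarrow> continuous_on UNIV (Z \<omega>)"
    and UU: "bounded UU" and [measurable]: "\<epsilon> \<in> borel_measurable M"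
  shows "tail_event M UU Z r \<epsilon> \<in> sets M"
proof -
  let ?V = "{u \<in> UU. norm u \<ge> r}"
  have [measurable]: "(\<lambda>\<omega>. SUP u\<in>?V. Z \<omega> u) \<in> borel_measurable M"
  proof (rule continuous_cSUP_measurable[OF meas continuous_on_subset[OF cont]])
    fix \<omega> assume w: "\<omega> \<in> space M"
    have "bounded (Z \<omega> ` ?V)"
      by (rule bounded_continuous_image_of_bounded[OF continuous_on_subset[OF cont[OF w]]])
         (use UU in \<open>auto intro: bounded_subset\<close>)
    then show "bdd_above (Z \<omega> ` ?V)" by (rule bounded_imp_bdd_above)
  qed auto
  show ?thesis unfolding tail_event_def Let_def by (cases "?V = {}") auto
qed

lemma tail_event_complement:
  fixes Z :: "'w \<Rightarrow> real^'p \<Rightarrow> real"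
  assumes w: "\<omega> \<in> space M" "\<omega> \<notin> tail_event M UU Z r \<epsilon>" and cont: "continuous_on UNIV (Z \<omega>)" and UU: "bounded UU"
    and u: "u \<in> UU" "norm u \<ge> r"
  shows "Z \<omega> u < \<epsilon> \<omega>"
proof -
  let ?V = "{u \<in> UU. norm u \<ge> r}"
  have "bounded (Z \<omega> ` ?V)"
    by (rule bounded_continuous_image_of_bounded[OF continuous_on_subset[OF cont]])
       (use UU in \<open>auto intro: bounded_subset\<close>)
  then have "Z \<omega> u \<le> (SUP u\<in>?V. Z \<omega> u)"
    using u by (intro cSUP_upper) (auto intro: bounded_imp_bdd_above)
  moreover have V: "?V \<noteq> {}" using u by auto
  ultimately show ?thesis using w unfolding tail_event_def Let_def if_not_P[OF V] by auto
qed

text \<open>Writing the modulus as a supremum over a set of pairs makes it accessible to \<open>continuous_cSUP_measurable\<close>.\<close>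
lemma log_modulus_SUP:
  "log_modulus UU z \<delta> c = (SUP p\<in>{(u1, u2). u1 \<in> UU \<and> norm u1 < c \<and> u2 \<in> UU \<and> norm u2 < c \<and> norm (u2 - u1) \<le> \<delta>}.
     \<bar>ln (z (snd p)) - ln (z (fst p))\<bar>)"
  unfolding log_modulus_def by (rule arg_cong[of _ _ Sup]) force

lemma log_modulus_bdd_above:
  fixes z :: "real^'p \<Rightarrow> real"
  assumes "bounded ((\<lambda>u. ln (z u)) ` UU)"
  shows "bdd_above ((\<lambda>p. \<bar>ln (z (snd p)) - ln (z (fst p))\<bar>) `
     {(u1, u2). u1 \<in> UU \<and> norm u1 < c \<and> u2 \<in> UU \<and> norm u2 < c \<and> norm (u2 - u1) \<le> \<delta>})"
proof -
  obtain B where B: "\<And>u. u \<in> UU \<Longrightarrow> \<bar>ln (z u)\<bar> \<le> (B::real)" using assms unfolding bounded_iff by auto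
  show ?thesis
  proof (rule bdd_aboveI2[of _ _ "2 * B"])
    fix p assume "p \<in> {(u1, u2). u1 \<in> UU \<and> norm u1 < c \<and> u2 \<in> UU \<and> norm u2 < c \<and> norm (u2 - u1) \<le> \<delta>}"
    then show "\<bar>ln (z (snd p)) - ln (z (fst p))\<bar> \<le> 2 * B"
      using B[of "fst p"] B[of "snd p"] by (auto simp: case_prod_unfold)
  qed
qed

lemma modulus_event_measurable:
  fixes Z :: "'w \<Rightarrow> real^'p \<Rightarrow> real"
  assumes meas: "\<And>u. (\<lambda>\<omega>. Z \<omega> u) \<in> borel_measurable M" and cont: "\<And>\<omega>. \<omega> \<in> space M \<Longrightarrow> continuous_on UNIV (Z \<omega>)"
    and pos: "\<And>\<omega> u. \<omega> \<in> space M \<Longrightarrow> u \<in> UU \<Longrightarrow> Z \<omega> u > 0"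
    and bdd: "\<And>\<omega>. \<omega> \<in> space M \<Longrightarrow> bounded ((\<lambda>u. ln (Z \<omega> u)) ` UU)"
  shows "modulus_event M UU Z \<delta> c \<epsilon> \<in> sets M"
proof -
  note meas[measurable]
  have [measurable]: "(\<lambda>\<omega>. log_modulus UU (Z \<omega>) \<delta> c) \<in> borel_measurable M"
    unfolding log_modulus_SUP
  proof (rule continuous_cSUP_measurable)
    let ?S = "{(u1, u2). u1 \<in> UU \<and> norm u1 < c \<and> u2 \<in> UU \<and> norm u2 < c \<and> norm (u2 - u1) \<le> \<delta>}"
    fix \<omega> assume w: "\<omega> \<in> space M"
    have "continuous_on ?S (\<lambda>p. Z \<omega> (snd p))" "continuous_on ?S (\<lambda>p. Z \<omega> (fst p))"
      by (rule continuous_on_compose2[OF cont[OF w]], auto intro!: continuous_intros)+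
    moreover have "Z \<omega> (snd p) \<noteq> 0" "Z \<omega> (fst p) \<noteq> 0" if "p \<in> ?S" for p
      using pos[OF w, of "fst p"] pos[OF w, of "snd p"] that by auto
    ultimately show "continuous_on ?S (\<lambda>p. \<bar>ln (Z \<omega> (snd p)) - ln (Z \<omega> (fst p))\<bar>)"
      by (intro continuous_intros) auto
    show "bdd_above ((\<lambda>p. \<bar>ln (Z \<omega> (snd p)) - ln (Z \<omega> (fst p))\<bar>) ` ?S)"
      by (rule log_modulus_bdd_above[OF bdd[OF w]])
  qed measurable
  show ?thesis unfolding modulus_event_def by measurable
qed

lemma modulus_event_complement:
  assumes w: "\<omega> \<in> space M" "\<omega> \<notin> modulus_event M UU Z \<delta> c \<epsilon>" and bdd: "bounded ((\<lambda>u. ln (Z \<omega> u)) ` UU)"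
    and u: "u1 \<in> UU" "u2 \<in> UU" "norm u1 < c" "norm u2 < c" "norm (u2 - u1) \<le> \<delta>"
  shows "\<bar>ln (Z \<omega> u2) - ln (Z \<omega> u1)\<bar> \<le> \<epsilon>"
proof -
  have "\<bar>ln (Z \<omega> u2) - ln (Z \<omega> u1)\<bar> \<le> log_modulus UU (Z \<omega>) \<delta> c"
    unfolding log_modulus_SUP
    using cSUP_upper[OF _ log_modulus_bdd_above[OF bdd], of "(u1, u2)" c \<delta>] u by simp
  then show ?thesis using w by (simp add: modulus_event_def not_less)
qed

context extended_prob_space
begin

lemma C_measurable: "\<psi> \<in> borel_measurable C \<Longrightarrow> \<psi> \<in> borel_measurable M"
  using MC by (rule measurable_from_subalg)

text \<open>The hypotheses control events only after multiplication by \<open>\<psi>\<close>; this removes the factor.\<close>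
lemma prob_le_weighted:
  assumes A: "A \<in> sets M" and \<psi>: "\<psi> \<in> borel_measurable C" "\<And>\<omega>. \<omega> \<in> space M \<Longrightarrow> 0 \<le> \<psi> \<omega> \<and> \<psi> \<omega> \<le> (1::real)"
  shows "prob A \<le> (LINT \<omega>|M. indicator A \<omega> * \<psi> \<omega>) + (LINT \<omega>|M. \<bar>\<psi> \<omega> - 1\<bar>)"
proof -
  note [measurable] = A C_measurable[OF \<psi>(1)]
  have i1: "integrable M (\<lambda>\<omega>. \<bar>\<psi> \<omega> - 1\<bar>)" by (rule integrable_const_bound[of _ 1]) (use \<psi>(2) in \<open>force\<close>)+
  have "prob A = (LINT \<omega>|M. indicator A \<omega>)" using A sets.sets_into_space by simp
  also have "\<dots> \<le> (LINT \<omega>|M. indicator A \<omega> * \<psi> \<omega> + \<bar>\<psi> \<omega> - 1\<bar>)"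
  proof (rule integral_mono)
    show "integrable M (indicator A :: _ \<Rightarrow> real)" by (simp add: emeasure_eq_measure)
    show "integrable M (\<lambda>\<omega>. indicator A \<omega> * \<psi> \<omega> + \<bar>\<psi> \<omega> - 1\<bar>)"
      using i1 conditional_prob_integral(3)[OF A \<psi>] by auto
    show "indicator A \<omega> \<le> indicator A \<omega> * \<psi> \<omega> + \<bar>\<psi> \<omega> - 1\<bar>" for \<omega>
      by (auto simp: indicator_def)
  qed
  also have "\<dots> = (LINT \<omega>|M. indicator A \<omega> * \<psi> \<omega>) + (LINT \<omega>|M. \<bar>\<psi> \<omega> - 1\<bar>)"
    using i1 conditional_prob_integral(3)[OF A \<psi>] by simp
  finally show ?thesis .
qed

text \<open>
  The weight is removed only after the union over the radii has been taken, so that its cost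
  \<open>\<integral> |\<psi> - 1|\<close> is paid once and not once per radius.
\<close>
lemma prob_union_le_conditional_sum:
  fixes S :: "nat \<Rightarrow> 'w set"
  assumes S: "\<And>r. r \<ge> R \<Longrightarrow> S r \<in> sets M" and B: "B \<in> sets C"
    and \<psi>: "\<psi> \<in> borel_measurable C" "\<And>\<omega>. \<omega> \<in> space M \<Longrightarrow> 0 \<le> \<psi> \<omega> \<and> \<psi> \<omega> \<le> (1::real)"
    and b: "\<And>r. r \<ge> R \<Longrightarrow> AE \<omega> in M. \<omega> \<in> B \<longrightarrow> conditional_prob M C (S r) \<omega> * \<psi> \<omega> \<le> b r"
    and b0: "\<And>r. b r \<ge> 0" and sm: "summable b"
  shows "prob ((\<Union>r\<in>{R..}. S r) \<inter> B) \<le> (\<Sum>i. b (i + R)) + (LINT \<omega>|M. \<bar>\<psi> \<omega> - 1\<bar>)"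
proof -
  have BM[measurable]: "B \<in> sets M" using B MC by (auto simp: subalgebra_def)
  note [measurable] = C_measurable[OF \<psi>(1)] B
  define A where "A = (\<lambda>N. (\<Union>i<N. S (i + R)) \<inter> B)"
  have SM[measurable]: "S (i + R) \<in> sets M" for i using S by simp
  have AM: "A N \<in> sets M" for N unfolding A_def by measurable
  have \<psi>B: "(\<lambda>\<omega>. \<psi> \<omega> * indicator B \<omega>) \<in> borel_measurable C"
    using \<psi>(1) B by simp
  have \<psi>B01: "0 \<le> \<psi> \<omega> * indicator B \<omega> \<and> \<psi> \<omega> * indicator B \<omega> \<le> 1" if "\<omega> \<in> space M" for \<omega>
    using \<psi>(2)[OF that] by (auto simp: indicator_def)
  have each: "(LINT \<omega>|M. indicator (S (i + R)) \<omega> * (\<psi> \<omega> * indicator B \<omega>)) \<le> b (i + R)" for i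
  proof -
    have "(LINT \<omega>|M. indicator (S (i + R)) \<omega> * (\<psi> \<omega> * indicator B \<omega>)) =
        (LINT \<omega>|M. conditional_prob M C (S (i + R)) \<omega> * (\<psi> \<omega> * indicator B \<omega>))"
      using conditional_prob_integral(1)[OF SM \<psi>B \<psi>B01] by simp
    also have "\<dots> \<le> (LINT \<omega>|M. b (i + R))"
    proof (rule integral_mono_AE)
      show "integrable M (\<lambda>\<omega>. conditional_prob M C (S (i + R)) \<omega> * (\<psi> \<omega> * indicator B \<omega>))"
        by (rule conditional_prob_integral(2)[OF SM \<psi>B \<psi>B01])
      have "R \<le> i + R" by simp
      show "AE \<omega> in M. conditional_prob M C (S (i + R)) \<omega> * (\<psi> \<omega> * indicator B \<omega>) \<le> b (i + R)"
        using b[OF \<open>R \<le> i + R\<close>] by eventually_elim (auto simp: b0 indicator_def)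
    qed simp
    finally show ?thesis by (simp add: prob_space)
  qed
  have le: "prob (A N) \<le> (\<Sum>i. b (i + R)) + (LINT \<omega>|M. \<bar>\<psi> \<omega> - 1\<bar>)" for N
  proof -
    have ii: "integrable M (\<lambda>\<omega>. indicator (S (i + R)) \<omega> * (\<psi> \<omega> * indicator B \<omega>))" for i
      by (rule conditional_prob_integral(3)[OF SM \<psi>B \<psi>B01])
    have "(LINT \<omega>|M. indicator (A N) \<omega> * \<psi> \<omega>) \<le> (LINT \<omega>|M. (\<Sum>i<N. indicator (S (i + R)) \<omega> * (\<psi> \<omega> * indicator B \<omega>)))"
    proof (rule integral_mono)
      show "integrable M (\<lambda>\<omega>. indicator (A N) \<omega> * \<psi> \<omega>)" by (rule conditional_prob_integral(3)[OF AM \<psi>])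
      show "integrable M (\<lambda>\<omega>. (\<Sum>i<N. indicator (S (i + R)) \<omega> * (\<psi> \<omega> * indicator B \<omega>)))"
        using ii by (intro Bochner_Integration.integrable_sum) auto
      fix \<omega> assume w: "\<omega> \<in> space M"
      show "indicator (A N) \<omega> * \<psi> \<omega> \<le> (\<Sum>i<N. indicator (S (i + R)) \<omega> * (\<psi> \<omega> * indicator B \<omega>))"
      proof (cases "\<omega> \<in> A N")
        case True
        then obtain i where i: "i < N" "\<omega> \<in> S (i + R)" "\<omega> \<in> B" by (auto simp: A_def)
        have "indicator (A N) \<omega> * \<psi> \<omega> = indicator (S (i + R)) \<omega> * (\<psi> \<omega> * indicator B \<omega>)" using True i by simp
        also have "\<dots> \<le> (\<Sum>i<N. indicator (S (i + R)) \<omega> * (\<psi> \<omega> * indicator B \<omega>))"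
          by (rule member_le_sum) (use i \<psi>(2)[OF w] in auto)
        finally show ?thesis .
      next
        case False
        then show ?thesis using \<psi>(2)[OF w] by (auto intro!: sum_nonneg)
      qed
    qed
    also have "\<dots> = (\<Sum>i<N. (LINT \<omega>|M. indicator (S (i + R)) \<omega> * (\<psi> \<omega> * indicator B \<omega>)))"
      using ii by (subst Bochner_Integration.integral_sum) auto
    also have "\<dots> \<le> (\<Sum>i<N. b (i + R))" by (intro sum_mono each)
    also have "\<dots> \<le> (\<Sum>i. b (i + R))"
      by (rule sum_le_suminf) (use sm b0 in \<open>auto simp: summable_iff_shift\<close>)
    finally show ?thesis using prob_le_weighted[OF AM \<psi>, of N] by linarith
  qed
  have "incseq A" unfolding A_def incseq_def by (auto intro: less_le_trans)
  then have lim: "(\<lambda>N. prob (A N)) \<longlonglongrightarrow> prob (\<Union>N. A N)"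
    using AM by (intro finite_Lim_measure_incseq) auto
  have "(\<Union>r\<in>{R..}. S r) \<inter> B \<subseteq> (\<Union>N. A N)"
  proof
    fix \<omega> assume "\<omega> \<in> (\<Union>r\<in>{R..}. S r) \<inter> B"
    then obtain r where r: "r \<ge> R" "\<omega> \<in> S r" "\<omega> \<in> B" by auto
    then have "\<omega> \<in> A (Suc (r - R))" unfolding A_def by (auto intro!: bexI[of _ "r - R"])
    then show "\<omega> \<in> (\<Union>N. A N)" by blast
  qed
  then have "prob ((\<Union>r\<in>{R..}. S r) \<inter> B) \<le> prob (\<Union>N. A N)"
    using AM by (intro finite_measure_mono) auto
  also have "\<dots> \<le> (\<Sum>i. b (i + R)) + (LINT \<omega>|M. \<bar>\<psi> \<omega> - 1\<bar>)"
    by (rule LIMSEQ_le_const2[OF lim]) (use le in auto)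
  finally show ?thesis .
qed

lemma prob_exceeds_level_small:
  assumes U: "U \<in> borel_measurable C" and e: "e > 0"
  obtains K :: real where "K > 0" "\<And>K'. K' \<ge> K \<Longrightarrow> prob {\<omega> \<in> space M. U \<omega> > K'} \<le> e"
proof -
  have [measurable]: "U \<in> borel_measurable M" by (rule C_measurable[OF U])
  define A where "A = (\<lambda>n::nat. {\<omega> \<in> space M. U \<omega> > real n})"
  have AM: "A n \<in> sets M" for n unfolding A_def by measurable
  have "decseq A" unfolding A_def decseq_def by (auto intro: order_le_less_trans)
  then have "(\<lambda>n. prob (A n)) \<longlonglongrightarrow> prob (\<Inter>n. A n)"
    using AM by (intro finite_Lim_measure_decseq) auto
  moreover have "(\<Inter>n. A n) = {}"
  proof -
    have "\<omega> \<notin> (\<Inter>n. A n)" for \<omega>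
    proof -
      obtain n :: nat where "U \<omega> \<le> real n" using real_arch_simple by blast
      then have "\<omega> \<notin> A n" by (simp add: A_def)
      then show ?thesis by blast
    qed
    then show ?thesis by blast
  qed
  ultimately have "(\<lambda>n. prob (A n)) \<longlonglongrightarrow> 0" by simp
  then have "eventually (\<lambda>n. prob (A n) < e) sequentially" by (rule order_tendstoD) (rule e)
  then obtain n where n: "prob (A n) < e" unfolding eventually_sequentially by blast
  show thesis
  proof (rule that[of "real n + 1"])
    fix K' assume K': "K' \<ge> real n + 1"
    have "prob {\<omega> \<in> space M. U \<omega> > K'} \<le> prob (A n)"
      by (rule finite_measure_mono) (use K' AM in \<open>auto simp: A_def\<close>)
    then show "prob {\<omega> \<in> space M. U \<omega> > K'} \<le> e" using n by simp
  qed simp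
qed

text \<open>
  The random bounds \<open>U\<close> and \<open>V\<close> become constants on the event \<open>B\<close> that both are at most \<open>K\<close>. This event lies
  in \<open>C\<close>, so it may be moved inside the conditional probabilities, whose bounds \<open>K r\<^sup>-\<^sup>L\<close> are then summed
  over the radii \<open>r \<ge> R\<close>. Off the tail events a point with \<open>r \<le> |u| < r + 1\<close> satisfies \<open>1 + |u| \<le> 3 r\<close>,
  which turns \<open>K r\<^sup>-\<^sup>D\<close> into a multiple of \<open>(1 + |u|)\<^sup>-\<^sup>D\<close>.
\<close>
lemma tightness_from_conditional_tail:
  fixes Z :: "nat \<Rightarrow> 'w \<Rightarrow> real^'p \<Rightarrow> real"
  assumes U: "U \<in> borel_measurable C" and V: "V \<in> borel_measurable C" and L: "L > 1" and D: "D > 0"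
    and \<psi>: "\<And>n. \<psi> n \<in> borel_measurable C" "\<And>n \<omega>. \<omega> \<in> space M \<Longrightarrow> 0 \<le> \<psi> n \<omega> \<and> \<psi> n \<omega> \<le> (1::real)"
    and \<psi>1: "(\<lambda>n. LINT \<omega>|M. \<bar>\<psi> n \<omega> - 1\<bar>) \<longlonglongrightarrow> 0"
    and meas: "\<And>n u. (\<lambda>\<omega>. Z n \<omega> u) \<in> borel_measurable M"
    and cont: "\<And>n \<omega>. \<omega> \<in> space M \<Longrightarrow> continuous_on UNIV (Z n \<omega>)" and UU: "\<And>n. bounded (UU n)"
    and cond: "\<And>n r. r \<ge> 1 \<Longrightarrow> AE \<omega> in M. conditional_prob M C
        (tail_event M (UU n) (Z n) (real r) (\<lambda>\<omega>. U \<omega> / real r powr D)) \<omega> * \<psi> n \<omega> \<le> V \<omega> / real r powr L"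
    and e: "e > 0"
  shows "\<exists>K R. K > 0 \<and> eventually (\<lambda>n. \<exists>E\<in>sets M. measure M E \<le> e \<and>
        (\<forall>\<omega>\<in>space M - E. \<forall>u\<in>UU n. norm u \<ge> R \<longrightarrow> Z n \<omega> u \<le> K * (1 + norm u) powr (- D))) sequentially"
proof -
  note [measurable] = C_measurable[OF U] C_measurable[OF V]
  have e4: "e / 4 > 0" using e by simp
  obtain K1 where K1: "K1 > 0" "\<And>K'. K' \<ge> K1 \<Longrightarrow> prob {\<omega> \<in> space M. U \<omega> > K'} \<le> e / 4"
    by (rule prob_exceeds_level_small[OF U e4]) blast
  obtain K2 where K2: "K2 > 0" "\<And>K'. K' \<ge> K2 \<Longrightarrow> prob {\<omega> \<in> space M. V \<omega> > K'} \<le> e / 4"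
    by (rule prob_exceeds_level_small[OF V e4]) blast
  define K where "K = max K1 K2"
  have K: "K > 0" using K1 by (simp add: K_def)
  define B where "B = {\<omega> \<in> space M. U \<omega> \<le> K \<and> V \<omega> \<le> K}"
  have spC: "space C = space M" using MC by (simp add: subalgebra_def)
  have BC: "B \<in> sets C" unfolding B_def spC[symmetric] using U V by measurable
  have BM[measurable]: "B \<in> sets M" using BC MC by (auto simp: subalgebra_def)
  have PB: "prob (space M - B) \<le> e / 2"
  proof -
    have "prob (space M - B) \<le> prob ({\<omega> \<in> space M. U \<omega> > K} \<union> {\<omega> \<in> space M. V \<omega> > K})"
      by (rule finite_measure_mono) (auto simp: B_def not_le)
    also have "\<dots> \<le> prob {\<omega> \<in> space M. U \<omega> > K} + prob {\<omega> \<in> space M. V \<omega> > K}"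
      by (rule measure_Un_le) auto
    also have "\<dots> \<le> e / 4 + e / 4" using K1(2)[of K] K2(2)[of K] by (intro add_mono) (auto simp: K_def)
    finally show ?thesis by simp
  qed
  define b where "b = (\<lambda>r::nat. K * real r powr (- L))"
  have b0: "b r \<ge> 0" for r unfolding b_def using K by simp
  have sm: "summable b" unfolding b_def using L by (intro summable_mult) (simp add: summable_real_powr_iff)
  obtain N where N: "\<And>n. n \<ge> N \<Longrightarrow> norm (\<Sum>i. b (i + n)) < e / 4" using suminf_exist_split[OF e4 sm] by blast
  define R where "R = max N 1"
  have RN: "(\<Sum>i. b (i + R)) < e / 4" using N[of R] by (simp add: R_def)
  have "eventually (\<lambda>n. (LINT \<omega>|M. \<bar>\<psi> n \<omega> - 1\<bar>) < e / 4) sequentially"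
    by (rule order_tendstoD[OF \<psi>1]) (rule e4)
  then have "eventually (\<lambda>n. \<exists>E\<in>sets M. measure M E \<le> e \<and>
        (\<forall>\<omega>\<in>space M - E. \<forall>u\<in>UU n. norm u \<ge> real R \<longrightarrow> Z n \<omega> u \<le> K * 3 powr D * (1 + norm u) powr (- D))) sequentially"
  proof eventually_elim
    case (elim n)
    define S where "S = (\<lambda>r::nat. tail_event M (UU n) (Z n) (real r) (\<lambda>\<omega>. U \<omega> / real r powr D))"
    have SM: "S r \<in> sets M" for r unfolding S_def
      by (rule tail_event_measurable[OF meas cont UU]) auto
    have cb: "AE \<omega> in M. \<omega> \<in> B \<longrightarrow> conditional_prob M C (S r) \<omega> * \<psi> n \<omega> \<le> b r" if r: "r \<ge> R" for r
    proof -
      have r1: "r \<ge> 1" using r by (simp add: R_def)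
      show ?thesis using cond[OF r1, of n]
      proof eventually_elim
        case (elim \<omega>)
        show ?case
        proof
          assume "\<omega> \<in> B"
          then have "V \<omega> / real r powr L \<le> K / real r powr L"
            by (intro divide_right_mono) (auto simp: B_def)
          also have "\<dots> = b r" by (simp add: b_def powr_minus_divide)
          finally show "conditional_prob M C (S r) \<omega> * \<psi> n \<omega> \<le> b r" using elim unfolding S_def by simp
        qed
      qed
    qed
    define E where "E = (space M - B) \<union> ((\<Union>r\<in>{R..}. S r) \<inter> B)"
    have UM: "(\<Union>r\<in>{R..}. S r) \<inter> B \<in> sets M" using SM by auto
    have EM: "E \<in> sets M" unfolding E_def using UM by auto
    have "prob E \<le> prob (space M - B) + prob ((\<Union>r\<in>{R..}. S r) \<inter> B)"
      unfolding E_def using UM by (intro measure_Un_le) auto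
    also have "prob ((\<Union>r\<in>{R..}. S r) \<inter> B) \<le> (\<Sum>i. b (i + R)) + (LINT \<omega>|M. \<bar>\<psi> n \<omega> - 1\<bar>)"
      by (rule prob_union_le_conditional_sum[OF SM BC \<psi> cb b0 sm])
    finally have "prob E \<le> e" using PB RN elim by linarith
    moreover have "Z n \<omega> u \<le> K * 3 powr D * (1 + norm u) powr (- D)"
      if w: "\<omega> \<in> space M - E" and u: "u \<in> UU n" "norm u \<ge> real R" for \<omega> u
    proof -
      define r where "r = nat \<lfloor>norm u\<rfloor>"
      have fl: "real_of_int \<lfloor>norm u\<rfloor> \<ge> 0" by simp
      have rr: "real r = real_of_int \<lfloor>norm u\<rfloor>" by (simp add: r_def)
      have ru: "real r \<le> norm u" "norm u < real r + 1" unfolding rr by linarith+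
      have "int R \<le> \<lfloor>norm u\<rfloor>" using u(2) by (simp add: le_floor_iff)
      then have rR: "r \<ge> R" unfolding r_def by simp
      have r1: "real r \<ge> 1" using rR by (simp add: R_def)
      have wB: "\<omega> \<in> B" and wS: "\<omega> \<notin> S r" using w rR by (auto simp: E_def)
      have "Z n \<omega> u < U \<omega> / real r powr D"
        using tail_event_complement[of \<omega> M "UU n" "Z n" "real r" "\<lambda>\<omega>. U \<omega> / real r powr D" u] w wS cont UU u ru
        unfolding S_def by auto
      also have "\<dots> \<le> K / real r powr D" using wB by (intro divide_right_mono) (auto simp: B_def)
      also have "\<dots> = K * real r powr (- D)" by (simp add: powr_minus_divide)
      also have "\<dots> \<le> K * ((1 + norm u) / 3) powr (- D)"
        using K D ru r1 by (intro mult_left_mono powr_mono2') auto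
      also have "((1 + norm u) / 3) powr (- D) = 3 powr D * (1 + norm u) powr (- D)"
        by (simp add: powr_divide powr_minus_divide)
      finally show ?thesis by simp
    qed
    ultimately show ?case using EM by blast
  qed
  moreover have "K * 3 powr D > 0" using K by simp
  ultimately show ?thesis by blast
qed

text \<open>
  A reverse Fatou argument: where the upper limit of the conditional probabilities is at most \<open>e'\<close>, they
  are eventually below \<open>2 e'\<close>, and dominated convergence turns this into a bound on the probability that
  they exceed \<open>2 e'\<close>.
\<close>
lemma equicontinuity_from_conditional_modulus:
  fixes W :: "real \<Rightarrow> nat \<Rightarrow> 'w set"
  assumes W: "\<And>\<delta> n. W \<delta> n \<in> sets M"
    and \<psi>: "\<And>n. \<psi> n \<in> borel_measurable C" "\<And>n \<omega>. \<omega> \<in> space M \<Longrightarrow> 0 \<le> \<psi> n \<omega> \<and> \<psi> n \<omega> \<le> (1::real)"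
    and \<psi>1: "(\<lambda>n. LINT \<omega>|M. \<bar>\<psi> n \<omega> - 1\<bar>) \<longlonglongrightarrow> 0"
    and cond: "tendsto_in_prob M (\<lambda>\<delta> \<omega>. real_of_ereal (limsup (\<lambda>n. ereal (conditional_prob M C (W \<delta> n) \<omega> * \<psi> n \<omega>))))
        (\<lambda>\<omega>. 0) (at_right 0)"
    and e: "e > 0"
  obtains \<delta> where "0 < \<delta>" "\<delta> < 1" "eventually (\<lambda>n. prob (W \<delta> n) \<le> e) sequentially"
proof -
  define e' where "e' = e / 5"
  have e': "e' > 0" using e by (simp add: e'_def)
  define ls where "ls = (\<lambda>\<delta> \<omega>. limsup (\<lambda>n. ereal (conditional_prob M C (W \<delta> n) \<omega> * \<psi> n \<omega>)))"
  have "((\<lambda>\<delta>. prob {\<omega> \<in> space M. \<bar>real_of_ereal (ls \<delta> \<omega>) - 0\<bar> > e'}) \<longlongrightarrow> 0) (at_right 0)"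
    using cond e' unfolding tendsto_in_prob_def ls_def by blast
  then have "eventually (\<lambda>\<delta>. prob {\<omega> \<in> space M. \<bar>real_of_ereal (ls \<delta> \<omega>) - 0\<bar> > e'} < e') (at_right 0)"
    by (rule order_tendstoD) (rule e')
  moreover have "eventually (\<lambda>\<delta>::real. \<delta> \<in> {0<..<1}) (at_right 0)"
    by (rule eventually_at_right_real) simp
  ultimately have "eventually (\<lambda>\<delta>. prob {\<omega> \<in> space M. \<bar>real_of_ereal (ls \<delta> \<omega>) - 0\<bar> > e'} < e' \<and> \<delta> \<in> {0<..<1}) (at_right 0)"
    by eventually_elim auto
  then obtain \<delta> where \<delta>: "prob {\<omega> \<in> space M. \<bar>real_of_ereal (ls \<delta> \<omega>) - 0\<bar> > e'} < e'" "0 < \<delta>" "\<delta> < 1"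
    using eventually_happens'[OF trivial_limit_at_right_real] by fastforce
  define X where "X = (\<lambda>n \<omega>. conditional_prob M C (W \<delta> n) \<omega> * \<psi> n \<omega>)"
  have ls_eq: "ls \<delta> = (\<lambda>\<omega>. limsup (\<lambda>n. ereal (X n \<omega>)))" by (simp add: ls_def X_def)
  note [measurable] = C_measurable[OF \<psi>(1)] W
  have X_meas[measurable]: "X n \<in> borel_measurable M" for n
    unfolding X_def conditional_prob_def by measurable
  have ls_meas[measurable]: "ls \<delta> \<in> borel_measurable M"
    unfolding ls_eq by measurable
  have X01: "AE \<omega> in M. 0 \<le> X n \<omega> \<and> X n \<omega> \<le> 1" for n
  proof -
    have "AE \<omega> in M. \<omega> \<in> space M" by simp
    then show ?thesis using conditional_prob_AE_bounds[OF W[of \<delta> n]]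
    proof eventually_elim
      case (elim \<omega>)
      then show ?case using \<psi>(2)[of \<omega> n] unfolding X_def by (auto intro: mult_le_one)
    qed
  qed
  then have X01_all: "AE \<omega> in M. \<forall>n. 0 \<le> X n \<omega> \<and> X n \<omega> \<le> 1" by (simp add: AE_all_countable)
  define G where "G = {\<omega> \<in> space M. \<bar>real_of_ereal (ls \<delta> \<omega>)\<bar> \<le> e'}"
  have [measurable]: "G \<in> sets M" unfolding G_def by measurable
  define f where "f = (\<lambda>n \<omega>. indicator (G \<inter> {\<omega> \<in> space M. X n \<omega> > 2 * e'}) \<omega> :: real)"
  have "(\<lambda>n. LINT \<omega>|M. f n \<omega>) \<longlonglongrightarrow> (LINT \<omega>|M. 0)"
  proof (rule integral_dominated_convergence[where w = "\<lambda>_. 1"])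
    show "AE \<omega> in M. (\<lambda>n. f n \<omega>) \<longlonglongrightarrow> 0"
      using X01_all
    proof eventually_elim
      case (elim \<omega>)
      show ?case
      proof (cases "\<omega> \<in> G")
        case False then show ?thesis by (simp add: f_def)
      next
        case True
        have up: "ls \<delta> \<omega> \<le> 1" unfolding ls_eq
          by (rule Limsup_bounded) (use elim in auto)
        have lo: "0 \<le> ls \<delta> \<omega>" unfolding ls_eq
          by (rule le_Limsup) (use elim in auto)
        have "ls \<delta> \<omega> = ereal (real_of_ereal (ls \<delta> \<omega>))"
          using up lo by (cases "ls \<delta> \<omega>") auto
        also have "\<dots> \<le> ereal e'"
          unfolding ereal_less_eq(3) using True order_trans[OF abs_ge_self] unfolding G_def by blast
        also have "\<dots> < ereal (2 * e')" using e' by simp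
        finally have "eventually (\<lambda>n. ereal (X n \<omega>) < ereal (2 * e')) sequentially"
          unfolding ls_eq by (rule Limsup_lessD)
        then have "eventually (\<lambda>n. f n \<omega> = 0) sequentially"
          by eventually_elim (auto simp: f_def)
        then show ?thesis by (rule tendsto_eventually)
      qed
    qed
    show "AE \<omega> in M. norm (f n \<omega>) \<le> 1" for n by (simp add: f_def)
    show "f n \<in> borel_measurable M" for n unfolding f_def by measurable
  qed auto
  then have "(\<lambda>n. LINT \<omega>|M. f n \<omega>) \<longlonglongrightarrow> 0" by simp
  then have "eventually (\<lambda>n. (LINT \<omega>|M. f n \<omega>) < e') sequentially" by (rule order_tendstoD) (rule e')
  moreover have "eventually (\<lambda>n. (LINT \<omega>|M. \<bar>\<psi> n \<omega> - 1\<bar>) < e') sequentially" by (rule order_tendstoD[OF \<psi>1]) (rule e')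
  ultimately have "eventually (\<lambda>n. prob (W \<delta> n) \<le> e) sequentially"
  proof eventually_elim
    case (elim n)
    have [measurable]: "f n \<in> borel_measurable M" unfolding f_def by measurable
    have fi: "integrable M (f n)" by (rule integrable_const_bound[of _ 1]) (auto simp: f_def)
    have "(LINT \<omega>|M. X n \<omega>) \<le> (LINT \<omega>|M. 2 * e' + indicator (space M - G) \<omega> + f n \<omega>)"
    proof (rule integral_mono_AE)
      show "integrable M (X n)"
        by (rule integrable_const_bound[of _ 1]) (use X01[of n] in \<open>auto elim: eventually_mono\<close>)
      show "integrable M (\<lambda>\<omega>. 2 * e' + indicator (space M - G) \<omega> + f n \<omega>)"
        using fi by (auto simp: emeasure_eq_measure)
      have "AE \<omega> in M. \<omega> \<in> space M" by simp
      then show "AE \<omega> in M. X n \<omega> \<le> 2 * e' + indicator (space M - G) \<omega> + f n \<omega>"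
        using X01[of n] by eventually_elim (use e' in \<open>auto simp: f_def indicator_def\<close>)
    qed
    also have "\<dots> = 2 * e' + prob (space M - G) + (LINT \<omega>|M. f n \<omega>)"
      using fi by (simp add: emeasure_eq_measure prob_space Int_absorb1)
    also have "space M - G = {\<omega> \<in> space M. \<bar>real_of_ereal (ls \<delta> \<omega>) - 0\<bar> > e'}" by (auto simp: G_def)
    finally have "(LINT \<omega>|M. X n \<omega>) \<le> 4 * e'" using \<delta>(1) elim(1) by linarith
    moreover have "(LINT \<omega>|M. X n \<omega>) = (LINT \<omega>|M. indicator (W \<delta> n) \<omega> * \<psi> n \<omega>)"
      unfolding X_def by (rule conditional_prob_integral(1)[OF W \<psi>])
    ultimately show ?case using prob_le_weighted[OF W \<psi>, of \<delta> n n] elim(2) by (simp add: e'_def)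
  qed
  then show thesis using that \<delta> by blast
qed

end

section \<open>The local parameter\<close>

lemma norm_matrix_vector_le:
  fixes A :: "real^'p^'p"
  shows "norm (A *v u) \<le> real CARD('p) * norm A * norm u"
proof -
  have "norm (A *v u) \<le> (\<Sum>i\<in>UNIV. \<bar>(A *v u) $ i\<bar>)" by (rule norm_le_l1_cart)
  also have "\<dots> \<le> (\<Sum>i\<in>(UNIV::'p set). norm A * norm u)"
  proof (rule sum_mono)
    fix i
    have "\<bar>(A *v u) $ i\<bar> = \<bar>(A $ i) \<bullet> u\<bar>" by (simp add: matrix_vector_mul_component)
    also have "\<dots> \<le> norm (A $ i) * norm u" by (rule Cauchy_Schwarz_ineq2)
    also have "\<dots> \<le> norm A * norm u" by (intro mult_right_mono Finite_Cartesian_Product.norm_nth_le) simp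
    finally show "\<bar>(A *v u) $ i\<bar> \<le> norm A * norm u" .
  qed
  finally show ?thesis by simp
qed

lemma matrix_inv_vector:
  fixes A :: "real^'p^'p"
  assumes "invertible A"
  shows "matrix_inv A *v (A *v x) = x" "A *v (matrix_inv A *v x) = x"
proof -
  have "A ** matrix_inv A = mat 1 \<and> matrix_inv A ** A = mat 1"
    using assms unfolding invertible_def matrix_inv_def by (rule someI_ex)
  then show "matrix_inv A *v (A *v x) = x" "A *v (matrix_inv A *v x) = x"
    by (simp_all add: matrix_vector_mul_assoc)
qed

lemma continuous_local_param: "continuous_on UNIV (local_param \<theta>s A)"
  unfolding local_param_def by (intro continuous_intros matrix_vector_mult_linear_continuous_on)

lemma open_local_space: "open \<Theta> \<Longrightarrow> open (local_space \<Theta> \<theta>s A)"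
  unfolding local_space_def using open_vimage[OF _ continuous_local_param, of \<Theta> \<theta>s A] by (simp add: vimage_def)

lemma bounded_local_space:
  assumes "bounded \<Theta>" "invertible A"
  shows "bounded (local_space \<Theta> \<theta>s A)"
proof -
  obtain R where R: "\<And>\<theta>. \<theta> \<in> \<Theta> \<Longrightarrow> norm \<theta> \<le> R" using assms(1) unfolding bounded_iff by blast
  show ?thesis
  proof (rule boundedI)
    fix u assume "u \<in> local_space \<Theta> \<theta>s A"
    then have "norm (\<theta>s + A *v u) \<le> R" using R by (simp add: local_space_def local_param_def)
    then have "norm (A *v u) \<le> R + norm \<theta>s"
      using norm_triangle_ineq4[of "\<theta>s + A *v u" \<theta>s] by simp
    moreover have "norm u \<le> real CARD('a) * norm (matrix_inv A) * norm (A *v u)"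
      using norm_matrix_vector_le[of "matrix_inv A" "A *v u"] by (simp add: matrix_inv_vector[OF assms(2)])
    ultimately show "norm u \<le> real CARD('a) * norm (matrix_inv A) * (R + norm \<theta>s)"
      by (meson mult_left_mono mult_nonneg_nonneg norm_ge_zero of_nat_0_le_iff order_trans)
  qed
qed

lemma scaling_uniformly_small:
  fixes A :: "nat \<Rightarrow> real^'p^'p"
  assumes "A \<longlonglongrightarrow> 0" "r > 0"
  shows "eventually (\<lambda>n. \<forall>u. norm u < R \<longrightarrow> norm (A n *v u) < r) sequentially"
proof -
  have "(\<lambda>n. real CARD('p) * norm (A n) * \<bar>R\<bar>) \<longlonglongrightarrow> real CARD('p) * norm (0::real^'p^'p) * \<bar>R\<bar>"
    by (intro tendsto_intros assms)
  then have "eventually (\<lambda>n. real CARD('p) * norm (A n) * \<bar>R\<bar> < r) sequentially"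
    by (rule order_tendstoD) (use assms(2) in simp)
  then show ?thesis
  proof eventually_elim
    case (elim n)
    show ?case
    proof (intro allI impI)
      fix u :: "real^'p" assume u: "norm u < R"
      have "norm (A n *v u) \<le> real CARD('p) * norm (A n) * norm u" by (rule norm_matrix_vector_le)
      also have "\<dots> \<le> real CARD('p) * norm (A n) * \<bar>R\<bar>" using u by (intro mult_left_mono) auto
      finally show "norm (A n *v u) < r" using elim by simp
    qed
  qed
qed

text \<open>
  The Jacobian constant of the substitution, the factor \<open>exp (h \<theta>s)\<close> and the value of the prior at \<open>\<theta>s\<close> all
  cancel between numerator and denominator; \<open>A\<close> commutes with the integral by linearity and is undone by
  its inverse.
\<close>
lemma quasi_bayes_local:
  fixes \<Theta> :: "(real^'p) set" and A :: "real^'p^'p"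
  assumes \<Theta>: "open \<Theta>" "bounded \<Theta>" "\<theta>s \<in> \<Theta>" and A: "invertible A"
    and h: "continuous_on (closure \<Theta>) h"
    and prior: "continuous_on \<Theta> prior" "\<And>\<theta>. \<theta> \<in> \<Theta> \<Longrightarrow> c \<le> prior \<theta>" "\<And>\<theta>. \<theta> \<in> \<Theta> \<Longrightarrow> prior \<theta> \<le> C" "c > 0"
  shows "matrix_inv A *v (quasi_bayes \<Theta> prior h - \<theta>s) =
    field_mean (\<lambda>u. indicator (local_space \<Theta> \<theta>s A) u *
      exp (h (local_param \<theta>s A u) - h \<theta>s) * (prior (local_param \<theta>s A u) / prior \<theta>s))"
proof -
  let ?U = "local_space \<Theta> \<theta>s A"
  define k where "k = (\<lambda>\<theta>. indicator \<Theta> \<theta> * (exp (h \<theta>) * prior \<theta>))"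
  have hcont: "continuous_on \<Theta> h" using h closure_subset continuous_on_subset by blast
  have k_meas[measurable]: "k \<in> borel_measurable borel"
  proof -
    have "continuous_on \<Theta> (\<lambda>\<theta>. exp (h \<theta>) * prior \<theta>)" by (intro continuous_intros hcont prior)
    from borel_measurable_continuous_on_indicator[OF _ this] \<Theta>(1) show ?thesis by (simp add: k_def)
  qed
  have "compact (h ` closure \<Theta>)" using \<Theta>(2) h by (intro compact_continuous_image) auto
  then obtain B where B: "\<And>\<theta>. \<theta> \<in> closure \<Theta> \<Longrightarrow> \<bar>h \<theta>\<bar> \<le> B"
    using compact_imp_bounded[of "h ` closure \<Theta>"] unfolding bounded_iff by auto
  have B': "\<bar>h \<theta>\<bar> \<le> B" if "\<theta> \<in> \<Theta>" for \<theta> using B closure_subset that by blast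
  define k' where "k' = (\<lambda>u. k (local_param \<theta>s A u))"
  have lp[measurable]: "local_param \<theta>s A \<in> borel_measurable borel"
    using continuous_local_param by (rule borel_measurable_continuous_onI)
  have k'_meas[measurable]: "k' \<in> borel_measurable borel" unfolding k'_def by measurable
  have k'_eq: "k' u = indicator ?U u * (exp (h (local_param \<theta>s A u)) * prior (local_param \<theta>s A u))" for u
    by (simp add: k'_def k_def local_space_def indicator_def)
  have C0: "C \<ge> 0" using prior(2,3)[OF \<Theta>(3)] prior(4) by linarith
  have k'_bd: "\<bar>k' u\<bar> \<le> exp B * C" for u
  proof (cases "u \<in> ?U")
    case True
    then have "local_param \<theta>s A u \<in> \<Theta>" by (simp add: local_space_def)
    then have "exp (h (local_param \<theta>s A u)) * prior (local_param \<theta>s A u) \<le> exp B * C"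
      "0 \<le> prior (local_param \<theta>s A u)"
      using B' prior(2,3)[of "local_param \<theta>s A u"] prior(4) by (auto intro!: mult_mono simp: abs_le_iff)
    then show ?thesis using True by (simp add: k'_eq abs_mult)
  qed (simp add: k'_eq C0)
  obtain Rb where Rb: "\<And>u. u \<in> ?U \<Longrightarrow> norm u \<le> Rb"
    using bounded_local_space[OF \<Theta>(2) A] unfolding bounded_iff by blast
  have supp: "k' u = 0" if "norm u > Rb" for u
    using Rb[of u] that by (cases "u \<in> ?U") (auto simp: k'_eq)
  note ik = integrable_bounded_support[OF k'_meas k'_bd supp]
  have ik2: "integrable lborel (\<lambda>u. k' u *\<^sub>R u)" by (rule integrable_scaleR_moment[OF ik])
  have pos: "(LINT u|lborel. k' u) > 0"
  proof -
    have "0 \<in> ?U" using \<Theta>(3) by (simp add: local_space_def local_param_def)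
    then obtain r where r: "r > 0" "ball 0 r \<subseteq> ?U"
      using open_local_space[OF \<Theta>(1), of \<theta>s A] openE by blast
    have "0 < exp (- B) * c * measure lborel (ball (0::real^'p) r)"
      using prior(4) r(1) content_ball_gt_0_iff[of "0::real^'p" r] by simp
    also have "\<dots> = (LINT u|lborel. exp (- B) * c * indicator (ball (0::real^'p) r) u)" by simp
    also have "\<dots> \<le> (LINT u|lborel. k' u)"
    proof (rule integral_mono[OF _ ik(1)])
      show "integrable lborel (\<lambda>u. exp (- B) * c * indicator (ball (0::real^'p) r) u)"
        using emeasure_lborel_ball_finite by (intro integrable_mult_right integrable_real_indicator) auto
      fix u
      show "exp (- B) * c * indicator (ball 0 r) u \<le> k' u"
      proof (cases "u \<in> ?U")
        case True
        then have T: "local_param \<theta>s A u \<in> \<Theta>" by (simp add: local_space_def)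
        have "exp (- B) * c \<le> exp (h (local_param \<theta>s A u)) * prior (local_param \<theta>s A u)"
          using B'[OF T] prior(2)[OF T] prior(4) by (intro mult_mono) (auto simp: abs_le_iff)
        moreover have "0 \<le> exp (h (local_param \<theta>s A u)) * prior (local_param \<theta>s A u)"
          using prior(2)[OF T] prior(4) by auto
        ultimately show ?thesis using True by (simp add: k'_eq indicator_def)
      next
        case False
        then have "u \<notin> ball 0 r" using r(2) by blast
        then show ?thesis using False by (simp add: k'_eq)
      qed
    qed
    finally show ?thesis .
  qed
  have linA: "linear ((*v) A)" "linear ((*v) (matrix_inv A))" by (rule matrix_vector_mul_linear)+
  obtain cA :: real where cA: "cA > 0" "distr lborel borel ((*v) A) = density lborel (\<lambda>_. ennreal cA)"
    by (rule lborel_distr_linear[OF linA matrix_inv_vector[OF A]])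
  let ?D = "LINT u|lborel. k' u" and ?N = "LINT u|lborel. k' u *\<^sub>R u"
  have D: "?D = cA * (LINT \<theta>|lborel. k \<theta>)"
    using integral_lborel_affine[OF linA(1) cA k_meas, of \<theta>s] by (simp add: k'_def local_param_def)
  have N: "?D *\<^sub>R \<theta>s + A *v ?N = cA *\<^sub>R (LINT \<theta>|lborel. k \<theta> *\<^sub>R \<theta>)"
  proof -
    have m: "(\<lambda>\<theta>. k \<theta> *\<^sub>R \<theta>) \<in> borel_measurable borel" by measurable
    have "cA *\<^sub>R (LINT \<theta>|lborel. k \<theta> *\<^sub>R \<theta>) = (LINT u|lborel. k' u *\<^sub>R local_param \<theta>s A u)"
      using integral_lborel_affine[OF linA(1) cA m, of \<theta>s] by (simp add: k'_def local_param_def)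
    also have "\<dots> = (LINT u|lborel. k' u *\<^sub>R \<theta>s + A *v (k' u *\<^sub>R u))"
      by (simp add: local_param_def scaleR_add_right linear_scale[OF linA(1)])
    also have "\<dots> = ?D *\<^sub>R \<theta>s + A *v ?N"
      using ik(1) ik2 integral_bounded_linear[OF matrix_vector_mul_bounded_linear ik2, of A]
        integrable_bounded_linear[OF matrix_vector_mul_bounded_linear ik2, of A] by simp
    finally show ?thesis ..
  qed
  have "quasi_bayes \<Theta> prior h = inverse (LINT \<theta>|lborel. k \<theta>) *\<^sub>R (LINT \<theta>|lborel. k \<theta> *\<^sub>R \<theta>)"
    by (simp add: quasi_bayes_def set_lebesgue_integral_def k_def)
  also have "\<dots> = inverse ?D *\<^sub>R (cA *\<^sub>R (LINT \<theta>|lborel. k \<theta> *\<^sub>R \<theta>))"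
    unfolding D using cA(1) by simp
  also have "\<dots> = \<theta>s + A *v field_mean k'"
    unfolding N[symmetric] using pos by (simp add: field_mean_def scaleR_add_right linear_scale[OF linA(1)])
  finally have "matrix_inv A *v (quasi_bayes \<Theta> prior h - \<theta>s) = field_mean k'"
    by (simp add: matrix_inv_vector[OF A])
  also have "k' = (\<lambda>u. (exp (h \<theta>s) * prior \<theta>s) * (indicator ?U u *
      exp (h (local_param \<theta>s A u) - h \<theta>s) * (prior (local_param \<theta>s A u) / prior \<theta>s)))"
    using prior(2)[OF \<Theta>(3)] prior(4) by (auto simp: k'_eq exp_diff)
  also have "field_mean \<dots> = field_mean (\<lambda>u. indicator ?U u *
      exp (h (local_param \<theta>s A u) - h \<theta>s) * (prior (local_param \<theta>s A u) / prior \<theta>s))"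
    by (rule field_mean_scale) (use prior(2)[OF \<Theta>(3)] prior(4) in auto)
  finally show ?thesis .
qed

lemma tendsto_in_prob_compose:
  assumes "tendsto_in_prob M X Y F" "filterlim \<tau> F H"
  shows "tendsto_in_prob M (\<lambda>i. X (\<tau> i)) Y H"
  using assms unfolding tendsto_in_prob_def by (auto intro: filterlim_compose[OF _ assms(2)])

lemma eventually_at_top_in:
  "eventually P (at_top_in TT) \<longleftrightarrow> (\<exists>N. \<forall>T\<in>TT. T \<ge> N \<longrightarrow> P T)"
  unfolding at_top_in_def eventually_inf_principal eventually_at_top_linorder by blast

lemma tendsto_at_top_in_of_sequences:
  fixes d :: "real \<Rightarrow> real"
  assumes seq: "\<And>\<tau>. \<tau> \<in> index_seqs TT T0 \<Longrightarrow> (\<lambda>n. d (\<tau> n)) \<longlonglongrightarrow> l"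
  shows "(d \<longlongrightarrow> l) (at_top_in TT)"
proof (rule tendstoI, rule ccontr)
  fix e :: real assume e: "e > 0" and "\<not> eventually (\<lambda>T. dist (d T) l < e) (at_top_in TT)"
  then have "\<exists>T\<in>TT. T \<ge> max (real n) T0 \<and> \<not> dist (d T) l < e" for n :: nat
    unfolding eventually_at_top_in by blast
  then obtain \<tau> where \<tau>: "\<And>n. \<tau> n \<in> TT" "\<And>n::nat. \<tau> n \<ge> max (real n) T0" "\<And>n. \<not> dist (d (\<tau> n)) l < e"
    by metis
  have "filterlim \<tau> at_top sequentially"
    by (rule filterlim_at_top_mono[OF filterlim_real_sequentially]) (use \<tau>(2) in auto)
  then have "\<tau> \<in> index_seqs TT T0" using \<tau> by (auto simp: index_seqs_def)
  from tendstoD[OF seq[OF this] e] show False using \<tau>(3) by simp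
qed

lemma index_seqs_filterlim:
  assumes "\<tau> \<in> index_seqs TT T0"
  shows "filterlim \<tau> (at_top_in TT) sequentially"
  using assms unfolding at_top_in_def index_seqs_def
  by (simp add: filterlim_inf filterlim_principal)

text \<open>
  The first hypothesis speaks of the members of admissible sequences. Each index beyond \<open>T0\<close> is such a
  member, which also gives measurability of the estimator at that index.
\<close>
lemma index_seqs_through:
  assumes "\<not> bdd_above TT" "T \<in> TT" "T \<ge> T0"
  obtains \<tau> where "\<tau> \<in> index_seqs TT T0" "T \<in> range \<tau>"
proof -
  have "\<exists>T'\<in>TT. T' \<ge> max (real n) T0" for n :: nat
    using assms(1) unfolding bdd_above_def by (meson linear not_le)
  then obtain \<tau> where \<tau>: "\<And>n. \<tau> n \<in> TT" "\<And>n::nat. \<tau> n \<ge> max (real n) T0" by metis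
  define \<tau>' where "\<tau>' = (\<lambda>n. if n = 0 then T else \<tau> n)"
  have "filterlim \<tau>' at_top sequentially"
  proof (rule filterlim_at_top_mono[OF filterlim_real_sequentially])
    show "eventually (\<lambda>n. real n \<le> \<tau>' n) sequentially"
      using eventually_gt_at_top[of 0] by eventually_elim (use \<tau>(2) in \<open>auto simp: \<tau>'_def\<close>)
  qed
  then have "\<tau>' \<in> index_seqs TT T0" using \<tau> assms by (auto simp: index_seqs_def \<tau>'_def)
  moreover have "T \<in> range \<tau>'" by (rule range_eqI[of _ _ 0]) (simp add: \<tau>'_def)
  ultimately show thesis by (rule that)
qed

lemma continuous_map_Euclidean_space:
  fixes f :: "(nat \<Rightarrow> real) \<Rightarrow> real"
  assumes "continuous_on UNIV f"
  shows "continuous_map (Euclidean_space k) euclideanreal f"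
  using assms unfolding Euclidean_space_def euclidean_product_topology
  by (intro continuous_map_from_subtopology) simp

lemma bcontfun_eval_measurable:
  "(\<lambda>F :: 'a::topological_space \<Rightarrow>\<^sub>C real. apply_bcontfun F u) \<in> borel_measurable borel"
proof (rule borel_measurable_continuous_onI)
  show "continuous_on UNIV (\<lambda>F :: 'a \<Rightarrow>\<^sub>C real. apply_bcontfun F u)"
    unfolding continuous_on_iff by (metis dist_bounded order_le_less_trans)
qed

theorem theorem2p4:
  fixes M C G :: "'w measure" and Mb :: "'v measure" and \<pi> :: "'v \<Rightarrow> 'w"
    and TT :: "real set" and T0 :: real
    and \<Theta> :: "(real^'p) set" and \<theta>s :: "real^'p"
    and H :: "real \<Rightarrow> 'w \<Rightarrow> real^'p \<Rightarrow> real"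
    and a :: "real \<Rightarrow> real^'p^'p"
    and Z :: "real \<Rightarrow> 'w \<Rightarrow> real^'p \<Rightarrow> real"
    and Zlim :: "'v \<Rightarrow> (real^'p) \<Rightarrow>\<^sub>C real"
    and prior :: "real^'p \<Rightarrow> real"
    and \<Psi> :: "real \<Rightarrow> 'w \<Rightarrow> real"
    and D L :: real
  defines "UU \<equiv> \<lambda>T. local_space \<Theta> \<theta>s (a T)"
    and "u_tilde \<equiv> \<lambda>T \<omega>. matrix_inv (a T) *v (quasi_bayes \<Theta> prior (H T \<omega>) - \<theta>s)"
    and "u_lim \<equiv> \<lambda>\<omega>. field_mean (apply_bcontfun (Zlim \<omega>))"
  assumes "prob_space M"
    and "subalgebra M G" and "subalgebra G C"
    and "TT \<subseteq> {0..}" and "\<not> bdd_above TT" and "T0 > 0"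
    and "open \<Theta>" and "connected \<Theta>" and "bounded \<Theta>" and "\<theta>s \<in> \<Theta>"
    and H_meas: "\<And>T. T \<in> TT \<Longrightarrow>
      (\<lambda>(\<omega>, \<theta>). H T \<omega> \<theta>) \<in> borel_measurable (M \<Otimes>\<^sub>M restrict_space borel (closure \<Theta>))"
    and H_cont: "\<And>T \<omega>. T \<in> TT \<Longrightarrow> \<omega> \<in> space M \<Longrightarrow> continuous_on (closure \<Theta>) (H T \<omega>)"
    and "\<And>T. T \<in> TT \<Longrightarrow> invertible (a T)"
    and "(a \<longlongrightarrow> 0) (at_top_in TT)"
    and "\<And>T. T \<in> TT \<Longrightarrow> is_extended_field M \<Theta> \<theta>s (a T) (H T) (Z T)"
    and "continuous_on \<Theta> prior"
    and "bdd_below (prior ` \<Theta>)" and "bdd_above (prior ` \<Theta>)" and "(INF \<theta>\<in>\<Theta>. prior \<theta>) > 0"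
    and "\<And>T. T \<in> TT \<Longrightarrow> \<Psi> T \<in> borel_measurable C"
    and "\<And>T \<omega>. T \<in> TT \<Longrightarrow> \<omega> \<in> space M \<Longrightarrow> \<Psi> T \<omega> \<in> {0..1}"
    and "is_extension M Mb \<pi>"
    and "Zlim \<in> measurable Mb (restrict_space borel C_hat)"
    and "D > real CARD('p) + 1" and "L > 1"
    and cond1: "\<exists>U \<in> borel_measurable C. \<exists>V \<in> borel_measurable C.
      \<forall>\<tau> \<in> index_seqs TT T0. \<forall>T \<in> range \<tau>. \<forall>r::nat. r \<ge> 1 \<longrightarrow>
        (AE \<omega> in M.
           conditional_prob M C (tail_event M (UU T) (Z T) (real r) (\<lambda>\<omega>. U \<omega> / real r powr D)) \<omega>
             * \<Psi> T \<omega> \<le> V \<omega> / real r powr L)"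
    and cond2: "\<And>\<epsilon> c \<tau>. \<epsilon> > 0 \<Longrightarrow> c > 0 \<Longrightarrow> \<tau> \<in> index_seqs TT T0 \<Longrightarrow>
      tendsto_in_prob M
        (\<lambda>\<delta> \<omega>. real_of_ereal (limsup (\<lambda>n. ereal
           (conditional_prob M C (modulus_event M (UU (\<tau> n)) (Z (\<tau> n)) \<delta> c \<epsilon>) \<omega> * \<Psi> (\<tau> n) \<omega>))))
        (\<lambda>\<omega>. 0) (at_right 0)"
    and cond3i: "\<And>k (u :: nat \<Rightarrow> real^'p) f Y. k \<ge> 1 \<Longrightarrow>
      continuous_map (Euclidean_space k) euclideanreal f \<Longrightarrow>
      bounded (f ` topspace (Euclidean_space k)) \<Longrightarrow>
      Y \<in> borel_measurable G \<Longrightarrow> bounded (Y ` space G) \<Longrightarrow>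
      tendsto_in_prob Mb
        (\<lambda>T \<omega>. real_cond_exp M C
           (\<lambda>\<omega>'. f (\<lambda>i. if i < k then Z T \<omega>' (u i) else 0) * \<Psi> T \<omega>' * Y \<omega>') (\<pi> \<omega>))
        (ext_cond_exp Mb \<pi> C
           (\<lambda>\<omega>. f (\<lambda>i. if i < k then apply_bcontfun (Zlim \<omega>) (u i) else 0) * Y (\<pi> \<omega>)))
        (at_top_in TT)"
    and cond3ii: "tendsto_in_prob M \<Psi> (\<lambda>\<omega>. 1) (at_top_in TT)"
  shows "(\<forall>(f :: real^'p \<Rightarrow> real) Y.
            continuous_on UNIV f \<longrightarrow> bounded (range f) \<longrightarrow>
            Y \<in> borel_measurable G \<longrightarrow> bounded (Y ` space G) \<longrightarrow>
            tendsto_in_prob Mb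
              (\<lambda>T \<omega>. real_cond_exp M C (\<lambda>\<omega>'. f (u_tilde T \<omega>') * Y \<omega>') (\<pi> \<omega>))
              (ext_cond_exp Mb \<pi> C (\<lambda>\<omega>. f (u_lim \<omega>) * Y (\<pi> \<omega>)))
              (at_top_in TT))
       \<and> stably_converges M G Mb \<pi> u_tilde u_lim (at_top_in TT)"
proof -
  note prob_M = \<open>prob_space M\<close>
  note inv = \<open>\<And>T. T \<in> TT \<Longrightarrow> invertible (a T)\<close>
  note field = \<open>\<And>T. T \<in> TT \<Longrightarrow> is_extended_field M \<Theta> \<theta>s (a T) (H T) (Z T)\<close>
  note \<Psi>_meas = \<open>\<And>T. T \<in> TT \<Longrightarrow> \<Psi> T \<in> borel_measurable C\<close>
  note \<Psi>_range = \<open>\<And>T \<omega>. T \<in> TT \<Longrightarrow> \<omega> \<in> space M \<Longrightarrow> \<Psi> T \<omega> \<in> {0..1}\<close>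
  note a_0 = \<open>(a \<longlongrightarrow> 0) (at_top_in TT)\<close>
  note \<Theta>_open = \<open>open \<Theta>\<close> and \<Theta>_bdd = \<open>bounded \<Theta>\<close> and \<theta>s = \<open>\<theta>s \<in> \<Theta>\<close>
  note prior_cont = \<open>continuous_on \<Theta> prior\<close> and D = \<open>D > real CARD('p) + 1\<close> and L = \<open>L > 1\<close>
  note TT_unbdd = \<open>\<not> bdd_above TT\<close>
  interpret E: extended_prob_space M C G Mb \<pi>
    using prob_M \<open>subalgebra M G\<close> \<open>subalgebra G C\<close> \<open>is_extension M Mb \<pi>\<close>
    by (intro extended_prob_space.intro extended_prob_space_axioms.intro)
  define pl where "pl = (INF \<theta>\<in>\<Theta>. prior \<theta>)"
  define pu where "pu = (SUP \<theta>\<in>\<Theta>. prior \<theta>)"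
  have pl: "pl > 0" "\<And>\<theta>. \<theta> \<in> \<Theta> \<Longrightarrow> pl \<le> prior \<theta>" "\<And>\<theta>. \<theta> \<in> \<Theta> \<Longrightarrow> prior \<theta> \<le> pu"
    unfolding pl_def pu_def
    using \<open>0 < (INF \<theta>\<in>\<Theta>. prior \<theta>)\<close> \<open>bdd_below (prior ` \<Theta>)\<close> \<open>bdd_above (prior ` \<Theta>)\<close>
    by (auto intro: cINF_lower cSUP_upper)
  have p0: "prior \<theta>s > 0" using pl(1) pl(2)[OF \<theta>s] by linarith
  define q where "q = (\<lambda>T u. prior (local_param \<theta>s (a T) u) / prior \<theta>s)"
  define Q where "Q = pu / prior \<theta>s"
  have UU_open: "open (UU T)" for T unfolding UU_def by (rule open_local_space[OF \<Theta>_open])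
  have UU_bdd: "bounded (UU T)" if "T \<in> TT" for T
    unfolding UU_def by (rule bounded_local_space[OF \<Theta>_bdd inv[OF that]])
  have UU_iff: "u \<in> UU T \<longleftrightarrow> local_param \<theta>s (a T) u \<in> \<Theta>" for u T
    by (simp add: UU_def local_space_def)
  have UU_0: "0 \<in> UU T" for T using \<theta>s by (simp add: UU_iff local_param_def)
  have Z_meas2: "(\<lambda>(\<omega>, u). Z T \<omega> u) \<in> borel_measurable (M \<Otimes>\<^sub>M borel)" if "T \<in> TT" for T
    using field[OF that] by (simp add: is_extended_field_def)
  have Z_meas: "(\<lambda>\<omega>. Z T \<omega> u) \<in> borel_measurable M" if "T \<in> TT" for T u
    using measurable_compose[OF measurable_Pair[OF measurable_ident_sets[OF refl] measurable_const] Z_meas2[OF that], of u]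
    by simp
  have Z_cont: "continuous_on UNIV (Z T \<omega>)" and Z_nonneg: "Z T \<omega> u \<ge> 0"
    and Z_eq: "u \<in> UU T \<Longrightarrow> Z T \<omega> u = exp (H T \<omega> (local_param \<theta>s (a T) u) - H T \<omega> \<theta>s)"
    if "T \<in> TT" "\<omega> \<in> space M" for T \<omega> u
    using field[OF that(1)] that(2) by (auto simp: is_extended_field_def UU_def)
  have Z_pos: "Z T \<omega> u > 0" if "T \<in> TT" "\<omega> \<in> space M" "u \<in> UU T" for T \<omega> u
    using Z_eq[OF that] by simp
  have Z_0: "Z T \<omega> 0 = 1" if "T \<in> TT" "\<omega> \<in> space M" for T \<omega>
    using Z_eq[OF that UU_0] by (simp add: local_param_def)
  have ln_bdd: "bounded ((\<lambda>u. ln (Z T \<omega> u)) ` UU T)" if T: "T \<in> TT" and w: "\<omega> \<in> space M" for T \<omega>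
  proof -
    have "bounded (H T \<omega> ` \<Theta>)"
      by (rule bounded_continuous_image_of_bounded[OF H_cont[OF T w] \<Theta>_bdd])
    then obtain B where B: "\<And>\<theta>. \<theta> \<in> \<Theta> \<Longrightarrow> \<bar>H T \<omega> \<theta>\<bar> \<le> B" unfolding bounded_iff by auto
    show ?thesis
    proof (rule boundedI)
      fix x assume "x \<in> (\<lambda>u. ln (Z T \<omega> u)) ` UU T"
      then obtain u where u: "u \<in> UU T" "x = ln (Z T \<omega> u)" by blast
      then have "x = H T \<omega> (local_param \<theta>s (a T) u) - H T \<omega> \<theta>s" using Z_eq[OF T w u(1)] by simp
      then show "norm x \<le> B + B" using B[OF \<theta>s] B[of "local_param \<theta>s (a T) u"] u(1) by (simp add: UU_iff)
    qed
  qed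
  have q_meas: "(\<lambda>u. indicator (UU T) u * q T u) \<in> borel_measurable borel" for T
  proof -
    have prior_meas: "(\<lambda>\<theta>. indicator \<Theta> \<theta> * prior \<theta>) \<in> borel_measurable borel"
      using borel_measurable_continuous_on_indicator[OF _ prior_cont] \<Theta>_open by simp
    have param_meas: "local_param \<theta>s (a T) \<in> borel_measurable borel"
      using continuous_local_param by (rule borel_measurable_continuous_onI)
    have "(\<lambda>u. (indicator \<Theta> (local_param \<theta>s (a T) u) * prior (local_param \<theta>s (a T) u)) / prior \<theta>s)
        \<in> borel_measurable borel"
      by (rule borel_measurable_divide[OF measurable_compose[OF param_meas prior_meas] measurable_const]) simp
    then show ?thesis by (simp add: q_def UU_def local_space_def indicator_def)
  qed
  have W: "weighted_local_field (Z T \<omega>) (UU T) (q T) Q" if "T \<in> TT" "\<omega> \<in> space M" for T \<omega>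
  proof
    show "0 \<le> q T u" "q T u \<le> Q" if "u \<in> UU T" for u
      using pl(1) pl(2,3)[of "local_param \<theta>s (a T) u"] that p0
      by (auto simp: q_def Q_def UU_iff intro!: divide_right_mono divide_nonneg_nonneg)
  qed (use Z_cont Z_nonneg Z_pos Z_0 UU_open UU_bdd q_meas that in auto)
  \<comment> \<open>On the local parameter space the extended field is the likelihood ratio, so the posterior density is \<open>Z\<close> times the prior weight.\<close>
  have u_tilde_eq: "u_tilde T \<omega> = field_mean (\<lambda>u. indicator (UU T) u * Z T \<omega> u * q T u)"
    if T: "T \<in> TT" and w: "\<omega> \<in> space M" for T \<omega>
  proof -
    have "u_tilde T \<omega> = field_mean (\<lambda>u. indicator (UU T) u *
        exp (H T \<omega> (local_param \<theta>s (a T) u) - H T \<omega> \<theta>s) * q T u)"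
      unfolding u_tilde_def UU_def q_def
      by (rule quasi_bayes_local[OF \<Theta>_open \<Theta>_bdd \<theta>s inv[OF T] H_cont[OF T w] prior_cont pl(2,3,1)])
    also have "(\<lambda>u. indicator (UU T) u * exp (H T \<omega> (local_param \<theta>s (a T) u) - H T \<omega> \<theta>s) * q T u) =
        (\<lambda>u. indicator (UU T) u * Z T \<omega> u * q T u)"
      using Z_eq[OF T w] by (auto simp: indicator_def)
    finally show ?thesis .
  qed
  define z where "z = (\<lambda>\<omega>. apply_bcontfun (Zlim \<omega>))"
  have z_meas: "(\<lambda>\<omega>. z \<omega> u) \<in> borel_measurable Mb" for u
  proof -
    have "Zlim \<in> borel_measurable Mb"
      using \<open>Zlim \<in> measurable Mb (restrict_space borel C_hat)\<close> by (rule measurable_restrict_space2_iff[THEN iffD1, THEN conjunct1])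
    then show ?thesis unfolding z_def by (rule measurable_compose[OF _ bcontfun_eval_measurable])
  qed
  have z_cont: "continuous_on UNIV (z \<omega>)" for \<omega> unfolding z_def by simp
  \<comment> \<open>Along a fixed admissible sequence all hypotheses of the unconditional approximation hold.\<close>
  have fields: "converging_fields M Mb (\<lambda>n. Z (\<tau> n)) (\<lambda>n. UU (\<tau> n)) (\<lambda>n. q (\<tau> n)) Q D z"
    and \<Psi>_L1: "(\<lambda>n. LINT \<omega>|M. \<bar>\<Psi> (\<tau> n) \<omega> - 1\<bar>) \<longlonglongrightarrow> 0"
    if \<tau>: "\<tau> \<in> index_seqs TT T0" for \<tau>
  proof -
    have T: "\<tau> n \<in> TT" "\<tau> n \<ge> T0" for n using \<tau> by (auto simp: index_seqs_def)
    have lim: "filterlim \<tau> (at_top_in TT) sequentially" by (rule index_seqs_filterlim[OF \<tau>])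
    have \<Psi>01: "0 \<le> \<Psi> (\<tau> n) \<omega> \<and> \<Psi> (\<tau> n) \<omega> \<le> 1" if "\<omega> \<in> space M" for n \<omega>
      using \<Psi>_range[OF T(1) that] by simp
    show L1: "(\<lambda>n. LINT \<omega>|M. \<bar>\<Psi> (\<tau> n) \<omega> - 1\<bar>) \<longlonglongrightarrow> 0"
    proof (rule tendsto_in_prob_imp_L1[OF prob_M tendsto_in_prob_compose[OF cond3ii lim], where B = 1])
      show "\<Psi> (\<tau> n) \<in> borel_measurable M" for n by (rule E.C_measurable[OF \<Psi>_meas[OF T(1)]])
      show "AE \<omega> in M. \<bar>\<Psi> (\<tau> n) \<omega>\<bar> \<le> 1" for n by (rule AE_I2) (use \<Psi>01 in auto)
    qed auto
    have a_lim: "(\<lambda>n. a (\<tau> n)) \<longlonglongrightarrow> 0" by (rule filterlim_compose[OF a_0 lim])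
    show "converging_fields M Mb (\<lambda>n. Z (\<tau> n)) (\<lambda>n. UU (\<tau> n)) (\<lambda>n. q (\<tau> n)) Q D z"
    proof (intro converging_fields.intro converging_fields_axioms.intro prob_M E.Mb.prob_space_axioms)
      show "(\<lambda>(\<omega>, u). Z (\<tau> n) \<omega> u) \<in> borel_measurable (M \<Otimes>\<^sub>M borel)" for n by (rule Z_meas2[OF T(1)])
      show "weighted_local_field (Z (\<tau> n) \<omega>) (UU (\<tau> n)) (q (\<tau> n)) Q" if "\<omega> \<in> space M" for n \<omega>
        by (rule W[OF T(1) that])
      show "(\<lambda>u. indicator (UU (\<tau> n)) u * q (\<tau> n) u) \<in> borel_measurable borel" for n by (rule q_meas)
      show "D > real CARD('p) + 1" by (rule D)
      show "(\<lambda>\<omega>. z \<omega> u) \<in> borel_measurable Mb" for u by (rule z_meas)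
      show "continuous_on UNIV (z \<omega>)" for \<omega> by (rule z_cont)
    next
      fix R :: real
      obtain r where r: "r > 0" "ball \<theta>s r \<subseteq> \<Theta>" using \<Theta>_open \<theta>s openE by blast
      show "eventually (\<lambda>n. ball 0 R \<subseteq> UU (\<tau> n)) sequentially"
        using scaling_uniformly_small[OF a_lim r(1), of R]
      proof eventually_elim
        case (elim n)
        show ?case
        proof
          fix u :: "real^'p" assume "u \<in> ball 0 R"
          then have "norm (a (\<tau> n) *v u) < r" using elim by simp
          then have "local_param \<theta>s (a (\<tau> n)) u \<in> ball \<theta>s r" by (simp add: local_param_def dist_norm)
          then show "u \<in> UU (\<tau> n)" using r(2) by (auto simp: UU_iff)
        qed
      qed
    next
      fix R e :: real assume e: "e > 0"
      have "e * prior \<theta>s > 0" using e p0 by simp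
      then obtain r where r: "r > 0" "\<And>\<theta>. \<theta> \<in> \<Theta> \<Longrightarrow> dist \<theta> \<theta>s < r \<Longrightarrow> dist (prior \<theta>) (prior \<theta>s) < e * prior \<theta>s"
        using prior_cont \<theta>s unfolding continuous_on_iff by blast
      obtain r' where r': "r' > 0" "ball \<theta>s r' \<subseteq> \<Theta>" using \<Theta>_open \<theta>s openE by blast
      have "min r r' > 0" using r r' by simp
      from scaling_uniformly_small[OF a_lim this, of R]
      show "eventually (\<lambda>n. \<forall>u. norm u < R \<longrightarrow> \<bar>q (\<tau> n) u - 1\<bar> \<le> e) sequentially"
      proof eventually_elim
        case (elim n)
        show ?case
        proof (intro allI impI)
          fix u :: "real^'p" assume "norm u < R"
          then have s: "norm (a (\<tau> n) *v u) < min r r'" using elim by simp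
          let ?\<theta> = "local_param \<theta>s (a (\<tau> n)) u"
          have "?\<theta> \<in> ball \<theta>s r'" using s by (simp add: local_param_def dist_norm)
          then have "dist (prior ?\<theta>) (prior \<theta>s) < e * prior \<theta>s"
            using r'(2) s by (intro r(2)) (auto simp: local_param_def dist_norm)
          moreover have "q (\<tau> n) u - 1 = (prior ?\<theta> - prior \<theta>s) / prior \<theta>s"
            using p0 by (simp add: q_def diff_divide_distrib)
          ultimately show "\<bar>q (\<tau> n) u - 1\<bar> \<le> e"
            using p0 by (simp add: dist_real_def divide_le_eq)
        qed
      qed
    next
      fix e :: real assume e: "e > 0"
      obtain U V where UV: "U \<in> borel_measurable C" "V \<in> borel_measurable C"
        "\<And>\<tau> T r. \<tau> \<in> index_seqs TT T0 \<Longrightarrow> T \<in> range \<tau> \<Longrightarrow> (r::nat) \<ge> 1 \<Longrightarrow> AE \<omega> in M.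
           conditional_prob M C (tail_event M (UU T) (Z T) (real r) (\<lambda>\<omega>. U \<omega> / real r powr D)) \<omega>
             * \<Psi> T \<omega> \<le> V \<omega> / real r powr L"
        using cond1 by blast
      have D0: "D > 0" using D by linarith
      show "\<exists>K R. K > 0 \<and> eventually (\<lambda>n. \<exists>E\<in>sets M. measure M E \<le> e \<and>
        (\<forall>\<omega>\<in>space M - E. \<forall>u\<in>UU (\<tau> n). norm u \<ge> R \<longrightarrow> Z (\<tau> n) \<omega> u \<le> K * (1 + norm u) powr (- D))) sequentially"
      proof (rule E.tightness_from_conditional_tail[OF UV(1,2) L D0, where \<psi> = "\<lambda>n. \<Psi> (\<tau> n)"])
        show "\<Psi> (\<tau> n) \<in> borel_measurable C" for n by (rule \<Psi>_meas[OF T(1)])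
        show "(\<lambda>\<omega>. Z (\<tau> n) \<omega> u) \<in> borel_measurable M" for n u by (rule Z_meas[OF T(1)])
        show "continuous_on UNIV (Z (\<tau> n) \<omega>)" if "\<omega> \<in> space M" for n \<omega> by (rule Z_cont[OF T(1) that])
        show "bounded (UU (\<tau> n))" for n by (rule UU_bdd[OF T(1)])
        show "AE \<omega> in M. conditional_prob M C
          (tail_event M (UU (\<tau> n)) (Z (\<tau> n)) (real r) (\<lambda>\<omega>. U \<omega> / real r powr D)) \<omega> * \<Psi> (\<tau> n) \<omega> \<le> V \<omega> / real r powr L"
          if "r \<ge> 1" for n r by (rule UV(3)[OF \<tau> rangeI that])
      qed (use \<Psi>01 L1 e in auto)
    next
      fix \<epsilon> c e :: real assume \<epsilon>: "\<epsilon> > 0" and c: "c > 0" and e: "e > 0"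
      define Wm where "Wm = (\<lambda>\<delta> n. modulus_event M (UU (\<tau> n)) (Z (\<tau> n)) \<delta> c \<epsilon>)"
      have Wm_sets: "Wm \<delta> n \<in> sets M" for \<delta> n unfolding Wm_def
        by (rule modulus_event_measurable) (use Z_meas Z_cont Z_pos ln_bdd T(1) in auto)
      obtain \<delta> where \<delta>: "0 < \<delta>" "\<delta> < 1" "eventually (\<lambda>n. measure M (Wm \<delta> n) \<le> e) sequentially"
      proof (rule E.equicontinuity_from_conditional_modulus[of Wm "\<lambda>n. \<Psi> (\<tau> n)" e])
        show "tendsto_in_prob M (\<lambda>\<delta> \<omega>. real_of_ereal (limsup (\<lambda>n. ereal (conditional_prob M C (Wm \<delta> n) \<omega> * \<Psi> (\<tau> n) \<omega>))))
          (\<lambda>\<omega>. 0) (at_right 0)" unfolding Wm_def by (rule cond2[OF \<epsilon> c \<tau>])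
        show "\<Psi> (\<tau> n) \<in> borel_measurable C" for n by (rule \<Psi>_meas[OF T(1)])
      qed (use Wm_sets \<Psi>01 L1 e in auto)
      have "eventually (\<lambda>n. \<exists>E\<in>sets M. measure M E \<le> e \<and>
        (\<forall>\<omega>\<in>space M - E. \<forall>u1\<in>UU (\<tau> n). \<forall>u2\<in>UU (\<tau> n). norm u1 < c \<longrightarrow> norm u2 < c \<longrightarrow> norm (u2 - u1) \<le> \<delta> \<longrightarrow>
           \<bar>ln (Z (\<tau> n) \<omega> u2) - ln (Z (\<tau> n) \<omega> u1)\<bar> \<le> \<epsilon>)) sequentially"
        using \<delta>(3)
      proof eventually_elim
        case (elim n)
        show ?case
        proof (intro bexI[of _ "Wm \<delta> n"] conjI elim ballI impI)
          fix \<omega> u1 u2 assume w: "\<omega> \<in> space M - Wm \<delta> n" and u: "u1 \<in> UU (\<tau> n)" "u2 \<in> UU (\<tau> n)"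
            "norm u1 < c" "norm u2 < c" "norm (u2 - u1) \<le> \<delta>"
          show "\<bar>ln (Z (\<tau> n) \<omega> u2) - ln (Z (\<tau> n) \<omega> u1)\<bar> \<le> \<epsilon>"
            by (rule modulus_event_complement[OF _ _ _ u]) (use w ln_bdd[OF T(1)] in \<open>auto simp: Wm_def\<close>)
        qed (rule Wm_sets)
      qed
      then show "\<exists>\<delta>. 0 < \<delta> \<and> \<delta> < 1 \<and> eventually (\<lambda>n. \<exists>E\<in>sets M. measure M E \<le> e \<and>
        (\<forall>\<omega>\<in>space M - E. \<forall>u1\<in>UU (\<tau> n). \<forall>u2\<in>UU (\<tau> n). norm u1 < c \<longrightarrow> norm u2 < c \<longrightarrow> norm (u2 - u1) \<le> \<delta> \<longrightarrow>
           \<bar>ln (Z (\<tau> n) \<omega> u2) - ln (Z (\<tau> n) \<omega> u1)\<bar> \<le> \<epsilon>)) sequentially"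
        using \<delta> by blast
    next
      fix k :: nat and v :: "nat \<Rightarrow> real^'p" and f :: "(nat \<Rightarrow> real) \<Rightarrow> real"
      assume k: "k \<ge> 1" and f: "continuous_on UNIV f" "bounded (range f)"
      obtain F where F: "F > 0" "\<And>x. \<bar>f x\<bar> \<le> F" using f(2) by (auto simp: bounded_pos)
      let ?Zf = "\<lambda>n \<omega>. f (eval_at k v (Z (\<tau> n) \<omega>))" and ?zf = "\<lambda>\<omega>. f (eval_at k v (z \<omega>))"
      have Zf_meas[measurable]: "?Zf n \<in> borel_measurable M" for n
        using Z_meas[OF T(1)] f(1) by (intro eval_at_measurable)
      have zf_meas[measurable]: "?zf \<in> borel_measurable Mb"
        using z_meas f(1) by (intro eval_at_measurable)
      have [measurable]: "\<Psi> (\<tau> n) \<in> borel_measurable M" for n by (rule E.C_measurable[OF \<Psi>_meas[OF T(1)]])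
      have bd: "\<bar>?Zf n \<omega> * \<Psi> (\<tau> n) \<omega>\<bar> \<le> F" if "\<omega> \<in> space M" for n \<omega>
        using mult_mono[of "\<bar>?Zf n \<omega>\<bar>" F "\<bar>\<Psi> (\<tau> n) \<omega>\<bar>" 1] F \<Psi>01[OF that, of n] by (simp add: abs_mult)
      have i1: "integrable M (\<lambda>\<omega>. ?Zf n \<omega> * \<Psi> (\<tau> n) \<omega>)" for n
        by (rule E.integrable_const_bound[of _ F]) (use bd in auto)
      have i2: "integrable Mb ?zf" by (rule E.Mb.integrable_const_bound[of _ F]) (use F in auto)
      have i3: "integrable M (?Zf n)" for n by (rule E.integrable_const_bound[of _ F]) (use F in auto)
      have i4: "integrable M (\<lambda>\<omega>. \<bar>\<Psi> (\<tau> n) \<omega> - 1\<bar>)" for n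
        by (rule E.integrable_const_bound[of _ 1]) (use \<Psi>01 in \<open>force\<close>)+
      have c3: "tendsto_in_prob Mb (\<lambda>n \<omega>. real_cond_exp M C (\<lambda>\<omega>'. ?Zf n \<omega>' * \<Psi> (\<tau> n) \<omega>') (\<pi> \<omega>))
          (ext_cond_exp Mb \<pi> C ?zf) sequentially"
      proof -
        have fb: "bounded (f ` topspace (Euclidean_space k))" by (rule bounded_subset[OF f(2) image_mono[OF subset_UNIV]])
        have one: "bounded ((\<lambda>_. 1 :: real) ` space G)" by (rule boundedI[of _ 1]) auto
        show ?thesis
          using tendsto_in_prob_compose[OF cond3i[OF k continuous_map_Euclidean_space[OF f(1)] fb measurable_const one, of v] lim]
          by (simp add: eval_at_def z_def)
      qed
      have ext: "ext_cond_exp Mb \<pi> C ?zf = real_cond_exp Mb E.Cb ?zf" by (simp add: ext_cond_exp_def E.Cb_def)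
      have "(\<lambda>n. LINT \<omega>|Mb. \<bar>real_cond_exp M C (\<lambda>\<omega>'. ?Zf n \<omega>' * \<Psi> (\<tau> n) \<omega>') (\<pi> \<omega>) - ext_cond_exp Mb \<pi> C ?zf \<omega>\<bar>) \<longlonglongrightarrow> 0"
      proof (rule tendsto_in_prob_imp_L1[OF E.Mb.prob_space_axioms c3, where B = F])
        show "(\<lambda>\<omega>. real_cond_exp M C (\<lambda>\<omega>'. ?Zf n \<omega>' * \<Psi> (\<tau> n) \<omega>') (\<pi> \<omega>)) \<in> borel_measurable Mb" for n
          by (rule measurable_compose[OF E.\<pi>_meas]) measurable
        show "ext_cond_exp Mb \<pi> C ?zf \<in> borel_measurable Mb" unfolding ext by measurable
        show "AE \<omega> in Mb. \<bar>real_cond_exp M C (\<lambda>\<omega>'. ?Zf n \<omega>' * \<Psi> (\<tau> n) \<omega>') (\<pi> \<omega>)\<bar> \<le> F" for n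
          by (rule E.AE_pullback, rule E.C.real_cond_exp_AE_bound[OF E.finite_measure_axioms]) (use bd in auto)
        show "AE \<omega> in Mb. \<bar>ext_cond_exp Mb \<pi> C ?zf \<omega>\<bar> \<le> F"
          unfolding ext by (rule E.Cb.real_cond_exp_AE_bound[OF E.Mb.finite_measure_axioms]) (use F in auto)
      qed
      from tendsto_add[OF this tendsto_mult_right_zero[OF L1, of F]]
      \<comment> \<open>Integrating the conditional convergence with \<open>Y = 1\<close> gives the unconditional one; the second term removes \<open>\<Psi>\<close>.\<close>
      have lim0: "(\<lambda>n. (LINT \<omega>|Mb. \<bar>real_cond_exp M C (\<lambda>\<omega>'. ?Zf n \<omega>' * \<Psi> (\<tau> n) \<omega>') (\<pi> \<omega>) - ext_cond_exp Mb \<pi> C ?zf \<omega>\<bar>) +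
          F * (LINT \<omega>|M. \<bar>\<Psi> (\<tau> n) \<omega> - 1\<bar>)) \<longlonglongrightarrow> 0" by simp
      have "\<bar>(LINT \<omega>|M. ?Zf n \<omega>) - (LINT \<omega>|Mb. ?zf \<omega>)\<bar> \<le>
          (LINT \<omega>|Mb. \<bar>real_cond_exp M C (\<lambda>\<omega>'. ?Zf n \<omega>' * \<Psi> (\<tau> n) \<omega>') (\<pi> \<omega>) - ext_cond_exp Mb \<pi> C ?zf \<omega>\<bar>) +
          F * (LINT \<omega>|M. \<bar>\<Psi> (\<tau> n) \<omega> - 1\<bar>)" for n
      proof -
        have "\<bar>(LINT \<omega>|M. ?Zf n \<omega>) - (LINT \<omega>|M. ?Zf n \<omega> * \<Psi> (\<tau> n) \<omega>)\<bar> = \<bar>LINT \<omega>|M. ?Zf n \<omega> - ?Zf n \<omega> * \<Psi> (\<tau> n) \<omega>\<bar>"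
          using i1 i3 by simp
        also have "\<dots> \<le> (LINT \<omega>|M. \<bar>?Zf n \<omega> - ?Zf n \<omega> * \<Psi> (\<tau> n) \<omega>\<bar>)" by (rule integral_abs_bound)
        also have "\<dots> \<le> (LINT \<omega>|M. F * \<bar>\<Psi> (\<tau> n) \<omega> - 1\<bar>)"
        proof (rule integral_mono)
          fix \<omega>
          have "?Zf n \<omega> - ?Zf n \<omega> * \<Psi> (\<tau> n) \<omega> = ?Zf n \<omega> * (1 - \<Psi> (\<tau> n) \<omega>)" by (simp add: algebra_simps)
          then show "\<bar>?Zf n \<omega> - ?Zf n \<omega> * \<Psi> (\<tau> n) \<omega>\<bar> \<le> F * \<bar>\<Psi> (\<tau> n) \<omega> - 1\<bar>"
            using F(2) by (simp add: abs_mult abs_minus_commute mult_right_mono)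
        qed (use i1 i3 i4 in auto)
        finally have "\<bar>(LINT \<omega>|M. ?Zf n \<omega>) - (LINT \<omega>|M. ?Zf n \<omega> * \<Psi> (\<tau> n) \<omega>)\<bar> \<le> F * (LINT \<omega>|M. \<bar>\<Psi> (\<tau> n) \<omega> - 1\<bar>)" by simp
        then show ?thesis using E.expectation_difference_le[OF i1[of n] i2] by linarith
      qed
      then have "(\<lambda>n. (LINT \<omega>|M. ?Zf n \<omega>) - (LINT \<omega>|Mb. ?zf \<omega>)) \<longlonglongrightarrow> 0"
        by (intro Lim_null_comparison[OF _ lim0] always_eventually allI) simp
      then show "(\<lambda>n. LINT \<omega>|M. ?Zf n \<omega>) \<longlonglongrightarrow> (LINT \<omega>|Mb. ?zf \<omega>)" by (simp add: LIM_zero_iff)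
    qed
  qed
  \<comment> \<open>Conditional expectations of functions of the estimator are meaningful only once it is measurable.\<close>
  have u_tilde_meas: "u_tilde T \<in> borel_measurable M" if T: "T \<in> TT" "T \<ge> T0" for T
  proof -
    obtain \<tau> n where \<tau>: "\<tau> \<in> index_seqs TT T0" "T = \<tau> n"
      by (rule index_seqs_through[OF TT_unbdd T]) blast
    interpret F: converging_fields M Mb "\<lambda>n. Z (\<tau> n)" "\<lambda>n. UU (\<tau> n)" "\<lambda>n. q (\<tau> n)" Q D z
      by (rule fields[OF \<tau>(1)])
    have "F.quasi_mean n \<in> borel_measurable M \<longleftrightarrow> u_tilde T \<in> borel_measurable M"
      by (rule measurable_cong) (simp add: F.quasi_mean_def u_tilde_eq T(1) \<tau>(2)[symmetric])
    then show ?thesis using F.quasi_mean_measurable by simp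
  qed
  obtain \<tau>0 where \<tau>0: "\<tau>0 \<in> index_seqs TT T0"
  proof -
    obtain T where T: "T \<in> TT" "T \<ge> T0" using TT_unbdd unfolding bdd_above_def by (meson linear)
    show thesis by (rule index_seqs_through[OF TT_unbdd T]) (rule that)
  qed
  have u_lim_meas: "u_lim \<in> borel_measurable Mb"
    using converging_fields.Zlim_mean_measurable[OF fields[OF \<tau>0]] by (simp add: u_lim_def z_def)
  have main: "((\<lambda>T. LINT \<omega>|Mb. \<bar>real_cond_exp M C (\<lambda>\<omega>'. f (u_tilde T \<omega>') * Y \<omega>') (\<pi> \<omega>) -
      ext_cond_exp Mb \<pi> C (\<lambda>\<omega>. f (u_lim \<omega>) * Y (\<pi> \<omega>)) \<omega>\<bar>) \<longlongrightarrow> 0) (at_top_in TT)"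
    if f: "continuous_on UNIV f" "bounded (range f)" and Y: "Y \<in> borel_measurable G" "bounded (Y ` space G)"
    for f :: "real^'p \<Rightarrow> real" and Y
  proof (rule tendsto_at_top_in_of_sequences)
    fix \<tau> assume \<tau>: "\<tau> \<in> index_seqs TT T0"
    have T: "\<tau> n \<in> TT" "\<tau> n \<ge> T0" for n using \<tau> by (auto simp: index_seqs_def)
    have lim: "filterlim \<tau> (at_top_in TT) sequentially" by (rule index_seqs_filterlim[OF \<tau>])
    interpret F: converging_fields M Mb "\<lambda>n. Z (\<tau> n)" "\<lambda>n. UU (\<tau> n)" "\<lambda>n. q (\<tau> n)" Q D z
      by (rule fields[OF \<tau>])
    have \<Psi>01: "0 \<le> \<Psi> (\<tau> n) \<omega> \<and> \<Psi> (\<tau> n) \<omega> \<le> 1" if "\<omega> \<in> space M" for n \<omega>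
      using \<Psi>_range[OF T(1) that] by simp
    obtain B where B: "B > 0" "\<And>x. \<bar>f x\<bar> \<le> B" using f(2) by (auto simp: bounded_pos)
    have [measurable]: "f \<in> borel_measurable borel" using f(1) by (rule borel_measurable_continuous_onI)
    note [measurable] = u_tilde_meas[OF T] u_lim_meas E.C_measurable[OF \<Psi>_meas[OF T(1)]]
    show "(\<lambda>n. LINT \<omega>|Mb. \<bar>real_cond_exp M C (\<lambda>\<omega>'. f (u_tilde (\<tau> n) \<omega>') * Y \<omega>') (\<pi> \<omega>) -
      ext_cond_exp Mb \<pi> C (\<lambda>\<omega>. f (u_lim \<omega>) * Y (\<pi> \<omega>)) \<omega>\<bar>) \<longlonglongrightarrow> 0"
    proof (rule E.conditional_L1_limit[where F = B, OF _ _ _ _ Y])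
      show "(\<lambda>\<omega>. f (u_tilde (\<tau> n) \<omega>)) \<in> borel_measurable M" for n by measurable
      show "(\<lambda>\<omega>. f (u_lim \<omega>)) \<in> borel_measurable Mb" by measurable
      fix e :: real assume e: "e > 0"
      have e2: "e / 2 > 0" using e by simp
      obtain k v g where g: "k \<ge> 1" "continuous_on UNIV g" "\<And>x. \<bar>g x\<bar> \<le> B"
        "eventually (\<lambda>n. (LINT \<omega>|M. \<bar>f (F.quasi_mean n \<omega>) - g (eval_at k v (Z (\<tau> n) \<omega>))\<bar>) \<le> e / 2) sequentially"
        "(LINT \<omega>|Mb. \<bar>f (field_mean (z \<omega>)) - g (eval_at k v (z \<omega>))\<bar>) \<le> e / 2"
        by (rule F.mean_approximation[OF f(1) B(2,1) e2]) blast
      have g_bdd: "bounded (range g)" by (rule boundedI[of _ B]) (use g(3) in auto)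
      \<comment> \<open>The approximation carries the factor \<open>\<Psi>\<close>, as in the hypothesis on the finite-dimensional laws.\<close>
      let ?X = "\<lambda>n \<omega>. g (eval_at k v (Z (\<tau> n) \<omega>)) * \<Psi> (\<tau> n) \<omega>" and ?X' = "\<lambda>\<omega>. g (eval_at k v (z \<omega>))"
      have [measurable]: "(\<lambda>\<omega>. g (eval_at k v (Z (\<tau> n) \<omega>))) \<in> borel_measurable M" for n
        using Z_meas[OF T(1)] g(2) by (intro eval_at_measurable)
      have zg_meas[measurable]: "?X' \<in> borel_measurable Mb"
        using z_meas g(2) by (intro eval_at_measurable)
      have bd: "\<bar>?X n \<omega>\<bar> \<le> B" if "\<omega> \<in> space M" for n \<omega>
        using mult_mono[of "\<bar>g (eval_at k v (Z (\<tau> n) \<omega>))\<bar>" B "\<bar>\<Psi> (\<tau> n) \<omega>\<bar>" 1] B g(3) \<Psi>01[OF that, of n]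
        by (simp add: abs_mult)
      have qm: "F.quasi_mean n \<omega> = u_tilde (\<tau> n) \<omega>" if "\<omega> \<in> space M" for n \<omega>
        using u_tilde_eq[OF T(1) that] by (simp add: F.quasi_mean_def)
      have "eventually (\<lambda>n. (LINT \<omega>|M. \<bar>\<Psi> (\<tau> n) \<omega> - 1\<bar>) < e / (2 * B)) sequentially"
        by (rule order_tendstoD[OF \<Psi>_L1[OF \<tau>]]) (use e B in simp)
      then have ev: "eventually (\<lambda>n. (LINT \<omega>|M. \<bar>f (u_tilde (\<tau> n) \<omega>) - ?X n \<omega>\<bar>) \<le> e) sequentially"
        using g(4)
      proof eventually_elim
        case (elim n)
        have i4: "integrable M (\<lambda>\<omega>. \<bar>\<Psi> (\<tau> n) \<omega> - 1\<bar>)"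
          by (rule E.integrable_const_bound[of _ 1]) (use \<Psi>01 in \<open>force\<close>)+
        have i5: "integrable M (\<lambda>\<omega>. f (u_tilde (\<tau> n) \<omega>))" "integrable M (\<lambda>\<omega>. g (eval_at k v (Z (\<tau> n) \<omega>)))"
          by (rule E.integrable_const_bound[of _ B], use B g(3) in auto)+
        have i6: "integrable M (?X n)" by (rule E.integrable_const_bound[of _ B]) (use bd in auto)
        have "(LINT \<omega>|M. \<bar>f (u_tilde (\<tau> n) \<omega>) - ?X n \<omega>\<bar>) \<le>
            (LINT \<omega>|M. \<bar>f (u_tilde (\<tau> n) \<omega>) - g (eval_at k v (Z (\<tau> n) \<omega>))\<bar> + B * \<bar>\<Psi> (\<tau> n) \<omega> - 1\<bar>)"
        proof (rule integral_mono)
          fix \<omega>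
          let ?g = "g (eval_at k v (Z (\<tau> n) \<omega>))"
          have "\<bar>?g - ?X n \<omega>\<bar> = \<bar>?g\<bar> * \<bar>\<Psi> (\<tau> n) \<omega> - 1\<bar>"
            by (simp add: abs_mult[symmetric] algebra_simps abs_minus_commute)
          also have "\<dots> \<le> B * \<bar>\<Psi> (\<tau> n) \<omega> - 1\<bar>" using g(3) by (intro mult_right_mono) auto
          finally show "\<bar>f (u_tilde (\<tau> n) \<omega>) - ?X n \<omega>\<bar> \<le> \<bar>f (u_tilde (\<tau> n) \<omega>) - ?g\<bar> + B * \<bar>\<Psi> (\<tau> n) \<omega> - 1\<bar>"
            by linarith
        qed (use i4 i5 i6 in auto)
        also have "\<dots> = (LINT \<omega>|M. \<bar>f (u_tilde (\<tau> n) \<omega>) - g (eval_at k v (Z (\<tau> n) \<omega>))\<bar>) + B * (LINT \<omega>|M. \<bar>\<Psi> (\<tau> n) \<omega> - 1\<bar>)"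
          using i4 i5 by simp
        also have "(LINT \<omega>|M. \<bar>f (u_tilde (\<tau> n) \<omega>) - g (eval_at k v (Z (\<tau> n) \<omega>))\<bar>) =
            (LINT \<omega>|M. \<bar>f (F.quasi_mean n \<omega>) - g (eval_at k v (Z (\<tau> n) \<omega>))\<bar>)"
          by (rule Bochner_Integration.integral_cong) (simp_all add: qm)
        also have "\<dots> + B * (LINT \<omega>|M. \<bar>\<Psi> (\<tau> n) \<omega> - 1\<bar>) \<le> e / 2 + B * (e / (2 * B))"
          using elim B by (intro add_mono mult_left_mono) auto
        also have "\<dots> = e" using B by simp
        finally show ?case .
      qed
      have "tendsto_in_prob Mb (\<lambda>n \<omega>. real_cond_exp M C (\<lambda>\<omega>'. ?X n \<omega>' * Y \<omega>') (\<pi> \<omega>))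
          (ext_cond_exp Mb \<pi> C (\<lambda>\<omega>. ?X' \<omega> * Y (\<pi> \<omega>))) sequentially"
        using tendsto_in_prob_compose[OF cond3i[OF g(1) continuous_map_Euclidean_space[OF g(2)] _ Y, of v] lim]
          bounded_subset[OF g_bdd image_mono[OF subset_UNIV]]
        by (simp add: eval_at_def z_def)
      moreover have "(LINT \<omega>|Mb. \<bar>f (u_lim \<omega>) - ?X' \<omega>\<bar>) \<le> e"
        using g(5) e by (simp add: u_lim_def z_def)
      moreover have "?X n \<in> borel_measurable M" for n by measurable
      ultimately show "\<exists>Xs' X'. (\<forall>n. Xs' n \<in> borel_measurable M) \<and> X' \<in> borel_measurable Mb \<and>
        (\<forall>n. \<forall>\<omega>\<in>space M. \<bar>Xs' n \<omega>\<bar> \<le> B) \<and> (\<forall>\<omega>. \<bar>X' \<omega>\<bar> \<le> B) \<and>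
        eventually (\<lambda>n. (LINT \<omega>|M. \<bar>f (u_tilde (\<tau> n) \<omega>) - Xs' n \<omega>\<bar>) \<le> e) sequentially \<and>
        (LINT \<omega>|Mb. \<bar>f (u_lim \<omega>) - X' \<omega>\<bar>) \<le> e \<and>
        tendsto_in_prob Mb (\<lambda>n \<omega>. real_cond_exp M C (\<lambda>\<omega>'. Xs' n \<omega>' * Y \<omega>') (\<pi> \<omega>))
          (ext_cond_exp Mb \<pi> C (\<lambda>\<omega>. X' \<omega> * Y (\<pi> \<omega>))) sequentially"
        using ev bd g(3) zg_meas by (intro exI[of _ ?X] exI[of _ ?X']) blast
    qed (rule B(2))+
  qed
  have ints: "eventually (\<lambda>T. integrable M (\<lambda>\<omega>. f (u_tilde T \<omega>) * Y \<omega>)) (at_top_in TT)"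
    "integrable Mb (\<lambda>\<omega>. f (u_lim \<omega>) * Y (\<pi> \<omega>))"
    if f: "continuous_on UNIV f" "bounded (range f)" and Y: "Y \<in> borel_measurable G" "bounded (Y ` space G)"
    for f :: "real^'p \<Rightarrow> real" and Y
  proof -
    obtain B where B: "B > 0" "\<And>x. \<bar>f x\<bar> \<le> B" using f(2) by (auto simp: bounded_pos)
    obtain B' where B': "B' > 0" "\<And>\<omega>. \<omega> \<in> space M \<Longrightarrow> \<bar>Y \<omega>\<bar> \<le> B'" by (rule E.G_bounded[OF Y(2)]) blast
    have [measurable]: "f \<in> borel_measurable borel" using f(1) by (rule borel_measurable_continuous_onI)
    note [measurable] = u_lim_meas E.G_measurable[OF Y(1)]
    have "integrable M (\<lambda>\<omega>. f (u_tilde T \<omega>) * Y \<omega>)" if "T \<in> TT" "T \<ge> T0" for T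
    proof (rule E.integrable_const_bound[of _ "B * B'"])
      note [measurable] = u_tilde_meas[OF that]
      show "(\<lambda>\<omega>. f (u_tilde T \<omega>) * Y \<omega>) \<in> borel_measurable M" by measurable
      show "AE \<omega> in M. norm (f (u_tilde T \<omega>) * Y \<omega>) \<le> B * B'"
        by (rule AE_I2) (use B B' in \<open>auto simp: abs_mult intro!: mult_mono\<close>)
    qed
    then show "eventually (\<lambda>T. integrable M (\<lambda>\<omega>. f (u_tilde T \<omega>) * Y \<omega>)) (at_top_in TT)"
      unfolding eventually_at_top_in by blast
    show "integrable Mb (\<lambda>\<omega>. f (u_lim \<omega>) * Y (\<pi> \<omega>))"
    proof (rule E.Mb.integrable_const_bound[of _ "B * B'"])
      show "AE \<omega> in Mb. norm (f (u_lim \<omega>) * Y (\<pi> \<omega>)) \<le> B * B'"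
        by (rule AE_I2) (use B B'(1) B'(2)[OF measurable_space[OF E.\<pi>_meas]] in \<open>auto simp: abs_mult intro!: mult_mono\<close>)
    qed measurable
  qed
  show ?thesis
    unfolding stably_converges_def
  proof (intro conjI allI impI)
    fix f :: "real^'p \<Rightarrow> real" and Y :: "'w \<Rightarrow> real"
    assume f: "continuous_on UNIV f" "bounded (range f)" and Y: "Y \<in> borel_measurable G" "bounded (Y ` space G)"
    note ints = ints[OF f Y]
    show "tendsto_in_prob Mb (\<lambda>T \<omega>. real_cond_exp M C (\<lambda>\<omega>'. f (u_tilde T \<omega>') * Y \<omega>') (\<pi> \<omega>))
       (ext_cond_exp Mb \<pi> C (\<lambda>\<omega>. f (u_lim \<omega>) * Y (\<pi> \<omega>))) (at_top_in TT)"
    proof (rule L1_imp_tendsto_in_prob[OF E.Mb.prob_space_axioms _ _ main[OF f Y]])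
      show "eventually (\<lambda>T. integrable Mb (\<lambda>\<omega>. real_cond_exp M C (\<lambda>\<omega>'. f (u_tilde T \<omega>') * Y \<omega>') (\<pi> \<omega>))) (at_top_in TT)"
        using ints(1) by eventually_elim (intro E.integrable_pullback E.C.real_cond_exp_int(1))
      show "integrable Mb (ext_cond_exp Mb \<pi> C (\<lambda>\<omega>. f (u_lim \<omega>) * Y (\<pi> \<omega>)))"
        unfolding ext_cond_exp_def E.Cb_def[symmetric] by (rule E.Cb.real_cond_exp_int(1)[OF ints(2)])
    qed
    have "((\<lambda>T. (\<integral>\<omega>. f (u_tilde T \<omega>) * Y \<omega> \<partial>M) - (\<integral>\<omega>. f (u_lim \<omega>) * Y (\<pi> \<omega>) \<partial>Mb)) \<longlongrightarrow> 0) (at_top_in TT)"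
    proof (rule Lim_null_comparison[OF _ main[OF f Y]])
      show "eventually (\<lambda>T. norm ((\<integral>\<omega>. f (u_tilde T \<omega>) * Y \<omega> \<partial>M) - (\<integral>\<omega>. f (u_lim \<omega>) * Y (\<pi> \<omega>) \<partial>Mb)) \<le>
        (LINT \<omega>|Mb. \<bar>real_cond_exp M C (\<lambda>\<omega>'. f (u_tilde T \<omega>') * Y \<omega>') (\<pi> \<omega>) -
          ext_cond_exp Mb \<pi> C (\<lambda>\<omega>. f (u_lim \<omega>) * Y (\<pi> \<omega>)) \<omega>\<bar>)) (at_top_in TT)"
        using ints(1) by eventually_elim (use E.expectation_difference_le ints(2) in simp)
    qed
    then show "((\<lambda>T. \<integral>\<omega>. f (u_tilde T \<omega>) * Y \<omega> \<partial>M) \<longlongrightarrow> (\<integral>\<omega>. f (u_lim \<omega>) * Y (\<pi> \<omega>) \<partial>Mb)) (at_top_in TT)"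
      by (simp add: LIM_zero_iff)
  qed
qed

end
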